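(* Let $n\ge 2$, let $\mathbb{S}^n\subset\mathbb{R}^{n+1}$ be the unit sphere with its canonical Riemannian metric, geodesic distance $d$ and Riemannian volume $\mathrm{vol}_n$, and fix $o\in\mathbb{S}^n$. Say that a pair $(K_1,K_2)$ of subsets of $B(o,\pi/2)$ satisfies the spherical correlation inequality if $$\mathrm{vol}_n(K_1\cap K_2)\,\mathrm{vol}_n(B(o,\pi/2))\ \ge\ \mathrm{vol}_n(K_1)\,\mathrm{vol}_n(K_2).$$ Then: (i) If $K$ is an open geodesically convex subset of $B(o,\pi/2)$ which is centrally symmetric around $o$ and $0<r\le\pi/2$, then the pair $(B(o,r),K)$ satisfies the spherical correlation inequality. (ii) Let $1\le k\le n-1$ and $0<\varepsilon\le\pi/2$. Let $E\subset\mathbb{R}^{n+1}$ be a $(k+1)$-dimensional linear subspace containing $o$, $\mathbb{S}^k_o=\mathbb{S}^n\cap E$, and $\mathbb{S}^{n-k-1}=\mathbb{S}^n\cap E^{\perp}$. Let $X_k\subset \mathbb{S}^k_o$ be a $k$-dimensional geodesically convex set contained in the open hemisphere of $\mathbb{S}^k_o$ centered at $o$, containing $o$ and centrally symmetric around $o$, and let $X_n=X_k*\mathbb{S}^{n-k-1}=\{\cos(t)u+\sin(t)v:\ u\in X_k,\ v\in\mathbb{S}^{n-k-1},\ t\in[0,\pi/2]\}$. Let $Y=(\mathbb{S}^k_o+\varepsilon)\cap B(o,\pi/2)$. Then equality holds: $\mathrm{vol}_n(X_n\cap Y)\,\mathrm{vol}_n(B(o,\pi/2))=\mathrm{vol}_n(X_n)\,\mathrm{vol}_n(Y)$.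 (iii) Suppose there is an integer $N$ such that for every $n\ge N$, every pair of open geodesically convex subsets of the hemisphere $B(o,\pi/2)\subset\mathbb{S}^n$ that are both centrally symmetric around $o$ satisfies the spherical correlation inequality. Then for every dimension $n\ge1$, every such pair in $B(o,\pi/2)\subset\mathbb{S}^n$ satisfies the spherical correlation inequality. (iv) If $X$ is an open geodesically convex subset of $B(o,\pi/2)$ which is centrally symmetric around $o$, $1\le k\le n-1$, $\mathbb{S}^k_o$ is a $k$-dimensional totally geodesic subsphere of $\mathbb{S}^n$ containing $o$, $\varepsilon>0$, and $Y=(\mathbb{S}^k_o+\varepsilon)\cap B(o,\pi/2)$, then the pair $(X,Y)$ satisfies the spherical correlation inequality.
   Context: $B(x,r)=\{y\in\mathbb{S}^n: d(x,y)<r\}$; $B(o,\pi/2)$ is the open hemisphere centered at $o$. A set $S\subset B(o,\pi/2)$ is geodesically convex if for any two points of $S$ the minimizing geodesic segment joining them lies in $S$. A convex set $S$ is centrally symmetric around a point $x$ in its interior if for every geodesic $\sigma$ through $x$, with $\sigma\cap\partial S=\{x_b^+,x_b^-\}$, the geodesic segments $[x,x_b^+]$ and $[x,x_b^-]$ have equal length (equivalently, $S$ is invariant under the geodesic reflection at $x$). For $Y\subset\mathbb{S}^n$ and $\varepsilon>0$, $Y+\varepsilon=\{x\in\mathbb{S}^n: d(x,Y)\le\varepsilon\}$. A $k$-dimensional totally geodesic subsphere is a set $\mathbb{S}^n\cap E$ with $E$ a $(k+1)$-dimensional linear subspace of $\mathbb{R}^{n+1}$. Sets in (ii), (iii) are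 understood in the respective dimensional spheres with the same conventions. *)

theory Defs
  imports "HOL-Analysis.Analysis"
begin

text \<open>Points of R^(n+1) are represented as extensional functions nat => real
  on the index set {..n} (so that the dimension n can vary inside a statement).\<close>

definition Rsp :: "nat \<Rightarrow> (nat \<Rightarrow> real) set" where
  "Rsp n = PiE {..n} (\<lambda>_. UNIV)"

definition ip :: "nat \<Rightarrow> (nat \<Rightarrow> real) \<Rightarrow> (nat \<Rightarrow> real) \<Rightarrow> real" where
  "ip n x y = (\<Sum>i\<le>n. x i * y i)"

definition sph :: "nat \<Rightarrow> (nat \<Rightarrow> real) set" where
  "sph n = {x \<in> Rsp n. ip n x x = 1}"

definition sdist :: "nat \<Rightarrow> (nat \<Rightarrow> real) \<Rightarrow> (nat \<Rightarrow> real) \<Rightarrow> real" where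
  "sdist n x y = arccos (ip n x y)"

definition sball :: "nat \<Rightarrow> (nat \<Rightarrow> real) \<Rightarrow> real \<Rightarrow> (nat \<Rightarrow> real) set" where
  "sball n x r = {y \<in> sph n. sdist n x y < r}"

definition sthick :: "nat \<Rightarrow> (nat \<Rightarrow> real) set \<Rightarrow> real \<Rightarrow> (nat \<Rightarrow> real) set" where
  "sthick n Y e = {x \<in> sph n. (INF y\<in>Y. sdist n x y) \<le> e}"

definition lebR :: "nat \<Rightarrow> (nat \<Rightarrow> real) measure" where
  "lebR n = completion (PiM {..n} (\<lambda>_. lborel))"

definition scone :: "nat \<Rightarrow> (nat \<Rightarrow> real) set \<Rightarrow> (nat \<Rightarrow> real) set" where
  "scone n A = {restrict (\<lambda>i. t * x i) {..n} | x t. x \<in> A \<and> 0 < t \<and> t \<le> 1}"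

text \<open>Riemannian volume on S^n: vol_n(A) = (n+1) * Lebesgue measure of the cone over A.\<close>
definition svol :: "nat \<Rightarrow> (nat \<Rightarrow> real) set \<Rightarrow> real" where
  "svol n A = real (n + 1) * measure (lebR n) (scone n A)"

text \<open>Minimizing geodesic segment between two non-antipodal points of S^n
  (the minor great-circle arc = unit vectors in the cone spanned by x and y).\<close>
definition gseg :: "nat \<Rightarrow> (nat \<Rightarrow> real) \<Rightarrow> (nat \<Rightarrow> real) \<Rightarrow> (nat \<Rightarrow> real) set" where
  "gseg n x y = {z \<in> sph n. \<exists>a b. 0 \<le> a \<and> 0 \<le> b \<and>
                    z = restrict (\<lambda>i. a * x i + b * y i) {..n}}"

definition gconvex :: "nat \<Rightarrow> (nat \<Rightarrow> real) set \<Rightarrow> bool" where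
  "gconvex n S \<longleftrightarrow> (\<forall>x\<in>S. \<forall>y\<in>S. gseg n x y \<subseteq> S)"

definition sopen :: "nat \<Rightarrow> (nat \<Rightarrow> real) set \<Rightarrow> bool" where
  "sopen n S \<longleftrightarrow> S \<subseteq> sph n \<and> (\<forall>x\<in>S. \<exists>e>0. sball n x e \<subseteq> S)"

definition srefl :: "nat \<Rightarrow> (nat \<Rightarrow> real) \<Rightarrow> (nat \<Rightarrow> real) \<Rightarrow> (nat \<Rightarrow> real)" where
  "srefl n c x = restrict (\<lambda>i. 2 * ip n x c * c i - x i) {..n}"

text \<open>S is centrally symmetric around c, c lying in the interior of S relative to
  the ambient sphere M (M = S^n, or a totally geodesic subsphere).\<close>
definition csym :: "nat \<Rightarrow> (nat \<Rightarrow> real) set \<Rightarrow> (nat \<Rightarrow> real) \<Rightarrow> (nat \<Rightarrow> real) set \<Rightarrow> bool" where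
  "csym n M c S \<longleftrightarrow> (\<exists>e>0. sball n c e \<inter> M \<subseteq> S) \<and> (\<forall>x\<in>S. srefl n c x \<in> S)"

definition lsubspace :: "nat \<Rightarrow> nat \<Rightarrow> (nat \<Rightarrow> real) set \<Rightarrow> bool" where
  "lsubspace n d E \<longleftrightarrow> (\<exists>b. (\<forall>j<d. b j \<in> Rsp n) \<and>
      (\<forall>c. (\<forall>i\<le>n. (\<Sum>j<d. c j * b j i) = 0) \<longrightarrow> (\<forall>j<d. c j = 0)) \<and>
      E = {restrict (\<lambda>i. \<Sum>j<d. c j * b j i) {..n} | c. True})"

definition orthc :: "nat \<Rightarrow> (nat \<Rightarrow> real) set \<Rightarrow> (nat \<Rightarrow> real) set" where
  "orthc n E = {x \<in> Rsp n. \<forall>y\<in>E. ip n x y = 0}"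

definition SCI :: "nat \<Rightarrow> (nat \<Rightarrow> real) \<Rightarrow> (nat \<Rightarrow> real) set \<Rightarrow> (nat \<Rightarrow> real) set \<Rightarrow> bool" where
  "SCI n c K1 K2 \<longleftrightarrow>
     svol n (K1 \<inter> K2) * svol n (sball n c (pi/2)) \<ge> svol n K1 * svol n K2"

definition good_set :: "nat \<Rightarrow> (nat \<Rightarrow> real) \<Rightarrow> (nat \<Rightarrow> real) set \<Rightarrow> bool" where
  "good_set n c K \<longleftrightarrow> sopen n K \<and> gconvex n K \<and> K \<subseteq> sball n c (pi/2) \<and> csym n (sph n) c K"

end

theory Submission
  imports Defs
begin

text \<open>
  Spherical volumes are Lebesgue volumes of cones. Let \<open>C\<close> be the cone over \<open>X\<close>, rotated so that the centre
  is the first basis vector and the subsphere is spanned by the first \<open>m\<close> ones, and write points as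
  \<open>(p, q)\<close> with \<open>p\<close> in the span. The tube is the cone \<open>\<kappa> |q| \<le> |p|\<close>, where \<open>\<kappa>\<close> is the cotangent of its radius.
  For fixed \<open>q\<close>, the volume of \<open>{p. (p, h q) \<in> C, |p| < 1}\<close> is nonincreasing in \<open>h \<ge> 0\<close>: these are the sections
  of a convex set invariant under \<open>(p\<^sub>0, p', h) \<mapsto> (p\<^sub>0, - p', - h)\<close>, and Steiner symmetrization in the
  coordinates \<open>p'\<close> reduces this to an inclusion of sections. By homogeneity the volume
  of \<open>{p. (p, q) \<in> C, |p| < \<rho>}\<close> divided by \<open>\<rho>\<^sup>m\<close> is then nondecreasing in \<open>\<rho>\<close>, so its value \<open>J q\<close> at the threshold
  \<open>\<rho> = \<kappa> |q|\<close> bounds the density of \<open>C\<close> from below inside the tube and from above outside. As \<open>J\<close> is constant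
  along rays, its average does not depend on the radial weight, and this gives the inequality for tubes;
  balls are the case \<open>m = 1\<close>. For joins, and for the passage from high to low dimension, the slices in \<open>p\<close> are those of
  a cone that does not depend on \<open>q\<close>, so the volumes factor.
\<close>

text \<open>The centre lies in the span of the first \<open>m\<close> basis vectors, so the
  hemisphere is a cylinder over a half-space in \<open>p\<close>. There the tube takes exactly the
  share given by the radial weights, and the inequality says that its share of \<open>C\<close> is
  no smaller. The comparison is cut at the threshold radius because on both sides of it the slice of
  \<open>C\<close> is measured against the same power law \<open>J q * \<rho>^m\<close>, which
  replaces \<open>C\<close> by a function of the direction of \<open>q\<close> alone. The coordinate
  \<open>p\<^sub>0\<close> is exempt from symmetrization because the geodesic reflection
  \<open>x \<mapsto> 2 (ip x o) o - x\<close> keeps it and negates all the others. Monotonicity of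
  the sections is a statement of Brunn-Minkowski type; symmetrizing one coordinate at a time calls
  for it only on the line, where it concerns intervals. Measurability is a separate obstacle: the
  convex sets of the join statement are not assumed open and need not be Borel. Volumes are
  therefore taken in the completed measure, and cones over such sets are enclosed between two Borel
  cones of equal volume.\<close>

abbreviation Leb :: "nat set \<Rightarrow> (nat \<Rightarrow> real) measure" where
  "Leb I \<equiv> PiM I (\<lambda>_. lborel)"

abbreviation vol :: "nat set \<Rightarrow> (nat \<Rightarrow> real) set \<Rightarrow> ennreal" where
  "vol I \<equiv> emeasure (Leb I)"

interpretation leb: product_sigma_finite "\<lambda>_::nat. lborel :: real measure"
  by standard

abbreviation nrm :: "nat set \<Rightarrow> (nat \<Rightarrow> real) \<Rightarrow> real" where
  "nrm I x \<equiv> L2_set x I"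

section \<open>Product Lebesgue measure and Euclidean norms on finite index sets\<close>

lemma sigma_finite_Leb: "finite I \<Longrightarrow> sigma_finite_measure (Leb I)"
  by (rule leb.sigma_finite)

lemma space_Leb: "space (Leb I) = PiE I (\<lambda>_. UNIV)"
  by (simp add: space_PiM)

lemma measurable_nrm [measurable]: "nrm I \<in> borel_measurable (Leb I)"
  unfolding L2_set_def by measurable

lemma measurable_nrm_sub: "J \<subseteq> I \<Longrightarrow> nrm J \<in> borel_measurable (Leb I)"
proof -
  assume J: "J \<subseteq> I"
  have [measurable]: "(\<lambda>x. x i) \<in> borel_measurable (Leb I)" if "i \<in> J" for i
    using measurable_component_singleton[of i I "\<lambda>_. lborel :: real measure"] J that by auto
  show ?thesis unfolding L2_set_def by measurable
qed

lemma nrm_scale: "0 \<le> t \<Longrightarrow> nrm I (\<lambda>i\<in>I. t * x i) = t * nrm I x"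
  by (simp add: L2_set_def power_mult_distrib flip: sum_distrib_left)
     (simp add: real_sqrt_mult)

lemma abs_le_nrm: "finite I \<Longrightarrow> i \<in> I \<Longrightarrow> \<bar>x i\<bar> \<le> nrm I x"
  using member_le_L2_set[of I i "\<lambda>i. \<bar>x i\<bar>"] by (simp add: L2_set_def)

subsection \<open>Affine maps of the product Lebesgue measure\<close>

text \<open>Dilations (\<open>a = 0\<close>) and translations (\<open>t = 1\<close>) are the two
  cases in use; one map for both means one change of variables.\<close>

definition affm :: "nat set \<Rightarrow> real \<Rightarrow> (nat \<Rightarrow> real) \<Rightarrow> (nat \<Rightarrow> real) \<Rightarrow> nat \<Rightarrow> real" where
  "affm I t a x = (\<lambda>i\<in>I. a i + t * x i)"

lemma measurable_affm [measurable]: "affm I t a \<in> measurable (Leb I) (Leb I)"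
  unfolding affm_def by measurable

lemma emeasure_lborel_affine:
  assumes "(t::real) \<noteq> 0" "A \<in> sets borel"
  shows "emeasure lborel A = ennreal \<bar>t\<bar> * emeasure lborel {x. a + t * x \<in> A}"
proof -
  have "emeasure lborel A = emeasure (density (distr lborel borel (\<lambda>x. a + t * x)) (\<lambda>_. ennreal (abs t))) A"
    using lborel_real_affine[OF assms(1), of a] by simp
  also have "\<dots> = \<bar>t\<bar> * emeasure (distr lborel borel (\<lambda>x. a + t * x)) A"
    using assms(2) by (subst emeasure_density_const) auto
  also have "emeasure (distr lborel borel (\<lambda>x. a + t * x)) A = emeasure lborel {x. a + t * x \<in> A}"
    using assms(2) by (subst emeasure_distr) (auto simp: vimage_def)
  finally show ?thesis .
qed

text \<open>A product measure is determined by its values on boxes. The preimage of a box is again a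
  box, and each coordinate contributes one factor \<open>\<bar>t\<bar>\<close>.\<close>

lemma Leb_affine:
  assumes "finite I" "t \<noteq> 0"
  shows "density (distr (Leb I) (Leb I) (affm I t a)) (\<lambda>_. ennreal (\<bar>t\<bar> ^ card I)) = Leb I"
proof (rule leb.PiM_eqI[OF assms(1)])
  fix A :: "nat \<Rightarrow> real set" assume A: "\<And>i. i \<in> I \<Longrightarrow> A i \<in> sets lborel"
  have S: "PiE I A \<in> sets (Leb I)" using A assms(1) by (intro sets_PiM_I_finite) auto
  have pre: "affm I t a -` PiE I A \<inter> space (Leb I) = PiE I (\<lambda>i. {x. a i + t * x \<in> A i})"
    by (auto simp: affm_def space_Leb PiE_iff)
  have m: "{x. a i + t * x \<in> A i} \<in> sets lborel" if "i \<in> I" for i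
    using measurable_sets[of "\<lambda>x. a i + t * x" lborel lborel "A i"] A[OF that]
    by (simp add: vimage_def)
  have "emeasure (density (distr (Leb I) (Leb I) (affm I t a)) (\<lambda>_. ennreal (\<bar>t\<bar> ^ card I))) (PiE I A)
     = ennreal (\<bar>t\<bar> ^ card I) * vol I (PiE I (\<lambda>i. {x. a i + t * x \<in> A i}))"
    using S by (subst emeasure_density_const) (auto simp: emeasure_distr pre)
  also have "\<dots> = ennreal (\<bar>t\<bar> ^ card I) * (\<Prod>i\<in>I. emeasure lborel {x. a i + t * x \<in> A i})"
    using m by (subst leb.emeasure_PiM[OF assms(1)]) auto
  also have "\<dots> = (\<Prod>i\<in>I. ennreal \<bar>t\<bar> * emeasure lborel {x. a i + t * x \<in> A i})"
    by (simp add: prod.distrib flip: ennreal_power)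
  also have "\<dots> = (\<Prod>i\<in>I. emeasure lborel (A i))"
    using A by (intro prod.cong emeasure_lborel_affine[symmetric] assms) auto
  finally show "emeasure (density (distr (Leb I) (Leb I) (affm I t a)) (\<lambda>_. ennreal (\<bar>t\<bar> ^ card I))) (PiE I A)
    = (\<Prod>i\<in>I. emeasure lborel (A i))" .
qed simp

lemma nn_integral_affm:
  assumes "finite I" "t \<noteq> 0" and f[measurable]: "f \<in> borel_measurable (Leb I)"
  shows "(\<integral>\<^sup>+x. f x \<partial>Leb I) = ennreal (\<bar>t\<bar> ^ card I) * (\<integral>\<^sup>+x. f (affm I t a x) \<partial>Leb I)"
proof -
  have "(\<integral>\<^sup>+x. f x \<partial>Leb I) = (\<integral>\<^sup>+x. f x \<partial>density (distr (Leb I) (Leb I) (affm I t a)) (\<lambda>_. ennreal (\<bar>t\<bar> ^ card I)))"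
    using Leb_affine[OF assms(1,2)] by simp
  also have "\<dots> = (\<integral>\<^sup>+x. ennreal (\<bar>t\<bar> ^ card I) * f (affm I t a x) \<partial>Leb I)"
    by (subst nn_integral_density) (auto simp: nn_integral_distr)
  finally show ?thesis by (simp add: nn_integral_cmult)
qed

lemma emeasure_affm:
  assumes "finite I" "t \<noteq> 0" and A: "A \<in> sets (Leb I)"
  shows "vol I A = ennreal (\<bar>t\<bar> ^ card I) * vol I {x \<in> space (Leb I). affm I t a x \<in> A}"
proof -
  have "vol I A = emeasure (density (distr (Leb I) (Leb I) (affm I t a)) (\<lambda>_. ennreal (\<bar>t\<bar> ^ card I))) A"
    using Leb_affine[OF assms(1,2)] by simp
  also have "\<dots> = ennreal (\<bar>t\<bar> ^ card I) * vol I (affm I t a -` A \<inter> space (Leb I))"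
    using A by (subst emeasure_density_const) (auto simp: emeasure_distr)
  also have "affm I t a -` A \<inter> space (Leb I) = {x \<in> space (Leb I). affm I t a x \<in> A}" by auto
  finally show ?thesis .
qed

subsection \<open>Balls and cones\<close>

lemma emeasure_ball_finite:
  assumes "finite I"
  shows "vol I {x \<in> space (Leb I). nrm I x \<le> r} < \<infinity>"
proof -
  have "{x \<in> space (Leb I). nrm I x \<le> r} \<subseteq> PiE I (\<lambda>_. {-r..r})"
  proof
    fix x assume x: "x \<in> {x \<in> space (Leb I). nrm I x \<le> r}"
    have "x i \<in> {-r..r}" if "i \<in> I" for i
      using abs_le_nrm[OF assms that, of x] x by auto
    then show "x \<in> PiE I (\<lambda>_. {-r..r})" using x by (auto simp: space_Leb PiE_iff)
  qed
  then have "vol I {x \<in> space (Leb I). nrm I x \<le> r} \<le> vol I (PiE I (\<lambda>_. {-r..r}))"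
    using assms by (intro emeasure_mono sets_PiM_I_finite) auto
  also have "\<dots> < \<infinity>"
    using assms by (subst leb.emeasure_PiM) (auto simp: emeasure_lborel_Icc_eq less_top[symmetric] power_eq_top_ennreal)
  finally show ?thesis .
qed

lemma emeasure_ball_pos:
  assumes "finite I" "r > 0"
  shows "vol I {x \<in> space (Leb I). nrm I x < r} > 0"
proof -
  \<comment> \<open>The Euclidean norm is at most the sum of the absolute values, so a cube of this
    side fits into the ball. The added 1 makes the inequality strict and covers empty
    \<open>I\<close>.\<close>
  define d where "d = r / (real (card I) + 1)"
  have d: "d > 0" using assms by (simp add: d_def)
  have "PiE I (\<lambda>_. {0..d}) \<subseteq> {x \<in> space (Leb I). nrm I x < r}"
  proof
    fix x :: "nat \<Rightarrow> real" assume x: "x \<in> PiE I (\<lambda>_. {0..d})"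
    have "nrm I x \<le> (\<Sum>i\<in>I. \<bar>x i\<bar>)" by (rule L2_set_le_sum_abs)
    also have "\<dots> \<le> (\<Sum>i\<in>I. d)" using x by (intro sum_mono) (force simp: PiE_iff)
    also have "\<dots> = real (card I) * d" by simp
    also have "\<dots> < r" using assms by (simp add: d_def field_simps)
    finally show "x \<in> {x \<in> space (Leb I). nrm I x < r}" using x by (auto simp: space_Leb PiE_iff)
  qed
  then have "vol I (PiE I (\<lambda>_. {0..d})) \<le> vol I {x \<in> space (Leb I). nrm I x < r}"
    by (intro emeasure_mono) auto
  moreover have "vol I (PiE I (\<lambda>_. {0..d})) > 0"
    using assms d by (subst leb.emeasure_PiM) (auto simp: zero_less_iff_neq_zero)
  ultimately show ?thesis by order
qed

text \<open>Only \<open>t > 0\<close> is asked for, so the origin may or may not belong to the set.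
  The inclusion in \<open>PiE\<close> keeps the points extensional, as points of
  \<open>Leb I\<close> are.\<close>

definition homog :: "nat set \<Rightarrow> (nat \<Rightarrow> real) set \<Rightarrow> bool" where
  "homog I K \<longleftrightarrow> K \<subseteq> PiE I (\<lambda>_. UNIV) \<and> (\<forall>x\<in>K. \<forall>t>0. (\<lambda>i\<in>I. t * x i) \<in> K)"

lemma homog_scale_iff:
  assumes "homog I K" "t > 0" "x \<in> PiE I (\<lambda>_. UNIV)"
  shows "(\<lambda>i\<in>I. t * x i) \<in> K \<longleftrightarrow> x \<in> K"
proof
  assume "(\<lambda>i\<in>I. t * x i) \<in> K"
  moreover have "1 / t > 0" using assms by simp
  ultimately have "(\<lambda>i\<in>I. (1/t) * (\<lambda>i\<in>I. t * x i) i) \<in> K" using assms(1) unfolding homog_def by blast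
  also have "(\<lambda>i\<in>I. (1/t) * (\<lambda>i\<in>I. t * x i) i) = x" using assms by (auto simp: PiE_iff extensional_def)
  finally show "x \<in> K" .
qed (use assms in \<open>auto simp: homog_def\<close>)

lemma cone_ball_scale:
  assumes "finite I" "homog I K" and K[measurable]: "K \<in> sets (Leb I)" and "t > 0"
  shows "vol I {x \<in> K. nrm I x < t * r} = ennreal (t ^ card I) * vol I {x \<in> K. nrm I x < r}"
    and "vol I {x \<in> K. nrm I x \<le> t * r} = ennreal (t ^ card I) * vol I {x \<in> K. nrm I x \<le> r}"
proof -
  have sub: "K \<subseteq> PiE I (\<lambda>_. UNIV)" using assms by (auto simp: homog_def)
  have iff: "affm I t (\<lambda>_. 0) x \<in> K \<longleftrightarrow> x \<in> K" "nrm I (affm I t (\<lambda>_. 0) x) = t * nrm I x"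
    if "x \<in> space (Leb I)" for x
    using homog_scale_iff[OF assms(2,4), of x] nrm_scale[of t x I] that assms(4)
    by (auto simp: affm_def space_Leb)
  have 1: "{x \<in> K. nrm I x < s} \<in> sets (Leb I)" "{x \<in> K. nrm I x \<le> s} \<in> sets (Leb I)" for s
  proof -
    have "{x \<in> K. nrm I x < s} = K \<inter> {x\<in>space (Leb I). nrm I x < s}"
      "{x \<in> K. nrm I x \<le> s} = K \<inter> {x\<in>space (Leb I). nrm I x \<le> s}" using sub by (auto simp: space_Leb)
    then show "{x \<in> K. nrm I x < s} \<in> sets (Leb I)" "{x \<in> K. nrm I x \<le> s} \<in> sets (Leb I)" by auto
  qed
  have "{x \<in> space (Leb I). affm I t (\<lambda>_. 0) x \<in> {x \<in> K. nrm I x < t * r}} = {x \<in> K. nrm I x < r}"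
    "{x \<in> space (Leb I). affm I t (\<lambda>_. 0) x \<in> {x \<in> K. nrm I x \<le> t * r}} = {x \<in> K. nrm I x \<le> r}"
    using iff assms(4) sub by (auto simp: space_Leb)
  then show "vol I {x \<in> K. nrm I x < t * r} = ennreal (t ^ card I) * vol I {x \<in> K. nrm I x < r}"
    "vol I {x \<in> K. nrm I x \<le> t * r} = ennreal (t ^ card I) * vol I {x \<in> K. nrm I x \<le> r}"
    using emeasure_affm[OF assms(1) _ 1(1), of t "t*r" "\<lambda>_. 0"] emeasure_affm[OF assms(1) _ 1(2), of t "t*r" "\<lambda>_. 0"] assms(4)
    by auto
qed

subsection \<open>Rotation invariance\<close>

text \<open>Uniqueness of Haar measure: with \<open>B\<close> the unit ball, Fubini applied to the set of all \<open>(x, y)\<close> with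
  \<open>x \<in> A\<close> and \<open>T y - x \<in> B\<close> gives \<open>vol A * vol B = vol B * vol (T -` A)\<close>.\<close>

lemma distr_additive_isometry_Leb:
  assumes I: "finite I" and T[measurable]: "T \<in> measurable (Leb I) (Leb I)"
    and add: "\<And>a x. a \<in> space (Leb I) \<Longrightarrow> x \<in> space (Leb I) \<Longrightarrow> T (affm I 1 a x) = affm I 1 (T a) (T x)"
    and surj: "\<And>y. y \<in> space (Leb I) \<Longrightarrow> \<exists>x\<in>space (Leb I). T x = y"
    and iso: "\<And>x. x \<in> space (Leb I) \<Longrightarrow> nrm I (T x) = nrm I x"
  shows "distr (Leb I) (Leb I) T = Leb I"
proof (rule measure_eqI)
  fix A assume "A \<in> sets (distr (Leb I) (Leb I) T)"
  then have A[measurable]: "A \<in> sets (Leb I)" by simp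
  interpret S: sigma_finite_measure "Leb I" by (rule sigma_finite_Leb[OF I])
  interpret P: pair_sigma_finite "Leb I" "Leb I" ..
  define B :: "(nat \<Rightarrow> real) set" where "B = {x \<in> space (Leb I). nrm I x \<le> 1}"
  define \<beta> :: ennreal where "\<beta> = vol I B"
  have B[measurable]: "B \<in> sets (Leb I)" unfolding B_def by measurable
  have fin: "\<beta> < \<infinity>" unfolding \<beta>_def B_def by (rule emeasure_ball_finite[OF I])
  have "{x \<in> space (Leb I). nrm I x < 1} \<subseteq> B" by (auto simp: B_def)
  then have "vol I {x \<in> space (Leb I). nrm I x < 1} \<le> \<beta>"
    unfolding \<beta>_def by (intro emeasure_mono) auto
  then have pos: "\<beta> \<noteq> 0" using emeasure_ball_pos[OF I, of 1] by auto
  have [measurable]: "(\<lambda>y. T y i) \<in> borel_measurable (Leb I)" if "i \<in> I" for i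
    using measurable_compose[OF T measurable_component_singleton[OF that]] by simp
  have sp: "T x \<in> space (Leb I)" if "x \<in> space (Leb I)" for x
    using measurable_space[OF T that] .
  define d :: "(nat \<Rightarrow> real) \<Rightarrow> (nat \<Rightarrow> real) \<Rightarrow> nat \<Rightarrow> real" where "d = (\<lambda>u v. \<lambda>i\<in>I. u i - v i)"
  have dsp: "d u v \<in> space (Leb I)" for u v by (simp add: d_def space_Leb)
  have d_iff: "d u v \<in> B \<longleftrightarrow> (\<Sum>i\<in>I. (u i - v i)\<^sup>2) \<le> 1" for u v
    by (simp add: B_def d_def space_Leb L2_set_def)
  \<comment> \<open>With \<open>x = T s\<close>, translating \<open>y\<close> by \<open>s\<close>
    turns \<open>T y - x\<close> into \<open>T y\<close>, and an isometry maps exactly the unit ball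
    into the unit ball.\<close>
  have inner1: "(\<integral>\<^sup>+y. indicator B (d (T y) x) \<partial>Leb I) = \<beta>" if x: "x \<in> space (Leb I)" for x
  proof -
    obtain s where s: "s \<in> space (Leb I)" "T s = x" using surj[OF x] by auto
    have "(\<integral>\<^sup>+y. indicator B (d (T y) x) \<partial>Leb I) = (\<integral>\<^sup>+y. indicator B (d (T (affm I 1 s y)) x) \<partial>Leb I)"
      by (subst nn_integral_affm[OF I, of 1 _ s]) (auto simp: d_iff indicator_def)
    also have "\<dots> = (\<integral>\<^sup>+y. indicator B y \<partial>Leb I)"
    proof (rule nn_integral_cong)
      fix y assume y: "y \<in> space (Leb I)"
      have "d (T (affm I 1 s y)) x = T y"
        using sp[OF y] add[OF s(1) y] unfolding s(2) d_def affm_def[of I 1 x]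
        by (auto simp: space_Leb PiE_iff extensional_def)
      then show "indicator B (d (T (affm I 1 s y)) x) = (indicator B y :: ennreal)"
        using iso[OF y] sp[OF y] y by (auto simp: B_def indicator_def)
    qed
    finally show ?thesis by (simp add: \<beta>_def)
  qed
  have "vol I A * \<beta> = (\<integral>\<^sup>+x. indicator A x * \<beta> \<partial>Leb I)"
    by (simp add: nn_integral_multc)
  also have "\<dots> = (\<integral>\<^sup>+x. (\<integral>\<^sup>+y. indicator A x * indicator B (d (T y) x) \<partial>Leb I) \<partial>Leb I)"
  proof (rule nn_integral_cong)
    fix x assume x: "x \<in> space (Leb I)"
    have "(\<integral>\<^sup>+y. indicator A x * indicator B (d (T y) x) \<partial>Leb I) = indicator A x * (\<integral>\<^sup>+y. indicator B (d (T y) x) \<partial>Leb I)"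
      by (intro nn_integral_cmult) (simp add: d_iff indicator_def)
    then show "indicator A x * \<beta> = (\<integral>\<^sup>+y. indicator A x * indicator B (d (T y) x) \<partial>Leb I)"
      using inner1[OF x] by simp
  qed
  also have "\<dots> = (\<integral>\<^sup>+y. (\<integral>\<^sup>+x. indicator A x * indicator B (d (T y) x) \<partial>Leb I) \<partial>Leb I)"
    by (rule P.Fubini'[symmetric]) (simp add: d_iff indicator_def)
  also have "\<dots> = (\<integral>\<^sup>+y. (\<integral>\<^sup>+x. indicator A (affm I 1 x (T y)) * indicator B x \<partial>Leb I) \<partial>Leb I)"
  proof (rule nn_integral_cong)
    fix y assume y: "y \<in> space (Leb I)"
    have "(\<integral>\<^sup>+x. indicator A x * indicator B (d (T y) x) \<partial>Leb I) =
       (\<integral>\<^sup>+x. indicator A (affm I 1 (T y) x) * indicator B (d (T y) (affm I 1 (T y) x)) \<partial>Leb I)"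
      by (subst nn_integral_affm[OF I, of 1 _ "T y"]) (auto simp: d_iff indicator_def)
    also have "\<dots> = (\<integral>\<^sup>+x. indicator A (affm I 1 x (T y)) * indicator B x \<partial>Leb I)"
    proof (rule nn_integral_cong)
      fix x assume x: "x \<in> space (Leb I)"
      have 1: "affm I 1 (T y) x = affm I 1 x (T y)" by (auto simp: affm_def)
      have "d (T y) (affm I 1 (T y) x) \<in> B \<longleftrightarrow> x \<in> B"
        unfolding d_iff using x by (simp add: affm_def B_def L2_set_def)
      then show "indicator A (affm I 1 (T y) x) * indicator B (d (T y) (affm I 1 (T y) x))
          = indicator A (affm I 1 x (T y)) * (indicator B x :: ennreal)"
        by (simp add: 1 indicator_def)
    qed
    finally show "(\<integral>\<^sup>+x. indicator A x * indicator B (d (T y) x) \<partial>Leb I) =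
      (\<integral>\<^sup>+x. indicator A (affm I 1 x (T y)) * indicator B x \<partial>Leb I)" .
  qed
  also have "\<dots> = (\<integral>\<^sup>+x. (\<integral>\<^sup>+y. indicator A (affm I 1 x (T y)) * indicator B x \<partial>Leb I) \<partial>Leb I)"
    by (rule P.Fubini') (simp add: affm_def)
  also have "\<dots> = (\<integral>\<^sup>+x. vol I (T -` A \<inter> space (Leb I)) * indicator B x \<partial>Leb I)"
  proof (rule nn_integral_cong)
    fix x assume x: "x \<in> space (Leb I)"
    obtain s where s: "s \<in> space (Leb I)" "T s = x" using surj[OF x] by auto
    have "(\<integral>\<^sup>+y. indicator A (affm I 1 x (T y)) * indicator B x \<partial>Leb I) =
      (\<integral>\<^sup>+y. indicator A (affm I 1 x (T y)) \<partial>Leb I) * indicator B x"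
      by (subst nn_integral_multc) (auto simp: affm_def)
    also have "(\<integral>\<^sup>+y. indicator A (affm I 1 x (T y)) \<partial>Leb I) = (\<integral>\<^sup>+y. indicator A (T (affm I 1 s y)) \<partial>Leb I)"
      using add[OF s(1)] s(2) by (intro nn_integral_cong) simp
    also have "\<dots> = (\<integral>\<^sup>+y. indicator A (T y) \<partial>Leb I)"
      by (subst (2) nn_integral_affm[OF I, of 1 _ s]) auto
    also have "\<dots> = (\<integral>\<^sup>+y. indicator (T -` A \<inter> space (Leb I)) y \<partial>Leb I)"
      by (intro nn_integral_cong) (auto simp: indicator_def)
    also have "\<dots> = vol I (T -` A \<inter> space (Leb I))" by (simp add: measurable_sets[OF T A])
    finally show "(\<integral>\<^sup>+y. indicator A (affm I 1 x (T y)) * indicator B x \<partial>Leb I) =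
       vol I (T -` A \<inter> space (Leb I)) * indicator B x" .
  qed
  also have "\<dots> = emeasure (distr (Leb I) (Leb I) T) A * \<beta>"
    by (simp add: nn_integral_cmult \<beta>_def emeasure_distr)
  finally show "emeasure (distr (Leb I) (Leb I) T) A = vol I A"
    using pos fin by (metis ennreal_mult_left_cong ennreal_mult_cancel_left infinity_ennreal_def mult.commute order_less_irrefl)
qed simp

text \<open>Both orthogonality relations enter: \<open>rows\<close> makes the transposed matrix a
  right inverse, hence the map surjective, and \<open>cols\<close> makes the map preserve the
  norm.\<close>

lemma distr_orthogonal_Leb:
  assumes I: "finite I"
    and rows: "\<And>j k. j \<in> I \<Longrightarrow> k \<in> I \<Longrightarrow> (\<Sum>i\<in>I. e j i * e k i) = (if j = k then 1 else 0)"
    and cols: "\<And>j k. j \<in> I \<Longrightarrow> k \<in> I \<Longrightarrow> (\<Sum>i\<in>I. e i j * e i k) = (if j = k then 1 else 0)"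
  shows "distr (Leb I) (Leb I) (\<lambda>x. \<lambda>j\<in>I. \<Sum>i\<in>I. x i * e j i) = Leb I"
proof (rule distr_additive_isometry_Leb[OF I])
  define T where "T = (\<lambda>x. \<lambda>j\<in>I. \<Sum>i\<in>I. x i * e j i :: real)"
  show "T \<in> measurable (Leb I) (Leb I)" unfolding T_def by measurable
  show "T (affm I 1 a x) = affm I 1 (T a) (T x)" for a x
    by (auto simp: T_def affm_def ring_distribs sum.distrib cong: sum.cong)
  show "\<exists>x\<in>space (Leb I). T x = y" if y: "y \<in> space (Leb I)" for y
  proof (intro bexI)
    let ?x = "\<lambda>i\<in>I. \<Sum>j\<in>I. y j * e j i"
    have "(\<Sum>i\<in>I. (\<Sum>k\<in>I. y k * e k i) * e j i) = y j" if j: "j \<in> I" for j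
    proof -
      have "(\<Sum>i\<in>I. (\<Sum>k\<in>I. y k * e k i) * e j i) = (\<Sum>i\<in>I. \<Sum>k\<in>I. y k * (e k i * e j i))"
        by (simp add: sum_distrib_right mult.assoc)
      also have "\<dots> = (\<Sum>k\<in>I. y k * (\<Sum>i\<in>I. e k i * e j i))"
        by (subst sum.swap) (simp add: sum_distrib_left)
      also have "\<dots> = (\<Sum>k\<in>I. if k = j then y k else 0)"
        using rows j by (intro sum.cong) auto
      finally show ?thesis using I j by simp
    qed
    then show "T ?x = y" using y by (auto simp: T_def space_Leb PiE_iff extensional_def cong: sum.cong)
    show "?x \<in> space (Leb I)" by (simp add: space_Leb)
  qed
  show "nrm I (T x) = nrm I x" for x
  proof -
    have "(\<Sum>j\<in>I. (T x j)\<^sup>2) = (\<Sum>j\<in>I. \<Sum>i\<in>I. \<Sum>k\<in>I. x i * e j i * (x k * e j k))"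
      by (simp add: T_def power2_eq_square sum_product)
    also have "\<dots> = (\<Sum>i\<in>I. \<Sum>k\<in>I. \<Sum>j\<in>I. x i * e j i * (x k * e j k))"
      by (subst sum.swap, rule sum.cong[OF refl], rule sum.swap)
    also have "\<dots> = (\<Sum>i\<in>I. \<Sum>k\<in>I. x i * x k * (\<Sum>j\<in>I. e j i * e j k))"
      by (simp add: sum_distrib_left mult_ac)
    also have "\<dots> = (\<Sum>i\<in>I. \<Sum>k\<in>I. if i = k then x i * x k else 0)"
      using cols by (intro sum.cong refl) auto
    also have "\<dots> = (\<Sum>i\<in>I. (x i)\<^sup>2)" using I by (simp add: power2_eq_square)
    finally show ?thesis by (simp add: L2_set_def)
  qed
qed

subsection \<open>Steiner symmetrization\<close>

definition sec :: "nat \<Rightarrow> (nat \<Rightarrow> real) set \<Rightarrow> (nat \<Rightarrow> real) \<Rightarrow> real set" where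
  "sec i L p = {x. p(i := x) \<in> L}"

text \<open>Each section in direction \<open>i\<close> is replaced by the centred open interval of
  the same length. Comparing in \<open>ennreal\<close> also covers sections of infinite length,
  which become the whole line.\<close>

definition steiner :: "nat set \<Rightarrow> nat \<Rightarrow> (nat \<Rightarrow> real) set \<Rightarrow> (nat \<Rightarrow> real) set" where
  "steiner P i L = {p \<in> PiE P (\<lambda>_. UNIV). ennreal (2 * \<bar>p i\<bar>) < emeasure lborel (sec i L p)}"

text \<open>Coordinates outside \<open>J\<close> are left alone, including the undefined ones
  outside the index set, so extensionality survives when \<open>J\<close> lies in the index
  set.\<close>

definition flip :: "nat set \<Rightarrow> (nat \<Rightarrow> real) \<Rightarrow> nat \<Rightarrow> real" where
  "flip J p = (\<lambda>i. if i \<in> J then - p i else p i)"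

lemma sets_sec:
  assumes "i \<in> P" "L \<in> sets (Leb P)" "p \<in> PiE P (\<lambda>_. UNIV)"
  shows "sec i L p \<in> sets borel"
proof -
  have "(\<lambda>x. p(i := x)) \<in> measurable lborel (Leb (insert i P))"
    using assms by (intro measurable_fun_upd[where J=P]) (auto simp: space_Leb)
  then have "(\<lambda>x. p(i := x)) -` L \<inter> space lborel \<in> sets lborel"
    using assms by (intro measurable_sets[where A="Leb P"]) (auto simp: insert_absorb)
  then show ?thesis by (simp add: sec_def vimage_def)
qed

lemma measurable_emeasure_sec:
  assumes "i \<in> P" "L \<in> sets (Leb P)"
  shows "(\<lambda>p. emeasure lborel (sec i L p)) \<in> borel_measurable (Leb P)"
proof -
  have "(\<lambda>(f, y). f(i := y)) \<in> measurable (Leb P \<Otimes>\<^sub>M lborel) (Leb (insert i P))" by (rule measurable_add_dim)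
  then have [measurable]: "(\<lambda>(f, y). f(i := y)) \<in> measurable (Leb P \<Otimes>\<^sub>M lborel) (Leb P)"
    using assms(1) by (simp add: insert_absorb)
  note assms(2)[measurable]
  have "(\<lambda>p. \<integral>\<^sup>+x. indicator L ((\<lambda>(f, y). f(i := y)) (p, x)) \<partial>lborel) \<in> borel_measurable (Leb P)"
    by measurable
  also have "?this \<longleftrightarrow> ?thesis"
  proof (rule measurable_cong)
    fix p assume "p \<in> space (Leb P)"
    then have "sec i L p \<in> sets borel" using assms by (intro sets_sec) (auto simp: space_Leb)
    then have "emeasure lborel (sec i L p) = (\<integral>\<^sup>+x. indicator (sec i L p) x \<partial>lborel)" by simp
    then show "(\<integral>\<^sup>+x. indicator L ((\<lambda>(f, y). f(i := y)) (p, x)) \<partial>lborel) = emeasure lborel (sec i L p)"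
      by (simp add: sec_def indicator_def)
  qed
  finally show ?thesis .
qed

lemma sets_steiner:
  assumes "i \<in> P" "L \<in> sets (Leb P)"
  shows "steiner P i L \<in> sets (Leb P)"
proof -
  note measurable_emeasure_sec[OF assms, measurable]
  have [measurable]: "(\<lambda>p. p i) \<in> borel_measurable (Leb P)"
    using measurable_component_singleton[of i P "\<lambda>_. lborel :: real measure"] assms by simp
  have "steiner P i L = {p \<in> space (Leb P). ennreal (2 * \<bar>p i\<bar>) < emeasure lborel (sec i L p)}"
    by (simp add: steiner_def space_Leb)
  then show ?thesis by simp
qed

lemma emeasure_lborel_centred:
  "emeasure lborel {x::real. ennreal (2 * \<bar>x\<bar>) < c} = c"
proof (cases c)
  case (real r)
  have "{x::real. ennreal (2 * \<bar>x\<bar>) < c} = {-(r/2)<..<r/2}"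
    using real by (auto simp: ennreal_less_iff abs_less_iff)
  then show ?thesis using real by simp
next
  case top
  then show ?thesis by (simp add: ennreal_less_top)
qed

text \<open>Cavalieri's principle: integrating over the other coordinates sees only the lengths of
  the sections in direction \<open>i\<close>, and these do not change.\<close>

lemma emeasure_steiner:
  assumes P: "finite P" "i \<in> P" and L: "L \<in> sets (Leb P)"
  shows "vol P (steiner P i L) = vol P L"
proof -
  let ?Q = "P - {i}"
  have ins: "insert i ?Q = P" using P by auto
  have eq: "vol P A = (\<integral>\<^sup>+q. emeasure lborel (sec i A q) \<partial>Leb ?Q)" if A: "A \<in> sets (Leb P)" for A
  proof -
    have "vol P A = (\<integral>\<^sup>+x. indicator A x \<partial>Leb (insert i ?Q))" using A ins by simp
    also have "\<dots> = (\<integral>\<^sup>+q. (\<integral>\<^sup>+x. indicator A (q(i := x)) \<partial>lborel) \<partial>Leb ?Q)"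
      using P A ins by (intro leb.product_nn_integral_insert) auto
    also have "\<dots> = (\<integral>\<^sup>+q. emeasure lborel (sec i A q) \<partial>Leb ?Q)"
    proof (rule nn_integral_cong)
      fix q assume q: "q \<in> space (Leb ?Q)"
      have "sec i A q = sec i A (q(i := 0))" by (simp add: sec_def)
      moreover have "q(i := 0) \<in> PiE P (\<lambda>_. UNIV)" using q P by (auto simp: space_Leb PiE_iff extensional_def)
      ultimately have "sec i A q \<in> sets borel" using sets_sec[OF P(2) A] by simp
      then have "emeasure lborel (sec i A q) = (\<integral>\<^sup>+x. indicator (sec i A q) x \<partial>lborel)" by simp
      then show "(\<integral>\<^sup>+x. indicator A (q(i := x)) \<partial>lborel) = emeasure lborel (sec i A q)"
        by (simp add: sec_def indicator_def)
    qed
    finally show ?thesis .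
  qed
  have "sec i (steiner P i L) q = {x. ennreal (2 * \<bar>x\<bar>) < emeasure lborel (sec i L q)}" if "q \<in> space (Leb ?Q)" for q
    using that P by (auto simp: sec_def steiner_def space_Leb PiE_iff extensional_def)
  then have "emeasure lborel (sec i (steiner P i L) q) = emeasure lborel (sec i L q)" if "q \<in> space (Leb ?Q)" for q
    using that by (simp add: emeasure_lborel_centred)
  then show ?thesis
    by (simp add: eq[OF L] eq[OF sets_steiner[OF P(2) L]] cong: nn_integral_cong)
qed

text \<open>Brunn-Minkowski on the line. \<open>S\<close> and \<open>S'\<close> are intervals up to
  their endpoints, so \<open>S''\<close> contains the open interval between the weighted sums of
  their infima and suprema. This is what makes Steiner symmetrization preserve convexity.\<close>

lemma interval_length_superadditive:
  fixes S S' S'' :: "real set"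
  assumes S: "S \<in> sets borel" "S' \<in> sets borel" "S'' \<in> sets borel"
    and bd: "S \<subseteq> {-1..1}" "S' \<subseteq> {-1..1}"
    and conv: "\<And>x y u. x \<in> S \<Longrightarrow> y \<in> S \<Longrightarrow> x \<le> u \<Longrightarrow> u \<le> y \<Longrightarrow> u \<in> S"
     "\<And>x y u. x \<in> S' \<Longrightarrow> y \<in> S' \<Longrightarrow> x \<le> u \<Longrightarrow> u \<le> y \<Longrightarrow> u \<in> S'"
    and sum: "\<And>x y. x \<in> S \<Longrightarrow> y \<in> S' \<Longrightarrow> a * x + b * y \<in> S''"
    and ab: "0 \<le> a" "0 \<le> b" "a + b = 1"
    and s: "ennreal s < emeasure lborel S" "ennreal s' < emeasure lborel S'" "0 \<le> s" "0 \<le> s'"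
  shows "ennreal (a * s + b * s') < emeasure lborel S''"
proof -
  have ne: "S \<noteq> {}" "S' \<noteq> {}" using s by auto
  have bb: "bdd_below S" "bdd_above S" "bdd_below S'" "bdd_above S'"
    using bdd_below_mono[OF bdd_below_Icc bd(1)] bdd_above_mono[OF bdd_above_Icc bd(1)]
      bdd_below_mono[OF bdd_below_Icc bd(2)] bdd_above_mono[OF bdd_above_Icc bd(2)] by auto
  have len: "Sup A - Inf A > r" if A: "A \<in> sets borel" "A \<noteq> {}" "bdd_below A" "bdd_above A" "ennreal r < emeasure lborel A" "0 \<le> r" for A r
  proof -
    have "A \<subseteq> {Inf A..Sup A}" using A(3,4) by (auto intro: cInf_lower cSup_upper)
    then have "emeasure lborel A \<le> emeasure lborel {Inf A..Sup A}" by (intro emeasure_mono) auto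
    also have "\<dots> = ennreal (Sup A - Inf A)"
      using cInf_le_cSup[OF A(2,4,3)] by (rule emeasure_lborel_Icc)
    finally have "ennreal r < ennreal (Sup A - Inf A)" by (rule less_le_trans[OF A(5)])
    then show ?thesis using A(6) by (simp add: ennreal_less_iff)
  qed
  have l: "Sup S - Inf S > s" "Sup S' - Inf S' > s'"
    using len[OF S(1) ne(1) bb(1,2) s(1,3)] len[OF S(2) ne(2) bb(3,4) s(2,4)] by auto
  have op: "u \<in> A" if A: "\<And>x y u. x \<in> A \<Longrightarrow> y \<in> A \<Longrightarrow> x \<le> u \<Longrightarrow> u \<le> y \<Longrightarrow> u \<in> A" "A \<noteq> {}"
    "Inf A < u" "u < Sup A" "bdd_below A" "bdd_above A" for A and u :: real
  proof -
    obtain x where x: "x \<in> A" "x < u" using cInf_less_iff[OF A(2,5)] A(3) by blast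
    obtain y where y: "y \<in> A" "u < y" using less_cSup_iff[OF A(2,6)] A(4) by blast
    show ?thesis using A(1)[OF x(1) y(1)] x y by auto
  qed
  let ?l = "a * Inf S + b * Inf S'" and ?u = "a * Sup S + b * Sup S'"
  have lu: "?l < ?u \<and> a * s + b * s' < ?u - ?l"
  proof -
    have "a * s + b * s' < a * (Sup S - Inf S) + b * (Sup S' - Inf S')"
    proof (cases "a > 0")
      case True
      have "a * s < a * (Sup S - Inf S)" using l True by simp
      moreover have "b * s' \<le> b * (Sup S' - Inf S')" using l ab by (intro mult_left_mono) auto
      ultimately show ?thesis by linarith
    next
      case False
      then show ?thesis using ab l by simp
    qed
    moreover have "0 \<le> a * s + b * s'" using ab s by simp
    ultimately show ?thesis by (simp add: algebra_simps)
  qed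
  have "{?l<..<?u} \<subseteq> S''"
  proof
    fix x assume x: "x \<in> {?l<..<?u}"
    \<comment> \<open>The relative position of \<open>x\<close> in the target interval; the points
      at the same relative position in \<open>S\<close> and \<open>S'\<close> combine to
      \<open>x\<close>.\<close>
    define \<theta> where "\<theta> = (x - ?l) / (?u - ?l)"
    have \<theta>: "0 < \<theta>" "\<theta> < 1" using x by (auto simp: \<theta>_def divide_simps)
    have pos: "Sup S - Inf S > 0" "Sup S' - Inf S' > 0" using l s by auto
    have u1: "Inf S + \<theta> * (Sup S - Inf S) \<in> S"
    proof (rule op[OF conv(1) ne(1)])
      show "Inf S < Inf S + \<theta> * (Sup S - Inf S)" using \<theta> pos by simp
      have "\<theta> * (Sup S - Inf S) < 1 * (Sup S - Inf S)" using \<theta> pos by (intro mult_strict_right_mono) auto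
      then show "Inf S + \<theta> * (Sup S - Inf S) < Sup S" by simp
    qed (use bb in auto)
    have u2: "Inf S' + \<theta> * (Sup S' - Inf S') \<in> S'"
    proof (rule op[OF conv(2) ne(2)])
      show "Inf S' < Inf S' + \<theta> * (Sup S' - Inf S')" using \<theta> pos by simp
      have "\<theta> * (Sup S' - Inf S') < 1 * (Sup S' - Inf S')" using \<theta> pos by (intro mult_strict_right_mono) auto
      then show "Inf S' + \<theta> * (Sup S' - Inf S') < Sup S'" by simp
    qed (use bb in auto)
    have "x = ?l + \<theta> * (?u - ?l)" using lu by (simp add: \<theta>_def)
    also have "\<dots> = a * (Inf S + \<theta> * (Sup S - Inf S)) + b * (Inf S' + \<theta> * (Sup S' - Inf S'))"
      by (simp add: algebra_simps)
    finally show "x \<in> S''" using sum[OF u1 u2] by simp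
  qed
  then have "emeasure lborel {?l<..<?u} \<le> emeasure lborel S''" using S by (intro emeasure_mono) auto
  moreover have "emeasure lborel {?l<..<?u} = ennreal (?u - ?l)" using lu by simp
  moreover have "ennreal (a * s + b * s') < ennreal (?u - ?l)" using lu ab s by (intro ennreal_lessI) auto
  ultimately show ?thesis by (metis less_le_trans)
qed

text \<open>Symmetrizing successively in the directions of \<open>J\<close> makes the sections unconditional in these directions, and then
  the central symmetry turns into the plain inclusion \<open>L h \<subseteq> L (\<theta> * h)\<close>.\<close>

lemma section_emeasure_mono:
  fixes L :: "real \<Rightarrow> (nat \<Rightarrow> real) set"
  assumes P: "finite P" and J: "finite J" "J \<subseteq> P"
    and "\<And>h. L h \<in> sets (Leb P)"
    and "\<And>h p i. p \<in> L h \<Longrightarrow> i \<in> P \<Longrightarrow> \<bar>p i\<bar> \<le> 1"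
    and "\<And>h h' p p' a b. p \<in> L h \<Longrightarrow> p' \<in> L h' \<Longrightarrow> 0 \<le> a \<Longrightarrow> 0 \<le> b \<Longrightarrow> a + b = 1 \<Longrightarrow>
           (\<lambda>i\<in>P. a * p i + b * p' i) \<in> L (a * h + b * h')"
    and "\<And>h p. p \<in> L h \<Longrightarrow> flip J p \<in> L (- h)"
    and \<theta>: "0 \<le> \<theta>" "\<theta> \<le> 1"
  shows "vol P (L h) \<le> vol P (L (\<theta> * h))"
  using J assms(4-7)
proof (induction J arbitrary: L rule: finite_induct)
  case empty
  have "L h \<subseteq> L (\<theta> * h)"
  proof
    fix p assume p: "p \<in> L h"
    have "p \<in> L (- h)" using empty(5)[OF p] by (simp add: flip_def)
    \<comment> \<open>The weights solve \<open>a + b = 1\<close> and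
      \<open>a - b = \<theta>\<close>. With no coordinate left to flip, \<open>p\<close> lies over
      both \<open>h\<close> and \<open>-h\<close>, and convexity moves it to
      \<open>\<theta> * h\<close>.\<close>
    then have "(\<lambda>i\<in>P. (1+\<theta>)/2 * p i + (1-\<theta>)/2 * p i) \<in> L ((1+\<theta>)/2 * h + (1-\<theta>)/2 * (-h))"
      using \<theta> by (intro empty(4) p) (auto simp: field_simps)
    also have "(1+\<theta>)/2 * h + (1-\<theta>)/2 * (-h) = \<theta> * h" by (simp add: field_simps)
    also have "(\<lambda>i\<in>P. (1+\<theta>)/2 * p i + (1-\<theta>)/2 * p i) = p"
    proof -
      have "p \<in> PiE P (\<lambda>_. UNIV)"
        using sets.sets_into_space[OF empty(2)[of h]] p by (auto simp: space_Leb)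
      moreover have "(1+\<theta>)/2 * p i + (1-\<theta>)/2 * p i = p i" for i by (simp add: field_simps)
      ultimately show ?thesis by (simp add: PiE_restrict)
    qed
    finally show "p \<in> L (\<theta> * h)" .
  qed
  then show ?case using empty(2) by (intro emeasure_mono)
next
  case (insert i J)
  have i: "i \<in> P" using insert.prems by auto
  note Lm = insert.prems(2) and Lb = insert.prems(3) and Lc = insert.prems(4) and Ls = insert.prems(5)
  let ?L = "\<lambda>h. steiner P i (L h)"
  have Lsp: "p \<in> PiE P (\<lambda>_. UNIV)" if "p \<in> L h" for p h
    using sets.sets_into_space[OF Lm[of h]] that by (auto simp: space_Leb)
  have sm: "sec i (L h) p \<in> sets borel" if "p \<in> PiE P (\<lambda>_. UNIV)" for h p
    using sets_sec[OF i Lm that] .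
  have sb: "sec i (L h) p \<subseteq> {-1..1}" for h p
    using Lb[of "p(i := _)" h i] i by (fastforce simp: sec_def abs_le_iff)
  have sc: "u \<in> sec i (L h) p" if "x \<in> sec i (L h) p" "y \<in> sec i (L h) p" "x \<le> u" "u \<le> y"
    for x y u h p
  proof (cases "x = y")
    case True
    then show ?thesis using that by auto
  next
    case False
    define b where "b = (u - x) / (y - x)"
    have b: "0 \<le> b" "0 \<le> 1 - b" "1 - b + b = 1" using that False by (auto simp: b_def divide_simps)
    have "b * (y - x) = u - x" using False by (simp add: b_def)
    then have u: "(1 - b) * x + b * y = u" by (simp add: algebra_simps)
    have "(\<lambda>j\<in>P. (1-b) * (p(i:=x)) j + b * (p(i:=y)) j) \<in> L ((1-b) * h + b * h)"
      using Lc[of "p(i:=x)" h "p(i:=y)" h "1-b" b] that b unfolding sec_def by blast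
    also have "(1-b) * h + b * h = h" by (simp add: algebra_simps)
    also have "(\<lambda>j\<in>P. (1-b) * (p(i:=x)) j + b * (p(i:=y)) j) = p(i := u)"
      using Lsp[of "p(i:=x)" h] that(1) i u
      by (auto simp: sec_def PiE_iff extensional_def fun_eq_iff algebra_simps split: if_splits)
    finally show ?thesis by (simp add: sec_def fun_upd_def)
  qed
  have "vol P (?L h) \<le> vol P (?L (\<theta> * h))"
  proof (rule insert.IH)
    show "J \<subseteq> P" using insert.prems by auto
    show "?L h \<in> sets (Leb P)" for h by (rule sets_steiner[OF i Lm])
    show "\<bar>p j\<bar> \<le> 1" if p: "p \<in> ?L h" and j: "j \<in> P" for h p j
    proof (cases "j = i")
      case True
      have "ennreal (2 * \<bar>p i\<bar>) < emeasure lborel (sec i (L h) p)" using p by (simp add: steiner_def)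
      also have "\<dots> \<le> emeasure lborel {-1..1::real}" using sb by (intro emeasure_mono) auto
      finally show ?thesis using True by (simp add: ennreal_less_iff)
    next
      case False
      have "emeasure lborel (sec i (L h) p) \<noteq> 0" using p by (auto simp: steiner_def)
      then obtain x where "x \<in> sec i (L h) p" by (metis emeasure_empty equals0I)
      then show ?thesis using Lb[of "p(i:=x)" h j] j False by (simp add: sec_def fun_upd_def)
    qed
    show "(\<lambda>i\<in>P. a * p i + b * p' i) \<in> ?L (a * h + b * h')"
      if p: "p \<in> ?L h" "p' \<in> ?L h'" and ab: "0 \<le> a" "0 \<le> b" "a + b = 1" for h h' p p' a b
    proof -
      let ?q = "\<lambda>i\<in>P. a * p i + b * p' i"
      have q: "?q \<in> PiE P (\<lambda>_. UNIV)" by auto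
      have pp: "p \<in> PiE P (\<lambda>_. UNIV)" "p' \<in> PiE P (\<lambda>_. UNIV)" using p by (auto simp: steiner_def)
      \<comment> \<open>Convexity survives the symmetrization: the section over the combined point
        contains the weighted sum of the two given sections, so its length is at least the weighted
        sum of theirs.\<close>
      have "ennreal (a * (2 * \<bar>p i\<bar>) + b * (2 * \<bar>p' i\<bar>)) < emeasure lborel (sec i (L (a * h + b * h')) ?q)"
      proof (rule interval_length_superadditive[OF sm sm sm sb sb sc sc _ ab])
        fix x y assume xy: "x \<in> sec i (L h) p" "y \<in> sec i (L h') p'"
        have "(\<lambda>j\<in>P. a * (p(i:=x)) j + b * (p'(i:=y)) j) \<in> L (a * h + b * h')"
          using Lc[of "p(i:=x)" h "p'(i:=y)" h' a b] xy ab unfolding sec_def by blast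
        also have "(\<lambda>j\<in>P. a * (p(i:=x)) j + b * (p'(i:=y)) j) = ?q(i := a * x + b * y)"
          using i by auto
        finally show "a * x + b * y \<in> sec i (L (a * h + b * h')) ?q" by (simp add: sec_def fun_upd_def)
      qed (use p pp q in \<open>auto simp: steiner_def\<close>)
      moreover have "2 * \<bar>?q i\<bar> \<le> a * (2 * \<bar>p i\<bar>) + b * (2 * \<bar>p' i\<bar>)"
        using i ab abs_triangle_ineq[of "a * p i" "b * p' i"] by (simp add: abs_mult)
      ultimately have "ennreal (2 * \<bar>?q i\<bar>) < emeasure lborel (sec i (L (a * h + b * h')) ?q)"
        by (meson ennreal_leI le_less_trans)
      then show ?thesis using q by (simp add: steiner_def)
    qed
    show "flip J p \<in> ?L (- h)" if p: "p \<in> ?L h" for h p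
    proof -
      have pp: "p \<in> PiE P (\<lambda>_. UNIV)" using p by (auto simp: steiner_def)
      have fp: "flip J p \<in> PiE P (\<lambda>_. UNIV)" using pp insert.prems(1) by (auto simp: flip_def PiE_iff extensional_def)
      \<comment> \<open>Flipping \<open>J\<close> and \<open>i\<close> together sends the section
        over \<open>p\<close> at height \<open>h\<close> to its mirror image at height
        \<open>-h\<close>. Mirroring keeps the length, so after symmetrization in direction
        \<open>i\<close> only \<open>J\<close> remains to be flipped.\<close>
      have "sec i (L (-h)) (flip J p) = uminus -` sec i (L h) p"
      proof -
        have 1: "flip (insert i J) (p(i:=-x)) = (flip J p)(i := x)" for x
          using insert.hyps by (auto simp: flip_def)
        have 2: "flip (insert i J) ((flip J p)(i:=x)) = p(i := -x)" for x
          using insert.hyps by (auto simp: flip_def)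
        show ?thesis
          using Ls[of "p(i := - _)" h] Ls[of "(flip J p)(i := _)" "-h"] unfolding 1 2
          by (auto simp: sec_def fun_upd_def)
      qed
      then have "emeasure lborel (sec i (L (-h)) (flip J p)) = emeasure (distr lborel borel uminus) (sec i (L h) p)"
        using sm[OF pp, of h] by (simp add: emeasure_distr)
      then have "emeasure lborel (sec i (L (-h)) (flip J p)) = emeasure lborel (sec i (L h) p)"
        by (simp add: lborel_distr_uminus)
      moreover have "flip J p i = p i" using insert.hyps by (simp add: flip_def)
      ultimately show ?thesis using p fp by (simp add: steiner_def)
    qed
  qed
  then show ?case by (simp add: emeasure_steiner[OF P i Lm])
qed

section \<open>Open sets, limits of scalings, and null spheres\<close>

lemma sets_Leb_open:
  assumes "open (U :: (nat \<Rightarrow> real) set)"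
  shows "{x \<in> space (Leb I). x \<in> U} \<in> sets (Leb I)"
proof -
  \<comment> \<open>Borel sets of the countable product are generated by the coordinates. Those in
    \<open>I\<close> are measurable, the others are constantly \<open>undefined\<close> on the space
    of \<open>Leb I\<close>.\<close>
  have "(\<lambda>x. x) \<in> borel_measurable (Leb I)"
  proof (rule measurable_coordinatewise_then_product)
    fix i
    show "(\<lambda>x. x i) \<in> borel_measurable (Leb I)"
    proof (cases "i \<in> I")
      case True
      then show ?thesis using measurable_component_singleton[of i I "\<lambda>_. lborel :: real measure"] by simp
    next
      case False
      then have "(\<lambda>x. x i) \<in> borel_measurable (Leb I) \<longleftrightarrow> (\<lambda>x. undefined :: real) \<in> borel_measurable (Leb I)"
        by (intro measurable_cong) (auto simp: space_Leb PiE_iff extensional_def)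
      then show ?thesis by simp
    qed
  qed
  from measurable_sets[OF this, of U] assms show ?thesis
    by (simp add: vimage_def Int_def conj_commute)
qed

text \<open>Let \<open>t\<close> decrease to 1. This removes the dilation that is spent on comparing
  closed with open balls, or a closed cone with its interior.\<close>

lemma le_of_le_scaled:
  fixes c o' :: ennreal
  assumes "c < \<infinity>" "o' < \<infinity>" "\<And>t::real. 1 < t \<Longrightarrow> c \<le> ennreal (t ^ d) * o'"
  shows "c \<le> o'"
proof -
  obtain x y where xy: "c = ennreal x" "0 \<le> x" "o' = ennreal y" "0 \<le> y"
    using assms(1,2) by (cases c; cases o') auto
  have "x \<le> t ^ d * y" if "1 < t" for t
  proof -
    have "ennreal x \<le> ennreal (t ^ d * y)"
      using assms(3)[OF that] xy that by (simp add: ennreal_mult)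
    then show ?thesis using xy that by (simp add: ennreal_le_iff)
  qed
  then have "eventually (\<lambda>t. x \<le> t ^ d * y) (at_right 1)"
    by (intro eventually_mono[OF eventually_at_right_less]) auto
  moreover have "((\<lambda>t. t ^ d * y) \<longlongrightarrow> 1 ^ d * y) (at_right 1)" by (intro tendsto_intros)
  ultimately have "x \<le> 1 ^ d * y" by (intro tendsto_lowerbound[where F="at_right (1::real)"]) auto
  then show ?thesis using xy by simp
qed

text \<open>For \<open>r > 0\<close> the closed ball lies in the open ball of radius
  \<open>t * r\<close> for every \<open>t > 1\<close>, so both have the same volume. The origin is
  null because dilation by 2 fixes it but multiplies volume by a power of 2 with positive exponent;
  this is where \<open>I\<close> must be nonempty.\<close>

lemma emeasure_sphere_null:
  assumes "finite I" "I \<noteq> {}"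
  shows "vol I {x \<in> space (Leb I). nrm I x = r} = 0"
proof -
  let ?S = "space (Leb I)"
  have h: "homog I ?S" by (auto simp: homog_def space_Leb)
  note sc = cone_ball_scale[OF assms(1) h sets.top]
  have fin: "vol I {x \<in> ?S. nrm I x \<le> s} < \<infinity>" for s by (rule emeasure_ball_finite[OF assms(1)])
  consider "r < 0" | "r = 0" | "r > 0" by linarith
  then show ?thesis
  proof cases
    case 1
    then have "nrm I x \<noteq> r" for x using L2_set_nonneg[of x I] by linarith
    then have "{x \<in> ?S. nrm I x = r} = {}" by auto
    then show ?thesis by (metis emeasure_empty)
  next
    case 2
    define c where "c = vol I {x \<in> ?S. nrm I x \<le> 0}"
    have e: "c = ennreal (2 ^ card I) * c"
      using sc(2)[of 2 0] by (simp add: c_def)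
    have "c < \<infinity>" unfolding c_def by (rule fin)
    then obtain u where u: "c = ennreal u" "0 \<le> u" by (cases c) auto
    have "card I \<noteq> 0" using assms by simp
    then have k: "(2::real) ^ card I > 1" by simp
    have "ennreal u = ennreal (2 ^ card I * u)" using e u by (simp add: ennreal_mult)
    then have "u = 2 ^ card I * u" using u(2) by (subst (asm) ennreal_inj) auto
    then have "c = 0" using k u by simp
    moreover have "nrm I x = r \<longleftrightarrow> nrm I x \<le> 0" for x using 2 L2_set_nonneg[of x I] by linarith
    ultimately show ?thesis by (simp add: c_def)
  next
    case 3
    let ?o = "vol I {x \<in> ?S. nrm I x < r}" and ?c = "vol I {x \<in> ?S. nrm I x \<le> r}"
    have oc: "?o \<le> ?c" by (intro emeasure_mono) auto
    have "?c \<le> ?o"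
    proof (rule le_of_le_scaled[where d="card I"])
      show "?c < \<infinity>" by (rule fin)
      then show "?o < \<infinity>" using oc by (rule le_less_trans[rotated])
      fix t :: real assume t: "1 < t"
      have "?c \<le> vol I {x \<in> ?S. nrm I x < t * r}"
        using t 3 by (intro emeasure_mono) (auto intro: le_less_trans)
      then show "?c \<le> ennreal (t ^ card I) * ?o" using sc(1)[of t r] t by simp
    qed
    then have co: "?c = ?o" using oc by (rule antisym)
    have "?c = ?o + vol I {x \<in> ?S. nrm I x = r}"
      by (subst plus_emeasure) (auto intro!: arg_cong[where f="emeasure _"])
    then have "?o + vol I {x \<in> ?S. nrm I x = r} = ?o + 0" using co by simp
    then show ?thesis using fin[of r] unfolding co ennreal_add_left_cancel by auto
  qed
qed

subsection \<open>Averages of functions that are constant along rays\<close>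

text \<open>Push the measure with density \<open>J\<close> on the unit ball forward under the norm.
  By homogeneity the ball of radius \<open>x\<close> receives the fraction \<open>x^card Q\<close>
  of the total mass, so the image measure depends on \<open>J\<close> only through that mass, and
  the images for \<open>J\<close> and for the constant 1 are proportional.\<close>

lemma radial_average:
  fixes J :: "(nat \<Rightarrow> real) \<Rightarrow> ennreal"
  assumes Q: "finite Q" and J[measurable]: "J \<in> borel_measurable (Leb Q)"
    and hom: "\<And>q t. q \<in> space (Leb Q) \<Longrightarrow> 0 < t \<Longrightarrow> J (\<lambda>i\<in>Q. t * q i) = J q"
    and fin: "(\<integral>\<^sup>+q. J q * indicator {..1} (nrm Q q) \<partial>Leb Q) < \<infinity>"
    and a[measurable]: "a \<in> borel_measurable borel" and b[measurable]: "b \<in> borel_measurable borel"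
    and supp: "\<And>s. s > 1 \<Longrightarrow> a s = 0" "\<And>s. s > 1 \<Longrightarrow> b s = 0"
  shows "(\<integral>\<^sup>+q. a (nrm Q q) * J q \<partial>Leb Q) * (\<integral>\<^sup>+q. b (nrm Q q) \<partial>Leb Q) =
         (\<integral>\<^sup>+q. b (nrm Q q) * J q \<partial>Leb Q) * (\<integral>\<^sup>+q. a (nrm Q q) \<partial>Leb Q)"
proof -
  define N where "N = (\<lambda>F. distr (density (Leb Q) (\<lambda>q. F q * indicator {..1} (nrm Q q))) borel (nrm Q))"
  define c where "c = (\<lambda>F :: (nat \<Rightarrow> real) \<Rightarrow> ennreal. \<integral>\<^sup>+q. F q * indicator {..1} (nrm Q q) \<partial>Leb Q)"
  define good where "good = (\<lambda>F :: (nat \<Rightarrow> real) \<Rightarrow> ennreal. F \<in> borel_measurable (Leb Q) \<and> c F < \<infinity> \<and>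
     (\<forall>q\<in>space (Leb Q). \<forall>t>0. F (\<lambda>i\<in>Q. t * q i) = F q))"
  \<comment> \<open>The tail plus the mass of the ball is written as a sum, since subtraction in
    \<open>ennreal\<close> is awkward.\<close>
  have tail: "emeasure (N F) {x<..} + (if x < 0 then 0 else ennreal (min x 1 ^ card Q) * c F) = c F"
    if F: "good F" for F x
  proof -
    have [measurable]: "F \<in> borel_measurable (Leb Q)" using F by (simp add: good_def)
    have 1: "emeasure (N F) {x<..} = (\<integral>\<^sup>+q. F q * indicator {..1} (nrm Q q) * indicator {x<..} (nrm Q q) \<partial>Leb Q)"
      unfolding N_def
      by (subst emeasure_distr, simp, simp, subst emeasure_density)
         (auto intro!: nn_integral_cong simp: indicator_def)
    have 2: "(\<integral>\<^sup>+q. F q * indicator {..1} (nrm Q q) * indicator {..x} (nrm Q q) \<partial>Leb Q)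
      = (if x < 0 then 0 else ennreal (min x 1 ^ card Q) * c F)"
    proof -
      \<comment> \<open>At \<open>x = 0\<close> the two cases differ: for empty \<open>Q\<close> the
        only point has norm 0 and the formula holds through \<open>0^0 = 1\<close>, while otherwise
        the origin is a null set.\<close>
      consider "x < 0" | "x = 0" "Q = {}" | "x = 0" "Q \<noteq> {}" | "0 < x" by linarith
      then show ?thesis
      proof cases
        case 1
        then have "\<not> nrm Q q \<le> x" for q using L2_set_nonneg[of q Q] by linarith
        then have "indicator {..x} (nrm Q q) = (0::ennreal)" for q by simp
        then show ?thesis using 1 by simp
      next
        case 2
        then show ?thesis by (simp add: c_def)
      next
        case 3
        have "AE q in Leb Q. nrm Q q \<noteq> 0"
          using emeasure_sphere_null[OF Q 3(2), of 0] by (subst AE_iff_measurable[OF _ refl]) auto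
        then have "(\<integral>\<^sup>+q. F q * indicator {..1} (nrm Q q) * indicator {..x} (nrm Q q) \<partial>Leb Q) = (\<integral>\<^sup>+q. 0 \<partial>Leb Q)"
          using 3(1) L2_set_nonneg[of _ Q] by (intro nn_integral_cong_AE) (auto simp: indicator_def antisym elim!: eventually_mono)
        then show ?thesis using 3 Q by (simp add: zero_power card_gt_0_iff)
      next
        case 4
        define y where "y = min x 1"
        have y: "y > 0" using 4 by (simp add: y_def)
        have "(\<integral>\<^sup>+q. F q * indicator {..1} (nrm Q q) * indicator {..x} (nrm Q q) \<partial>Leb Q)
          = (\<integral>\<^sup>+q. F q * indicator {..y} (nrm Q q) \<partial>Leb Q)"
          by (intro nn_integral_cong) (auto simp: indicator_def y_def)
        also have "\<dots> = ennreal (\<bar>y\<bar> ^ card Q) * (\<integral>\<^sup>+q. F (affm Q y (\<lambda>_. 0) q) * indicator {..y} (nrm Q (affm Q y (\<lambda>_. 0) q)) \<partial>Leb Q)"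
          using y by (intro nn_integral_affm[OF Q]) auto
        also have "(\<integral>\<^sup>+q. F (affm Q y (\<lambda>_. 0) q) * indicator {..y} (nrm Q (affm Q y (\<lambda>_. 0) q)) \<partial>Leb Q) = c F"
          unfolding c_def
        proof (rule nn_integral_cong)
          fix q assume q: "q \<in> space (Leb Q)"
          have "affm Q y (\<lambda>_. 0) q = (\<lambda>i\<in>Q. y * q i)" by (simp add: affm_def)
          moreover have "F (\<lambda>i\<in>Q. y * q i) = F q" using F q y unfolding good_def by blast
          moreover have "nrm Q (\<lambda>i\<in>Q. y * q i) = y * nrm Q q" using y by (intro nrm_scale) simp
          moreover have "y * nrm Q q \<le> y \<longleftrightarrow> nrm Q q \<le> 1" using y by (simp add: mult_le_cancel_left1)
          ultimately show "F (affm Q y (\<lambda>_. 0) q) * indicator {..y} (nrm Q (affm Q y (\<lambda>_. 0) q)) =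
            F q * indicator {..1} (nrm Q q)" by (simp add: indicator_def)
        qed
        finally show ?thesis using 4 y by (simp add: y_def)
      qed
    qed
    have "c F = (\<integral>\<^sup>+q. F q * indicator {..1} (nrm Q q) * indicator {x<..} (nrm Q q) +
        F q * indicator {..1} (nrm Q q) * indicator {..x} (nrm Q q) \<partial>Leb Q)"
      unfolding c_def by (intro nn_integral_cong) (auto simp: indicator_def)
    also have "\<dots> = emeasure (N F) {x<..} + (if x < 0 then 0 else ennreal (min x 1 ^ card Q) * c F)"
      unfolding 1 2[symmetric] by (intro nn_integral_add) auto
    finally show ?thesis by simp
  qed
  have gJ: "good J" using J hom fin by (simp add: good_def c_def)
  have g1: "good (\<lambda>_. 1)"
  proof -
    have "c (\<lambda>_. 1) = (\<integral>\<^sup>+q. indicator {q \<in> space (Leb Q). nrm Q q \<le> 1} q \<partial>Leb Q)"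
      unfolding c_def by (intro nn_integral_cong) (auto simp: indicator_def)
    then have "c (\<lambda>_. 1) = vol Q {q \<in> space (Leb Q). nrm Q q \<le> 1}" by simp
    then show ?thesis using emeasure_ball_finite[OF Q] by (simp add: good_def)
  qed
  have cfin: "c J < \<infinity>" "c (\<lambda>_. 1) < \<infinity>" using gJ g1 by (auto simp: good_def)
  have tail_le: "emeasure (N F) {x<..} \<le> c F" if "good F" for F x
    using tail[OF that, of x] by (metis le_iff_add)
  have sets_N: "sets (N F) = sets borel" for F by (simp add: N_def)
  \<comment> \<open>A measure on the line with finite tails is determined by them. Scaling each
    image by the mass of the other makes the tails equal without a division.\<close>
  have "scale_measure (c (\<lambda>_. 1)) (N J) = scale_measure (c J) (N (\<lambda>_. 1))"
  proof (rule measure_eqI_lessThan)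
    fix x
    have "c (\<lambda>_. 1) * emeasure (N J) {x<..} \<le> c (\<lambda>_. 1) * c J"
      by (intro mult_left_mono tail_le gJ) auto
    then show "emeasure (scale_measure (c (\<lambda>_. 1)) (N J)) {x<..} < \<infinity>"
      using cfin by (simp add: le_less_trans[OF _ ennreal_mult_less_top[THEN iffD2]])
    let ?k = "if x < 0 then 0 else ennreal (min x 1 ^ card Q)"
    have k: "emeasure (N F) {x<..} + ?k * c F = c F" if "good F" for F
      using tail[OF that, of x] by (cases "x < 0") auto
    have "c (\<lambda>_. 1) * emeasure (N J) {x<..} + ?k * c J * c (\<lambda>_. 1) = c (\<lambda>_. 1) * (emeasure (N J) {x<..} + ?k * c J)"
      by (simp add: algebra_simps)
    also have "\<dots> = c J * (emeasure (N (\<lambda>_. 1)) {x<..} + ?k * c (\<lambda>_. 1))"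
      unfolding k[OF gJ] k[OF g1] by (simp add: mult.commute)
    also have "\<dots> = c J * emeasure (N (\<lambda>_. 1)) {x<..} + ?k * c J * c (\<lambda>_. 1)"
      by (simp add: algebra_simps)
    finally have "?k * c J * c (\<lambda>_. 1) + c (\<lambda>_. 1) * emeasure (N J) {x<..} =
      ?k * c J * c (\<lambda>_. 1) + c J * emeasure (N (\<lambda>_. 1)) {x<..}" by (simp only: add.commute)
    moreover have "?k * c J * c (\<lambda>_. 1) \<noteq> top"
      using cfin by (auto simp: ennreal_mult_eq_top_iff split: if_splits)
    ultimately have "c (\<lambda>_. 1) * emeasure (N J) {x<..} = c J * emeasure (N (\<lambda>_. 1)) {x<..}"
      unfolding ennreal_add_left_cancel by simp
    then show "emeasure (scale_measure (c (\<lambda>_. 1)) (N J)) {x<..} = emeasure (scale_measure (c J) (N (\<lambda>_. 1))) {x<..}"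
      by simp
  qed (simp_all add: sets_N)
  then have NN: "c (\<lambda>_. 1) * (\<integral>\<^sup>+s. f s \<partial>N J) = c J * (\<integral>\<^sup>+s. f s \<partial>N (\<lambda>_. 1))" if "f \<in> borel_measurable borel" for f
    using nn_integral_scale_measure[of f "N J" "c (\<lambda>_. 1)"] nn_integral_scale_measure[of f "N (\<lambda>_. 1)" "c J"]
      that by (simp add: measurable_cong_sets[OF sets_N refl])
  have int: "(\<integral>\<^sup>+s. f s \<partial>N F) = (\<integral>\<^sup>+q. f (nrm Q q) * F q \<partial>Leb Q)"
    if "good F" and [measurable]: "f \<in> borel_measurable borel" and "\<And>s. s > 1 \<Longrightarrow> f s = 0" for F f
  proof -
    have [measurable]: "F \<in> borel_measurable (Leb Q)" using that by (simp add: good_def)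
    have "(\<integral>\<^sup>+s. f s \<partial>N F) = (\<integral>\<^sup>+q. F q * indicator {..1} (nrm Q q) * f (nrm Q q) \<partial>Leb Q)"
      unfolding N_def by (simp add: nn_integral_distr nn_integral_density)
    also have "\<dots> = (\<integral>\<^sup>+q. f (nrm Q q) * F q \<partial>Leb Q)"
      using that(3) by (intro nn_integral_cong) (auto simp: indicator_def not_le mult.commute)
    finally show ?thesis .
  qed
  have c1: "c (\<lambda>_. 1) \<noteq> 0"
  proof -
    have "0 < vol Q {q \<in> space (Leb Q). nrm Q q < 1}" by (rule emeasure_ball_pos[OF Q]) simp
    also have "\<dots> = (\<integral>\<^sup>+q. indicator {q \<in> space (Leb Q). nrm Q q < 1} q \<partial>Leb Q)" by simp
    also have "\<dots> \<le> c (\<lambda>_. 1)" unfolding c_def by (intro nn_integral_mono) (auto simp: indicator_def)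
    finally show ?thesis by simp
  qed
  let ?aJ = "\<integral>\<^sup>+s. a s \<partial>N J" and ?bJ = "\<integral>\<^sup>+s. b s \<partial>N J"
  let ?a1 = "\<integral>\<^sup>+s. a s \<partial>N (\<lambda>_. 1)" and ?b1 = "\<integral>\<^sup>+s. b s \<partial>N (\<lambda>_. 1)"
  have "c (\<lambda>_. 1) * (?aJ * ?b1) = (c J * ?a1) * ?b1" using NN[OF a] by (simp add: mult.assoc[symmetric])
  also have "\<dots> = (c J * ?b1) * ?a1" by (simp add: mult_ac)
  also have "\<dots> = c (\<lambda>_. 1) * (?bJ * ?a1)" using NN[OF b] by (simp add: mult.assoc[symmetric])
  finally have "?aJ * ?b1 = ?bJ * ?a1" using c1 cfin by (auto simp: ennreal_mult_cancel_left)
  then show ?thesis using int[OF gJ a supp(1)] int[OF gJ b supp(2)] int[OF g1 a supp(1)] int[OF g1 b supp(2)] by simp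
qed

subsection \<open>Slices of cones\<close>

text \<open>The condition \<open>a + b > 0\<close> excludes the zero combination, because cones over
  subsets of an open hemisphere do not contain the origin.\<close>

definition convcone :: "nat set \<Rightarrow> (nat \<Rightarrow> real) set \<Rightarrow> bool" where
  "convcone I D \<longleftrightarrow> D \<subseteq> PiE I (\<lambda>_. UNIV) \<and>
     (\<forall>x\<in>D. \<forall>y\<in>D. \<forall>a\<ge>0. \<forall>b\<ge>0. a + b > 0 \<longrightarrow> (\<lambda>i\<in>I. a * x i + b * y i) \<in> D)"

lemma convconeD:
  "convcone I D \<Longrightarrow> x \<in> D \<Longrightarrow> y \<in> D \<Longrightarrow> 0 \<le> a \<Longrightarrow> 0 \<le> b \<Longrightarrow> a + b > 0 \<Longrightarrow> (\<lambda>i\<in>I. a * x i + b * y i) \<in> D"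
  by (auto simp: convcone_def)

lemma convcone_imp_homog:
  assumes "convcone I D" shows "homog I D"
  unfolding homog_def
proof (intro conjI ballI allI impI)
  fix x t assume "x \<in> D" "0 < (t::real)"
  then show "(\<lambda>i\<in>I. t * x i) \<in> D" using convconeD[OF assms, of x x t 0] by simp
qed (use assms in \<open>auto simp: convcone_def\<close>)

abbreviation slice :: "nat set \<Rightarrow> nat set \<Rightarrow> (nat \<Rightarrow> real) set \<Rightarrow> (nat \<Rightarrow> real) \<Rightarrow> (nat \<Rightarrow> real) set" where
  "slice Q P S q \<equiv> {p \<in> space (Leb P). merge Q P (q, p) \<in> S}"

lemma nrm_merge:
  assumes "Q \<inter> P = {}"
  shows "nrm Q (merge Q P (q, p)) = nrm Q q" "nrm P (merge Q P (q, p)) = nrm P p"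
  using assms by (auto simp: merge_def intro!: L2_set_cong)

lemma nrm_Un:
  assumes "finite Q" "finite P" "Q \<inter> P = {}"
  shows "nrm (Q \<union> P) x = sqrt ((nrm Q x)\<^sup>2 + (nrm P x)\<^sup>2)"
  using assms by (simp add: L2_set_def sum.union_disjoint sum_nonneg)

lemma merge_in_space: "merge Q P (q, p) \<in> space (Leb (Q \<union> P))"
  by (auto simp: space_Leb merge_def PiE_iff extensional_def)

lemma sets_slice:
  assumes "S \<in> sets (Leb (Q \<union> P))" "q \<in> space (Leb Q)"
  shows "slice Q P S q \<in> sets (Leb P)"
proof -
  have "(\<lambda>p. merge Q P (q, p)) \<in> measurable (Leb P) (Leb (Q \<union> P))"
    by (rule measurable_compose[OF measurable_Pair1' measurable_merge]) (use assms in auto)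
  from measurable_sets[OF this assms(1)] show ?thesis by (simp add: vimage_def Int_def conj_commute)
qed

lemma
  assumes fin: "finite Q" "finite P" "Q \<inter> P = {}" and S: "S \<in> sets (Leb (Q \<union> P))"
  shows measurable_emeasure_slice: "(\<lambda>q. vol P (slice Q P S q)) \<in> borel_measurable (Leb Q)"
    and emeasure_slices: "vol (Q \<union> P) S = (\<integral>\<^sup>+q. vol P (slice Q P S q) \<partial>Leb Q)"
proof -
  interpret P: sigma_finite_measure "Leb P" by (rule sigma_finite_Leb) fact
  have 1: "vol P (slice Q P S q) = (\<integral>\<^sup>+p. indicator S (merge Q P (q, p)) \<partial>Leb P)"
    if q: "q \<in> space (Leb Q)" for q
  proof -
    have "vol P (slice Q P S q) = (\<integral>\<^sup>+p. indicator (slice Q P S q) p \<partial>Leb P)"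
      using sets_slice[OF S q] by simp
    also have "\<dots> = (\<integral>\<^sup>+p. indicator S (merge Q P (q, p)) \<partial>Leb P)"
      by (intro nn_integral_cong) (auto simp: indicator_def)
    finally show ?thesis .
  qed
  note S[measurable]
  have "(\<lambda>q. \<integral>\<^sup>+p. indicator S (merge Q P (q, p)) \<partial>Leb P) \<in> borel_measurable (Leb Q)"
    by measurable
  moreover have "(\<lambda>q. vol P (slice Q P S q)) \<in> borel_measurable (Leb Q) \<longleftrightarrow>
      (\<lambda>q. \<integral>\<^sup>+p. indicator S (merge Q P (q, p)) \<partial>Leb P) \<in> borel_measurable (Leb Q)"
    by (rule measurable_cong) (rule 1)
  ultimately show "(\<lambda>q. vol P (slice Q P S q)) \<in> borel_measurable (Leb Q)" by simp
  have "vol (Q \<union> P) S = (\<integral>\<^sup>+x. indicator S x \<partial>Leb (Q \<union> P))" using S by simp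
  also have "\<dots> = (\<integral>\<^sup>+q. (\<integral>\<^sup>+p. indicator S (merge Q P (q, p)) \<partial>Leb P) \<partial>Leb Q)"
    using fin by (intro leb.product_nn_integral_fold) auto
  also have "\<dots> = (\<integral>\<^sup>+q. vol P (slice Q P S q) \<partial>Leb Q)"
    by (intro nn_integral_cong 1[symmetric])
  finally show "vol (Q \<union> P) S = (\<integral>\<^sup>+q. vol P (slice Q P S q) \<partial>Leb Q)" .
qed

section \<open>Truncated slices and their growth with the radius\<close>

definition G :: "nat set \<Rightarrow> nat set \<Rightarrow> (nat \<Rightarrow> real) set \<Rightarrow> (nat \<Rightarrow> real) \<Rightarrow> real \<Rightarrow> ennreal" where
  "G Q P D q \<rho> = vol P {p \<in> slice Q P D q. nrm P p < \<rho>}"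

lemma sets_slice_ball:
  assumes "S \<in> sets (Leb (Q \<union> P))" "q \<in> space (Leb Q)"
  shows "{p \<in> slice Q P S q. nrm P p < \<rho>} \<in> sets (Leb P)" "{p \<in> slice Q P S q. nrm P p \<le> \<rho>} \<in> sets (Leb P)"
proof -
  have "{p \<in> slice Q P S q. nrm P p < \<rho>} = slice Q P S q \<inter> {p \<in> space (Leb P). nrm P p < \<rho>}"
    "{p \<in> slice Q P S q. nrm P p \<le> \<rho>} = slice Q P S q \<inter> {p \<in> space (Leb P). nrm P p \<le> \<rho>}" by auto
  then show "{p \<in> slice Q P S q. nrm P p < \<rho>} \<in> sets (Leb P)" "{p \<in> slice Q P S q. nrm P p \<le> \<rho>} \<in> sets (Leb P)"
    using sets_slice[OF assms] by auto
qed

lemma G_le_ball: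
  assumes "finite P"
  shows "G Q P D q \<rho> \<le> vol P {p \<in> space (Leb P). nrm P p \<le> \<rho>}"
  unfolding G_def by (intro emeasure_mono) auto

lemma G_finite: "finite P \<Longrightarrow> G Q P D q \<rho> < \<infinity>"
  using G_le_ball emeasure_ball_finite by (rule le_less_trans)

lemma G_closed:
  assumes "finite P" "P \<noteq> {}" "D \<in> sets (Leb (Q \<union> P))" "q \<in> space (Leb Q)"
  shows "vol P {p \<in> slice Q P D q. nrm P p \<le> \<rho>} = G Q P D q \<rho>"
proof -
  note m = sets_slice_ball[OF assms(3,4)]
  have "AE p in Leb P. nrm P p \<noteq> \<rho>"
    using emeasure_sphere_null[OF assms(1,2), of \<rho>] by (subst AE_iff_measurable[OF _ refl]) auto
  then show ?thesis unfolding G_def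
    by (intro emeasure_eq_AE m) (auto elim!: eventually_mono)
qed

lemma G_nonpos: "\<rho> \<le> 0 \<Longrightarrow> G Q P D q \<rho> = 0"
proof -
  assume "\<rho> \<le> 0"
  then have "\<not> nrm P p < \<rho>" for p using L2_set_nonneg[of p P] by linarith
  then show ?thesis by (simp add: G_def)
qed

lemma G_scale:
  assumes fin: "finite P" "Q \<inter> P = {}" and D: "homog (Q \<union> P) D" "D \<in> sets (Leb (Q \<union> P))"
    and q: "q \<in> space (Leb Q)" and t: "0 < t"
  shows "G Q P D (\<lambda>i\<in>Q. t * q i) (t * \<rho>) = ennreal (t ^ card P) * G Q P D q \<rho>"
proof -
  have q': "(\<lambda>i\<in>Q. t * q i) \<in> space (Leb Q)" by (simp add: space_Leb)
  have "{x \<in> space (Leb P). affm P t (\<lambda>_. 0) x \<in> {p \<in> slice Q P D (\<lambda>i\<in>Q. t * q i). nrm P p < t * \<rho>}}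
    = {p \<in> slice Q P D q. nrm P p < \<rho>}"
  proof -
    have 1: "merge Q P (\<lambda>i\<in>Q. t * q i, affm P t (\<lambda>_. 0) p) = (\<lambda>i\<in>Q \<union> P. t * merge Q P (q, p) i)" for p
      by (auto simp: merge_def affm_def)
    have 2: "merge Q P (q, p) \<in> PiE (Q \<union> P) (\<lambda>_. UNIV)" for p
      using merge_in_space by (simp add: space_Leb)
    have 3: "nrm P (affm P t (\<lambda>_. 0) p) = t * nrm P p" for p
      using nrm_scale[of t p P] t by (simp add: affm_def)
    have 4: "affm P t (\<lambda>_. 0) p \<in> space (Leb P)" for p by (simp add: affm_def space_Leb)
    show ?thesis using t by (simp add: 1 1[simplified] 3 4 homog_scale_iff[OF D(1) t 2])
  qed
  then show ?thesis
    using emeasure_affm[OF fin(1) _ sets_slice_ball(1)[OF D(2) q'], of t "t * \<rho>" "\<lambda>_. 0"] t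
    by (simp add: G_def)
qed

text \<open>By homogeneity, \<open>G\<close> at radius \<open>\<rho>\<close> divided by
  \<open>\<rho>^card P\<close> is the volume of the unit truncation of the slice over
  \<open>q / \<rho>\<close>. A larger radius thus moves the base point along its ray towards 0,
  where sections are larger. The statement is multiplied out to avoid quotients.\<close>

lemma G_mono_ratio:
  assumes fin: "finite P" "Q \<inter> P = {}" "z \<in> P"
    and D: "convcone (Q \<union> P) D" "D \<in> sets (Leb (Q \<union> P))"
    and sym: "\<And>x. x \<in> D \<Longrightarrow> flip (Q \<union> P - {z}) x \<in> D"
    and q: "q \<in> space (Leb Q)" and \<rho>: "0 < \<rho>" "\<rho> \<le> \<rho>'"
  shows "ennreal (\<rho>' ^ card P) * G Q P D q \<rho> \<le> ennreal (\<rho> ^ card P) * G Q P D q \<rho>'"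
proof -
  have z: "z \<notin> Q" using fin by auto
  define L where "L = (\<lambda>h. {p \<in> slice Q P D (\<lambda>i\<in>Q. h * q i). nrm P p < 1})"
  have sp: "(\<lambda>i\<in>Q. h * q i) \<in> space (Leb Q)" for h by (simp add: space_Leb)
  \<comment> \<open>The factor \<open>\<rho>/\<rho>'\<close> is the \<open>\<theta>\<close> of the
    section lemma, and the right-hand height is \<open>1/\<rho>'\<close>.\<close>
  have "vol P (L (1/\<rho>)) \<le> vol P (L (\<rho>/\<rho>' * (1/\<rho>)))"
  proof (rule section_emeasure_mono[where J="P - {z}"])
    show "L h \<in> sets (Leb P)" for h
      unfolding L_def by (intro sets_slice_ball D sp)
    show "\<bar>p i\<bar> \<le> 1" if "p \<in> L h" "i \<in> P" for h p i
      using that abs_le_nrm[OF fin(1) that(2), of p] by (auto simp: L_def)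
    show "(\<lambda>i\<in>P. a * p i + b * p' i) \<in> L (a * h + b * h')"
      if p: "p \<in> L h" "p' \<in> L h'" and ab: "0 \<le> a" "0 \<le> b" "a + b = 1" for h h' p p' a b
    proof -
      have "(\<lambda>i\<in>Q\<union>P. a * merge Q P (\<lambda>i\<in>Q. h * q i, p) i + b * merge Q P (\<lambda>i\<in>Q. h' * q i, p') i) \<in> D"
        using p ab by (intro convconeD[OF D(1)]) (auto simp: L_def)
      also have "(\<lambda>i\<in>Q\<union>P. a * merge Q P (\<lambda>i\<in>Q. h * q i, p) i + b * merge Q P (\<lambda>i\<in>Q. h' * q i, p') i)
        = merge Q P (\<lambda>i\<in>Q. (a * h + b * h') * q i, \<lambda>i\<in>P. a * p i + b * p' i)"
        by (auto simp: merge_def algebra_simps)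
      finally have 1: "merge Q P (\<lambda>i\<in>Q. (a * h + b * h') * q i, \<lambda>i\<in>P. a * p i + b * p' i) \<in> D" .
      have "nrm P (\<lambda>i\<in>P. a * p i + b * p' i) = nrm P (\<lambda>i. (\<lambda>i\<in>P. a * p i) i + (\<lambda>i\<in>P. b * p' i) i)"
        by (intro L2_set_cong) auto
      also have "\<dots> \<le> nrm P (\<lambda>i\<in>P. a * p i) + nrm P (\<lambda>i\<in>P. b * p' i)"
        by (rule L2_set_triangle_ineq)
      also have "\<dots> = a * nrm P p + b * nrm P p'" using ab by (simp add: nrm_scale)
      also have "\<dots> < 1"
        using ab p convex_bound_lt[of "nrm P p" 1 "nrm P p'" a b] by (auto simp: L_def)
      finally show ?thesis using 1 by (simp add: L_def space_Leb)
    qed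
    show "flip (P - {z}) p \<in> L (- h)" if p: "p \<in> L h" for h p
    proof -
      \<comment> \<open>The reflection negates all of \<open>Q\<close>, which appears here as the
        change from \<open>h\<close> to \<open>-h\<close>, and all of \<open>P\<close> except the
        axis coordinate \<open>z\<close>.\<close>
      have "flip (Q \<union> P - {z}) (merge Q P (\<lambda>i\<in>Q. h * q i, p)) \<in> D"
        using p by (intro sym) (auto simp: L_def)
      also have "flip (Q \<union> P - {z}) (merge Q P (\<lambda>i\<in>Q. h * q i, p)) = merge Q P (\<lambda>i\<in>Q. (-h) * q i, flip (P - {z}) p)"
        using fin z by (auto simp: flip_def merge_def fun_eq_iff)
      moreover have "nrm P (flip (P - {z}) p) = nrm P p"
        unfolding L2_set_def by (intro arg_cong[where f=sqrt] sum.cong) (auto simp: flip_def)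
      ultimately show ?thesis using p by (auto simp: L_def space_Leb flip_def PiE_iff extensional_def)
    qed
  qed (use fin \<rho> in \<open>auto simp: divide_simps\<close>)
  then have le: "G Q P D (\<lambda>i\<in>Q. 1/\<rho> * q i) 1 \<le> G Q P D (\<lambda>i\<in>Q. 1/\<rho>' * q i) 1"
    using \<rho> by (simp add: L_def G_def)
  have sc: "G Q P D q r = ennreal (r ^ card P) * G Q P D (\<lambda>i\<in>Q. 1/r * q i) 1" if r: "r > 0" for r
  proof -
    have "(\<lambda>i\<in>Q. r * (\<lambda>i\<in>Q. 1/r * q i) i) = q" using r q by (auto simp: space_Leb PiE_iff extensional_def)
    then show ?thesis using G_scale[OF fin(1,2) convcone_imp_homog[OF D(1)] D(2) sp r, of "1/r" 1] by simp
  qed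
  have "ennreal (\<rho>' ^ card P) * G Q P D q \<rho> = ennreal (\<rho>' ^ card P) * (ennreal (\<rho> ^ card P) * G Q P D (\<lambda>i\<in>Q. 1/\<rho> * q i) 1)"
    using sc \<rho> by simp
  also have "\<dots> \<le> ennreal (\<rho>' ^ card P) * (ennreal (\<rho> ^ card P) * G Q P D (\<lambda>i\<in>Q. 1/\<rho>' * q i) 1)"
    by (intro mult_left_mono le) auto
  also have "\<dots> = ennreal (\<rho> ^ card P) * G Q P D q \<rho>'"
    using sc[of \<rho>'] \<rho> by (simp add: mult_ac)
  finally show ?thesis .
qed

subsection \<open>Bands around a coordinate subspace\<close>

text \<open>The boundary cone \<open>\<kappa> * nrm Q x = nrm P x\<close> may belong to
  \<open>Y\<close> wholly, partly or not at all, so closed tubes and open balls are treated alike.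
  With \<open>\<kappa> = 0\<close> the whole space is a band. The coordinate \<open>z\<close> is the
  axis through the centre.\<close>

locale band =
  fixes Q P :: "nat set" and z :: nat and \<kappa> :: real and Y :: "(nat \<Rightarrow> real) set"
  assumes fin: "finite Q" "finite P" "Q \<inter> P = {}" and zP: "z \<in> P" and \<kappa>: "0 \<le> \<kappa>"
    and Y: "Y \<in> sets (Leb (Q \<union> P))"
      "\<And>x. x \<in> space (Leb (Q \<union> P)) \<Longrightarrow> \<kappa> * nrm Q x < nrm P x \<Longrightarrow> x \<in> Y"
      "\<And>x. x \<in> Y \<Longrightarrow> \<kappa> * nrm Q x \<le> nrm P x"
begin

abbreviation "I \<equiv> Q \<union> P"
abbreviation "d \<equiv> card P"

definition B :: "(nat \<Rightarrow> real) set" where "B = {x \<in> space (Leb I). nrm I x \<le> 1}"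
definition r1 :: "real \<Rightarrow> real" where "r1 s = sqrt (1 - s\<^sup>2)"
definition rm :: "real \<Rightarrow> real" where "rm s = min (\<kappa> * s) (r1 s)"
definition wY :: "real \<Rightarrow> ennreal" where "wY s = (if 0 \<le> s \<and> s \<le> 1 then ennreal (r1 s ^ d - rm s ^ d) else 0)"
definition wN :: "real \<Rightarrow> ennreal" where "wN s = (if 0 \<le> s \<and> s \<le> 1 then ennreal (rm s ^ d) else 0)"

text \<open>Over a point \<open>q\<close> with \<open>|q| = s\<close>, the unit ball has the slice \<open>|p| \<le> r1 s\<close>, whose part outside the band is
  \<open>|p| < rm s\<close> up to a null set; \<open>wY\<close> and \<open>wN\<close> are the resulting weights of the band and of its complement.\<close>

lemma P_ne: "P \<noteq> {}" using zP by auto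

lemma sets_B [measurable]: "B \<in> sets (Leb I)" unfolding B_def by measurable

lemma measurable_weights [measurable]: "wY \<in> borel_measurable borel" "wN \<in> borel_measurable borel"
  unfolding wY_def wN_def r1_def rm_def by measurable

lemma r1_nonneg: "0 \<le> s \<Longrightarrow> s \<le> 1 \<Longrightarrow> 0 \<le> r1 s"
  by (simp add: r1_def power_le_one)

lemma rm_nonneg: "0 \<le> s \<Longrightarrow> s \<le> 1 \<Longrightarrow> 0 \<le> rm s"
  using \<kappa> r1_nonneg by (simp add: rm_def)

lemma wY_plus:
  assumes "0 \<le> s" "s \<le> 1"
  shows "wY s + wN s = ennreal (r1 s ^ d)"
proof -
  have "rm s ^ d \<le> r1 s ^ d" using rm_nonneg[OF assms] by (intro power_mono) (auto simp: rm_def)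
  then show ?thesis using assms rm_nonneg[OF assms] by (simp add: wY_def wN_def flip: ennreal_plus)
qed

lemma merge_B_iff:
  "merge Q P (q, p) \<in> B \<longleftrightarrow> nrm Q q \<le> 1 \<and> nrm P p \<le> r1 (nrm Q q)"
proof -
  have 1: "nrm I (merge Q P (q, p)) = sqrt ((nrm Q q)\<^sup>2 + (nrm P p)\<^sup>2)"
    by (simp add: nrm_Un[OF fin] nrm_merge[OF fin(3)])
  have q: "0 \<le> nrm Q q" "0 \<le> nrm P p" by simp_all
  have "merge Q P (q, p) \<in> B \<longleftrightarrow> (nrm P p)\<^sup>2 \<le> 1 - (nrm Q q)\<^sup>2"
    by (auto simp: B_def merge_in_space 1)
  also have "\<dots> \<longleftrightarrow> nrm Q q \<le> 1 \<and> nrm P p \<le> r1 (nrm Q q)"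
  proof (cases "nrm Q q \<le> 1")
    case True
    then show ?thesis
      using real_sqrt_le_iff[of "(nrm P p)\<^sup>2" "1 - (nrm Q q)\<^sup>2"] q by (simp add: r1_def)
  next
    case False
    then have "(nrm Q q)\<^sup>2 > 1" using q by (simp add: one_less_power)
    moreover have "(nrm P p)\<^sup>2 \<ge> 0" by simp
    ultimately have "\<not> (nrm P p)\<^sup>2 \<le> 1 - (nrm Q q)\<^sup>2" by linarith
    then show ?thesis using False by simp
  qed
  finally show ?thesis .
qed

lemma slice_outside:
  assumes "\<not> nrm Q q \<le> 1"
  shows "slice Q P (A \<inter> B) q = {}"
  using assms by (auto simp: merge_B_iff)

context
  fixes q D assumes q: "q \<in> space (Leb Q)" "nrm Q q \<le> 1" and Dm: "D \<in> sets (Leb I)"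
begin

text \<open>The slice outside the band lies between an open and a closed truncation of the slice of
  \<open>D\<close>, depending on how \<open>Y\<close> treats its boundary. Spheres are null, so both
  truncations have the volume \<open>G\<close>.\<close>

lemma slice_not_band_le:
  "vol P (slice Q P ((D - Y) \<inter> B) q) \<le> G Q P D q (rm (nrm Q q))"
proof -
  have "slice Q P ((D - Y) \<inter> B) q \<subseteq> {p \<in> slice Q P D q. nrm P p \<le> rm (nrm Q q)}"
    using Y(2)[OF merge_in_space] by (force simp: merge_B_iff rm_def nrm_merge[OF fin(3)] not_less)
  then have "vol P (slice Q P ((D - Y) \<inter> B) q) \<le> vol P {p \<in> slice Q P D q. nrm P p \<le> rm (nrm Q q)}"
    by (intro emeasure_mono sets_slice_ball Dm q)
  then show ?thesis by (simp only: G_closed[OF fin(2) P_ne Dm q(1)])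
qed

lemma slice_not_band_ge:
  "G Q P D q (rm (nrm Q q)) \<le> vol P (slice Q P ((D - Y) \<inter> B) q)"
  unfolding G_def
proof (rule emeasure_mono)
  show "{p \<in> slice Q P D q. nrm P p < rm (nrm Q q)} \<subseteq> slice Q P ((D - Y) \<inter> B) q"
    using q Y(3) by (force simp: merge_B_iff rm_def nrm_merge[OF fin(3)])
  show "slice Q P ((D - Y) \<inter> B) q \<in> sets (Leb P)" using Dm Y by (intro sets_slice q) auto
qed

lemma slice_split:
  "vol P (slice Q P (D \<inter> Y \<inter> B) q) + vol P (slice Q P ((D - Y) \<inter> B) q) = G Q P D q (r1 (nrm Q q))"
proof -
  have "vol P (slice Q P (D \<inter> Y \<inter> B) q) + vol P (slice Q P ((D - Y) \<inter> B) q) =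
    vol P (slice Q P (D \<inter> Y \<inter> B) q \<union> slice Q P ((D - Y) \<inter> B) q)"
    using Dm Y by (intro plus_emeasure sets_slice q) auto
  also have "slice Q P (D \<inter> Y \<inter> B) q \<union> slice Q P ((D - Y) \<inter> B) q = {p \<in> slice Q P D q. nrm P p \<le> r1 (nrm Q q)}"
    using q by (auto simp: merge_B_iff)
  finally show ?thesis by (simp only: G_closed[OF fin(2) P_ne Dm q(1)])
qed

end

text \<open>The equality case: slices that grow exactly like the power \<open>d\<close>, with a
  constant that does not depend on \<open>q\<close>, contribute in proportion to the weights. The
  part inside the band follows by cancelling the finite part outside.\<close>

lemma emeasure_split_weights:
  assumes Dm: "D \<in> sets (Leb I)"
    and g: "\<And>q s. q \<in> space (Leb Q) \<Longrightarrow> 0 \<le> s \<Longrightarrow> G Q P D q s = ennreal (s ^ d) * \<beta>"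
  shows "vol I (D \<inter> Y \<inter> B) = \<beta> * (\<integral>\<^sup>+q. wY (nrm Q q) \<partial>Leb Q)"
    and "vol I ((D - Y) \<inter> B) = \<beta> * (\<integral>\<^sup>+q. wN (nrm Q q) \<partial>Leb Q)"
proof -
  have N: "vol P (slice Q P ((D - Y) \<inter> B) q) = \<beta> * wN (nrm Q q)"
    if q: "q \<in> space (Leb Q)" for q
  proof (cases "nrm Q q \<le> 1")
    case True
    have "vol P (slice Q P ((D - Y) \<inter> B) q) = G Q P D q (rm (nrm Q q))"
      using slice_not_band_le[OF q True Dm] slice_not_band_ge[OF q True Dm] by (rule antisym)
    also have "\<dots> = \<beta> * wN (nrm Q q)"
      using g[OF q rm_nonneg[OF _ True]] True by (simp add: wN_def mult.commute)
    finally show ?thesis .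
  next
    case False
    then show ?thesis using slice_outside[OF False, of "D - Y"] by (simp only: wN_def) simp
  qed
  have YY: "vol P (slice Q P (D \<inter> Y \<inter> B) q) = \<beta> * wY (nrm Q q)"
    if q: "q \<in> space (Leb Q)" for q
  proof (cases "nrm Q q \<le> 1")
    case True
    let ?s = "nrm Q q"
    have "vol P (slice Q P (D \<inter> Y \<inter> B) q) + \<beta> * wN ?s = G Q P D q (r1 ?s)"
      using slice_split[OF q True Dm] N[OF q] by simp
    also have "\<dots> = \<beta> * wY ?s + \<beta> * wN ?s"
      using g[OF q r1_nonneg[OF _ True]] wY_plus[OF _ True] by (simp add: mult.commute flip: distrib_left)
    finally have "\<beta> * wN ?s + vol P (slice Q P (D \<inter> Y \<inter> B) q) = \<beta> * wN ?s + \<beta> * wY ?s"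
      by (simp add: add.commute)
    moreover have "\<beta> * wN ?s \<noteq> top"
    proof -
      have "\<beta> * wN ?s = G Q P D q (rm ?s)"
        using g[OF q rm_nonneg[OF _ True]] True by (simp add: wN_def mult.commute)
      then show ?thesis using G_finite[OF fin(2)] by (metis infinity_ennreal_def less_irrefl)
    qed
    ultimately show ?thesis unfolding ennreal_add_left_cancel by simp
  next
    case False
    then show ?thesis using slice_outside[OF False, of "D \<inter> Y"] by (simp only: wY_def) simp
  qed
  have m: "D \<inter> Y \<inter> B \<in> sets (Leb I)" "(D - Y) \<inter> B \<in> sets (Leb I)" using Dm Y by auto
  show "vol I (D \<inter> Y \<inter> B) = \<beta> * (\<integral>\<^sup>+q. wY (nrm Q q) \<partial>Leb Q)"
    unfolding emeasure_slices[OF fin m(1)]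
    by (subst nn_integral_cmult[symmetric], measurable, rule nn_integral_cong, erule YY)
  show "vol I ((D - Y) \<inter> B) = \<beta> * (\<integral>\<^sup>+q. wN (nrm Q q) \<partial>Leb Q)"
    unfolding emeasure_slices[OF fin m(2)]
    by (subst nn_integral_cmult[symmetric], measurable, rule nn_integral_cong, erule N)
qed

text \<open>Over every \<open>q\<close> the slice of the cylinder is the same cone \<open>K\<close>,
  so the constant in front of the weights is the volume of \<open>K\<close> in the unit ball.
  Hemispheres, joins and suspensions are all handled by this formula.\<close>

lemma emeasure_cylinder:
  assumes K: "homog P K" "K \<in> sets (Leb P)"
  defines "D \<equiv> {x \<in> space (Leb I). restrict x P \<in> K}"
  shows "D \<in> sets (Leb I)"
    and "vol I (D \<inter> Y \<inter> B) = vol P {p \<in> K. nrm P p \<le> 1} * (\<integral>\<^sup>+q. wY (nrm Q q) \<partial>Leb Q)"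
    and "vol I ((D - Y) \<inter> B) = vol P {p \<in> K. nrm P p \<le> 1} * (\<integral>\<^sup>+q. wN (nrm Q q) \<partial>Leb Q)"
proof -
  have "(\<lambda>x. restrict x P) \<in> measurable (Leb I) (Leb P)" by (rule measurable_restrict_subset) auto
  from measurable_sets[OF this K(2)] show Dm: "D \<in> sets (Leb I)" unfolding D_def by (simp add: vimage_def Int_def conj_commute)
  have KP: "K \<subseteq> PiE P (\<lambda>_. UNIV)" using K(1) by (simp add: homog_def)
  have sl: "slice Q P D q = K" for q
  proof -
    have "restrict (merge Q P (q, p)) P = p" if "p \<in> PiE P (\<lambda>_. UNIV)" for p
      using that fin(3) by (auto simp: merge_def PiE_iff extensional_def fun_eq_iff)
    then show ?thesis using KP by (auto simp: D_def merge_in_space) (auto simp: space_Leb)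
  qed
  have G: "G Q P D q s = ennreal (s ^ d) * vol P {p \<in> K. nrm P p \<le> 1}"
    if q: "q \<in> space (Leb Q)" and s: "0 \<le> s" for q s
  proof (cases "s = 0")
    case True
    then show ?thesis using P_ne fin by (simp add: G_nonpos card_gt_0_iff)
  next
    case False
    then have "G Q P D q s = ennreal (s ^ d) * vol P {p \<in> K. nrm P p < 1}"
      unfolding G_def sl using cone_ball_scale(1)[OF fin(2) K, of s 1] s by simp
    also have "vol P {p \<in> K. nrm P p < 1} = G Q P D q 1" by (simp add: G_def sl)
    also have "\<dots> = vol P {p \<in> K. nrm P p \<le> 1}"
      using G_closed[OF fin(2) P_ne Dm q, of 1] by (simp add: sl)
    finally show ?thesis .
  qed
  show "vol I (D \<inter> Y \<inter> B) = vol P {p \<in> K. nrm P p \<le> 1} * (\<integral>\<^sup>+q. wY (nrm Q q) \<partial>Leb Q)"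
    "vol I ((D - Y) \<inter> B) = vol P {p \<in> K. nrm P p \<le> 1} * (\<integral>\<^sup>+q. wN (nrm Q q) \<partial>Leb Q)"
    by (intro emeasure_split_weights Dm G; assumption)+
qed

text \<open>\<open>J\<close> interpolates between the two parts: outside the band the slices are at
  most \<open>wN * J\<close>, inside at least \<open>wY * J\<close>. Since \<open>J\<close> is
  constant along rays, its averages against the two weights are equal, and \<open>J\<close> drops
  out.\<close>

lemma band_ratio_ge:
  assumes D: "convcone I D" "D \<in> sets (Leb I)"
    and sym: "\<And>x. x \<in> D \<Longrightarrow> flip (I - {z}) x \<in> D"
  shows "vol I ((D - Y) \<inter> B) * (\<integral>\<^sup>+q. wY (nrm Q q) \<partial>Leb Q) \<le>
         vol I (D \<inter> Y \<inter> B) * (\<integral>\<^sup>+q. wN (nrm Q q) \<partial>Leb Q)"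
proof -
  note hD = convcone_imp_homog[OF D(1)]
  \<comment> \<open>When \<open>\<kappa> * nrm Q q = 0\<close> the truncated slice is empty, so
    \<open>J\<close> is 0 and the identities below hold there too; the convention for division by 0
    has no influence.\<close>
  define J where "J = (\<lambda>q. ennreal (1 / (\<kappa> * nrm Q q) ^ d) * G Q P D q (\<kappa> * nrm Q q))"
  have inv1: "ennreal (1 / r ^ d) * ennreal (r ^ d) = 1" if "r > 0" for r :: real
    using that by (subst ennreal_mult[symmetric]) auto
  have inv: "ennreal (1 / r ^ d) * (ennreal (r ^ d) * x) = x" "ennreal (r ^ d) * (ennreal (1 / r ^ d) * x) = x"
    if "r > 0" for r :: real and x
    using inv1[OF that] by (metis mult.assoc mult.commute mult_1)+
  have Jm [measurable]: "J \<in> borel_measurable (Leb Q)"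
  proof -
    have [measurable]: "nrm P \<in> borel_measurable (Leb I)" "nrm Q \<in> borel_measurable (Leb I)"
      by (auto intro: measurable_nrm_sub)
    have "{x \<in> D. nrm P x < \<kappa> * nrm Q x} = D \<inter> {x \<in> space (Leb I). nrm P x < \<kappa> * nrm Q x}"
      using sets.sets_into_space[OF D(2)] by auto
    then have S: "{x \<in> D. nrm P x < \<kappa> * nrm Q x} \<in> sets (Leb I)" using D(2) by simp
    have "slice Q P {x \<in> D. nrm P x < \<kappa> * nrm Q x} q = {p \<in> slice Q P D q. nrm P p < \<kappa> * nrm Q q}" for q
      by (auto simp: nrm_merge[OF fin(3)])
    then have [measurable]: "(\<lambda>q. G Q P D q (\<kappa> * nrm Q q)) \<in> borel_measurable (Leb Q)"
      using measurable_emeasure_slice[OF fin S] by (simp add: G_def)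
    show ?thesis unfolding J_def by measurable
  qed
  have Jle: "J q \<le> vol P {p \<in> space (Leb P). nrm P p \<le> 1}" if "q \<in> space (Leb Q)" for q
  proof (cases "\<kappa> * nrm Q q = 0")
    case True
    show ?thesis unfolding J_def True by (simp add: G_nonpos)
  next
    case False
    then have r: "\<kappa> * nrm Q q > 0" using \<kappa> by (simp add: less_le)
    have "J q \<le> ennreal (1 / (\<kappa> * nrm Q q) ^ d) * vol P {p \<in> space (Leb P). nrm P p \<le> (\<kappa> * nrm Q q) * 1}"
      unfolding J_def using G_le_ball[OF fin(2), of Q D q "\<kappa> * nrm Q q"] by (intro mult_left_mono) auto
    also have "\<dots> = ennreal (1 / (\<kappa> * nrm Q q) ^ d) * (ennreal ((\<kappa> * nrm Q q) ^ d) * vol P {p \<in> space (Leb P). nrm P p \<le> 1})"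
      using r by (subst cone_ball_scale(2)[OF fin(2) _ sets.top]) (auto simp: homog_def space_Leb)
    also have "\<dots> = vol P {p \<in> space (Leb P). nrm P p \<le> 1}"
      by (rule inv[OF r])
    finally show ?thesis .
  qed
  have Jfin: "J q < \<infinity>" for q
    unfolding J_def using G_finite[OF fin(2)] by (simp add: ennreal_mult_less_top)
  have Jhom: "J (\<lambda>i\<in>Q. t * q i) = J q" if q: "q \<in> space (Leb Q)" and t: "0 < t" for q t
  proof (cases "\<kappa> * nrm Q q = 0")
    case True
    have "nrm Q (\<lambda>i\<in>Q. t * q i) = t * nrm Q q" using t by (intro nrm_scale) simp
    then show ?thesis using True by (auto simp: J_def G_nonpos)
  next
    case False
    then have r: "\<kappa> * nrm Q q > 0" using \<kappa> by (simp add: less_le)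
    have n: "nrm Q (\<lambda>i\<in>Q. t * q i) = t * nrm Q q" using t by (intro nrm_scale) simp
    have "J (\<lambda>i\<in>Q. t * q i) = ennreal (1 / (t * (\<kappa> * nrm Q q)) ^ d) * G Q P D (\<lambda>i\<in>Q. t * q i) (t * (\<kappa> * nrm Q q))"
      unfolding J_def n by (simp add: mult_ac)
    also have "\<dots> = ennreal (1 / (t * (\<kappa> * nrm Q q)) ^ d) * (ennreal (t ^ d) * G Q P D q (\<kappa> * nrm Q q))"
      by (subst G_scale[OF fin(2,3) hD D(2) q t]) simp
    also have "\<dots> = ennreal (1 / (t * (\<kappa> * nrm Q q)) ^ d * t ^ d) * G Q P D q (\<kappa> * nrm Q q)"
    proof -
      have "0 < t * (\<kappa> * nrm Q q)" using t r by simp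
      then have "0 \<le> 1 / (t * (\<kappa> * nrm Q q)) ^ d" by simp
      then show ?thesis using t by (subst ennreal_mult) (auto simp: mult.assoc)
    qed
    also have "1 / (t * (\<kappa> * nrm Q q)) ^ d * t ^ d = 1 / (\<kappa> * nrm Q q) ^ d"
      using t r by (simp add: power_mult_distrib)
    finally show ?thesis unfolding J_def .
  qed
  have Jint: "(\<integral>\<^sup>+q. J q * indicator {..1} (nrm Q q) \<partial>Leb Q) < \<infinity>"
  proof -
    have "(\<integral>\<^sup>+q. J q * indicator {..1} (nrm Q q) \<partial>Leb Q) \<le>
      (\<integral>\<^sup>+q. vol P {p \<in> space (Leb P). nrm P p \<le> 1} * indicator {q \<in> space (Leb Q). nrm Q q \<le> 1} q \<partial>Leb Q)"
      using Jle by (intro nn_integral_mono) (auto simp: indicator_def)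
    also have "\<dots> = vol P {p \<in> space (Leb P). nrm P p \<le> 1} * vol Q {q \<in> space (Leb Q). nrm Q q \<le> 1}"
      by (simp add: nn_integral_cmult)
    also have "\<dots> < \<infinity>" using emeasure_ball_finite fin by (simp add: ennreal_mult_less_top)
    finally show ?thesis .
  qed
  have Jeq: "G Q P D q (\<kappa> * nrm Q q) = ennreal ((\<kappa> * nrm Q q) ^ d) * J q" for q
  proof (cases "\<kappa> * nrm Q q = 0")
    case False
    then have r: "\<kappa> * nrm Q q > 0" using \<kappa> by (simp add: less_le)
    show ?thesis unfolding J_def inv(2)[OF r] ..
  next
    case True
    show ?thesis unfolding J_def True by (simp add: G_nonpos)
  qed
  have ratio: "ennreal (\<rho> ^ d) * G Q P D q \<rho>' \<le> ennreal (\<rho>' ^ d) * G Q P D q \<rho>"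
    if "q \<in> space (Leb Q)" "0 < \<rho>'" "\<rho>' \<le> \<rho>" for q \<rho> \<rho>'
    using G_mono_ratio[OF fin(2,3) zP D sym that] .
  have cancel: "x \<le> y" if "ennreal c * x \<le> ennreal c * y" "c > 0" for x y c
    using that ennreal_mult_le_mult_iff[of "ennreal c" x y] by simp
  \<comment> \<open>The outer radius \<open>rm\<close> is at most the threshold
    \<open>\<kappa> * nrm Q q\<close>, so the growth quotient there is bounded by its value
    \<open>J\<close> at the threshold.\<close>
  have N: "vol P (slice Q P ((D - Y) \<inter> B) q) \<le> wN (nrm Q q) * J q"
    if q: "q \<in> space (Leb Q)" for q
  proof (cases "nrm Q q \<le> 1")
    case True
    let ?s = "nrm Q q"
    have "vol P (slice Q P ((D - Y) \<inter> B) q) \<le> G Q P D q (rm ?s)"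
      by (rule slice_not_band_le[OF q True D(2)])
    also have "\<dots> \<le> ennreal (rm ?s ^ d) * J q"
    proof (cases "rm ?s = 0")
      case False
      then have rm: "rm ?s > 0" using rm_nonneg[OF _ True] by (simp add: less_le)
      have r: "rm ?s \<le> \<kappa> * ?s" by (simp add: rm_def)
      have "ennreal ((\<kappa> * ?s) ^ d) * G Q P D q (rm ?s) \<le> ennreal (rm ?s ^ d) * G Q P D q (\<kappa> * ?s)"
        by (rule ratio[OF q rm r])
      also have "\<dots> = ennreal ((\<kappa> * ?s) ^ d) * (ennreal (rm ?s ^ d) * J q)"
        unfolding Jeq by (simp add: mult_ac)
      finally show ?thesis by (rule cancel) (use rm r in simp)
    qed (simp add: G_nonpos)
    finally show ?thesis using True by (simp add: wN_def)
  next
    case False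
    show ?thesis unfolding slice_outside[OF False] by simp
  qed
  \<comment> \<open>If the threshold lies inside the ball, the full slice is at least
    \<open>r1^d * J\<close> by monotonicity of the quotient; removing the outer part, at most
    \<open>wN * J\<close>, leaves \<open>wY * J\<close>. In all remaining cases \<open>wY\<close> or
    \<open>J\<close> vanishes.\<close>
  have YY: "wY (nrm Q q) * J q \<le> vol P (slice Q P (D \<inter> Y \<inter> B) q)"
    if q: "q \<in> space (Leb Q)" for q
  proof (cases "nrm Q q \<le> 1 \<and> 0 < \<kappa> * nrm Q q \<and> \<kappa> * nrm Q q < r1 (nrm Q q)")
    case True
    let ?s = "nrm Q q"
    have s: "?s \<le> 1" "0 < \<kappa> * ?s" "\<kappa> * ?s \<le> r1 ?s" using True by auto
    have rm: "rm ?s = \<kappa> * ?s" using True by (simp add: rm_def)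
    have "ennreal ((\<kappa> * ?s) ^ d) * (ennreal (r1 ?s ^ d) * J q) = ennreal (r1 ?s ^ d) * G Q P D q (\<kappa> * ?s)"
      unfolding Jeq by (simp add: mult_ac)
    also have "\<dots> \<le> ennreal ((\<kappa> * ?s) ^ d) * G Q P D q (r1 ?s)"
      by (rule ratio[OF q s(2,3)])
    finally have 1: "ennreal (r1 ?s ^ d) * J q \<le> G Q P D q (r1 ?s)" by (rule cancel) (use s in simp)
    have "wN ?s * J q + wY ?s * J q = ennreal (r1 ?s ^ d) * J q"
      using wY_plus[OF _ s(1)] by (simp add: add.commute flip: distrib_right)
    also have "\<dots> \<le> vol P (slice Q P (D \<inter> Y \<inter> B) q) + vol P (slice Q P ((D - Y) \<inter> B) q)"
      using 1 slice_split[OF q s(1) D(2)] by simp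
    also have "\<dots> \<le> vol P (slice Q P (D \<inter> Y \<inter> B) q) + wN ?s * J q"
      by (intro add_left_mono N q)
    finally have "wN ?s * J q + wY ?s * J q \<le> wN ?s * J q + vol P (slice Q P (D \<inter> Y \<inter> B) q)"
      by (simp add: add.commute)
    moreover have "wN ?s * J q \<noteq> top" using Jfin[of q] by (auto simp: wN_def ennreal_mult_eq_top_iff)
    ultimately show ?thesis by (simp add: ennreal_add_left_cancel_le)
  next
    case False
    then consider "\<not> nrm Q q \<le> 1" | "\<not> 0 < \<kappa> * nrm Q q" | "nrm Q q \<le> 1" "r1 (nrm Q q) \<le> \<kappa> * nrm Q q" by linarith
    then have "wY (nrm Q q) * J q = 0"
    proof cases
      case 1
      then show ?thesis by (simp add: wY_def)
    next
      case 2
      then have 0: "\<kappa> * nrm Q q = 0" using \<kappa> by (simp add: less_le)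
      show ?thesis unfolding J_def 0 by (simp add: G_nonpos)
    next
      case 3
      then show ?thesis by (simp add: wY_def rm_def)
    qed
    then show ?thesis by (simp only: zero_le)
  qed
  have m: "D \<inter> Y \<inter> B \<in> sets (Leb I)" "(D - Y) \<inter> B \<in> sets (Leb I)" using D Y by auto
  have "vol I ((D - Y) \<inter> B) \<le> (\<integral>\<^sup>+q. wN (nrm Q q) * J q \<partial>Leb Q)"
    unfolding emeasure_slices[OF fin m(2)] by (intro nn_integral_mono N)
  then have "vol I ((D - Y) \<inter> B) * (\<integral>\<^sup>+q. wY (nrm Q q) \<partial>Leb Q) \<le>
     (\<integral>\<^sup>+q. wN (nrm Q q) * J q \<partial>Leb Q) * (\<integral>\<^sup>+q. wY (nrm Q q) \<partial>Leb Q)"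
    by (rule mult_right_mono) simp
  also have "\<dots> = (\<integral>\<^sup>+q. wY (nrm Q q) * J q \<partial>Leb Q) * (\<integral>\<^sup>+q. wN (nrm Q q) \<partial>Leb Q)"
    by (rule radial_average[OF fin(1) Jm Jhom Jint measurable_weights(2,1)]) (simp_all add: wY_def wN_def)
  also have "\<dots> \<le> vol I (D \<inter> Y \<inter> B) * (\<integral>\<^sup>+q. wN (nrm Q q) \<partial>Leb Q)"
    unfolding emeasure_slices[OF fin m(1)] by (intro mult_right_mono nn_integral_mono YY) simp_all
  finally show ?thesis .
qed

text \<open>\<open>H\<close> is a cylinder because \<open>z\<close> is a coordinate of
  \<open>P\<close>, so its parts inside and outside the band are in the ratio of the two weight
  integrals. After splitting both sides along the band, the product of the inner parts is common and
  \<open>band_ratio_ge\<close> compares the rest.\<close>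

lemma band_correlation:
  assumes D: "convcone I D" "D \<in> sets (Leb I)"
    and sym: "\<And>x. x \<in> D \<Longrightarrow> flip (I - {z}) x \<in> D"
  defines "H \<equiv> {x \<in> space (Leb I). 0 < x z}"
  shows "vol I (D \<inter> B) * vol I (H \<inter> Y \<inter> B) \<le>
         vol I (D \<inter> Y \<inter> B) * vol I (H \<inter> B)"
proof -
  let ?\<mu> = "vol I"
  define K where "K = {p \<in> space (Leb P). 0 < p z}"
  have [measurable]: "(\<lambda>p. p z) \<in> borel_measurable (Leb P)"
    using measurable_component_singleton[of z P "\<lambda>_. lborel :: real measure"] zP by simp
  have "homog P K" using zP by (auto simp: K_def homog_def space_Leb)
  moreover have "K \<in> sets (Leb P)" unfolding K_def by measurable
  ultimately have K: "homog P K" "K \<in> sets (Leb P)" by auto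
  have H: "H = {x \<in> space (Leb I). restrict x P \<in> K}"
    using zP by (auto simp: H_def K_def space_Leb)
  let ?\<beta> = "vol P {p \<in> K. nrm P p \<le> 1}"
  let ?a = "\<integral>\<^sup>+q. wY (nrm Q q) \<partial>Leb Q" and ?b = "\<integral>\<^sup>+q. wN (nrm Q q) \<partial>Leb Q"
  have Hm: "H \<in> sets (Leb I)" and HY: "?\<mu> (H \<inter> Y \<inter> B) = ?\<beta> * ?a" and HN: "?\<mu> ((H - Y) \<inter> B) = ?\<beta> * ?b"
    unfolding H by (rule emeasure_cylinder[OF K])+
  have split: "?\<mu> (A \<inter> B) = ?\<mu> (A \<inter> Y \<inter> B) + ?\<mu> ((A - Y) \<inter> B)" if "A \<in> sets (Leb I)" for A
    using that Y by (subst plus_emeasure) (auto intro!: arg_cong[where f="?\<mu>"])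
  have "?\<mu> (D \<inter> B) * ?\<mu> (H \<inter> Y \<inter> B) = ?\<mu> (D \<inter> Y \<inter> B) * (?\<beta> * ?a) + ?\<beta> * (?\<mu> ((D - Y) \<inter> B) * ?a)"
    unfolding split[OF D(2)] HY by (simp add: algebra_simps)
  also have "\<dots> \<le> ?\<mu> (D \<inter> Y \<inter> B) * (?\<beta> * ?a) + ?\<beta> * (?\<mu> (D \<inter> Y \<inter> B) * ?b)"
    by (intro add_left_mono mult_left_mono band_ratio_ge D sym) auto
  also have "\<dots> = ?\<mu> (D \<inter> Y \<inter> B) * ?\<mu> (H \<inter> B)"
    unfolding split[OF Hm] HY HN by (simp add: algebra_simps)
  finally show ?thesis .
qed

end

subsection \<open>Orthonormal bases\<close>

lemma ip_cong: "(\<And>i. i \<le> n \<Longrightarrow> x i = y i) \<Longrightarrow> ip n x w = ip n y w"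
  by (simp add: ip_def)

lemma ip_commute: "ip n x y = ip n y x"
  by (simp add: ip_def mult.commute)

lemma ip_combine: "ip n (\<lambda>i\<in>{..n}. a * x i + b * y i) w = a * ip n x w + b * ip n y w"
  by (simp add: ip_def ring_distribs sum.distrib sum_distrib_left mult.assoc)

lemma ip_restrict [simp]: "ip n (restrict x {..n}) w = ip n x w" "ip n w (restrict x {..n}) = ip n w x"
  by (simp_all add: ip_def)

lemma ip_sum: "ip n (\<lambda>i. \<Sum>j\<in>J. a j * e j i) w = (\<Sum>j\<in>J. a j * ip n (e j) w)"
  by (simp add: ip_def sum_distrib_right sum_distrib_left mult.assoc) (rule sum.swap)

lemma ip_diff: "ip n (\<lambda>i. x i - y i) w = ip n x w - ip n y w"
  by (simp add: ip_def left_diff_distrib sum_subtractf)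

lemma ip_scale: "ip n (\<lambda>i. a * x i) w = a * ip n x w"
  by (simp add: ip_def sum_distrib_left mult.assoc)

lemma ip_self_nonneg: "0 \<le> ip n x x"
  by (simp add: ip_def sum_nonneg)

lemma ip_self_eq_0: "ip n x x = 0 \<longleftrightarrow> (\<forall>i\<le>n. x i = 0)"
  by (auto simp: ip_def sum_nonneg_eq_0_iff)

definition ONF :: "nat \<Rightarrow> nat \<Rightarrow> (nat \<Rightarrow> nat \<Rightarrow> real) \<Rightarrow> bool" where
  "ONF n m e \<longleftrightarrow> (\<forall>j<m. \<forall>k<m. ip n (e j) (e k) = (if j = k then 1 else 0))"

definition resid :: "nat \<Rightarrow> nat \<Rightarrow> (nat \<Rightarrow> nat \<Rightarrow> real) \<Rightarrow> (nat \<Rightarrow> real) \<Rightarrow> nat \<Rightarrow> real" where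
  "resid n m e x = (\<lambda>i. x i - (\<Sum>j<m. ip n x (e j) * e j i))"

lemma ip_resid:
  assumes "ONF n m e" "k < m"
  shows "ip n (resid n m e x) (e k) = 0"
proof -
  have "(\<Sum>j<m. ip n x (e j) * ip n (e j) (e k)) = (\<Sum>j<m. if j = k then ip n x (e j) else 0)"
    using assms by (intro sum.cong) (auto simp: ONF_def)
  then show ?thesis using assms by (simp add: resid_def ip_diff ip_sum)
qed

lemma ip_resid_self:
  assumes "ONF n m e"
  shows "ip n (resid n m e x) (resid n m e x) = ip n x x - (\<Sum>j<m. (ip n x (e j))\<^sup>2)"
proof -
  let ?r = "resid n m e x"
  have sub: "ip n ?r w = ip n x w - (\<Sum>j<m. ip n x (e j) * ip n (e j) w)" for w
    by (simp add: resid_def ip_diff ip_sum)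
  have "ip n (e j) ?r = 0" if "j < m" for j
    using ip_resid[OF assms that] by (subst ip_commute)
  then have "ip n ?r ?r = ip n x ?r" by (subst sub) simp
  also have "\<dots> = ip n ?r x" by (rule ip_commute)
  also have "\<dots> = ip n x x - (\<Sum>j<m. (ip n x (e j))\<^sup>2)"
    unfolding sub power2_eq_square using ip_commute[of n _ x] by (metis (no_types, lifting))
  finally show ?thesis .
qed

lemma ONF_extend:
  assumes "ONF n m e" "ip n r r \<noteq> 0" "\<And>k. k < m \<Longrightarrow> ip n r (e k) = 0"
  shows "ONF n (Suc m) (e(m := (\<lambda>i\<in>{..n}. (1 / sqrt (ip n r r)) * r i)))"
proof -
  let ?v = "\<lambda>i\<in>{..n}. (1 / sqrt (ip n r r)) * r i"
  have pos: "ip n r r > 0" using assms(2) ip_self_nonneg[of n r] by linarith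
  have 1: "ip n ?v w = (1 / sqrt (ip n r r)) * ip n r w" for w
    using ip_scale[of n "1 / sqrt (ip n r r)" r w] by simp
  have "ip n ?v ?v = 1" using pos unfolding 1 by (subst ip_commute, subst 1) (simp flip: power2_eq_square)
  moreover have "ip n ?v (e k) = 0" "ip n (e k) ?v = 0" if "k < m" for k
    using assms(3)[OF that] 1[of "e k"] ip_commute[of n "e k" ?v] by auto
  ultimately show ?thesis using assms(1) unfolding ONF_def by (auto simp: less_Suc_eq)
qed

text \<open>A double count that stands in for dimension theory: for each coordinate \<open>i\<close>
  the sum over \<open>j\<close> is at most 1, so \<open>m\<close> vectors need
  \<open>m \<le> n + 1\<close>, and equality forces every one of these sums to be 1.\<close>

lemma ONF_trace: "ONF n m e \<Longrightarrow> (\<Sum>i\<le>n. \<Sum>j<m. (e j i)\<^sup>2) = real m"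
  by (subst sum.swap) (simp add: ONF_def ip_def power2_eq_square)

lemma ip_unit: "i \<le> n \<Longrightarrow> ip n (\<lambda>k. if k = i then 1 else 0) w = w i"
proof -
  assume "i \<le> n"
  moreover have "ip n (\<lambda>k. if k = i then 1 else 0) w = (\<Sum>k\<le>n. if k = i then w k else 0)"
    unfolding ip_def by (intro sum.cong) auto
  ultimately show ?thesis by simp
qed

text \<open>Bessel's inequality for the \<open>i\<close>-th unit vector. Its residual has squared
  norm 1 minus the sum; when that is 0 the residual vanishes, and its coordinates are the
  orthogonality relations in the other index.\<close>

lemma ONF_row_le:
  assumes "ONF n m e" "i \<le> n"
  shows "(\<Sum>j<m. (e j i)\<^sup>2) \<le> 1"
    and "(\<Sum>j<m. (e j i)\<^sup>2) = 1 \<Longrightarrow> k \<le> n \<Longrightarrow> (\<Sum>j<m. e j i * e j k) = (if i = k then 1 else 0)"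
    and "ip n (resid n m e (\<lambda>k. if k = i then 1 else 0)) (resid n m e (\<lambda>k. if k = i then 1 else 0)) = 1 - (\<Sum>j<m. (e j i)\<^sup>2)"
proof -
  let ?r = "resid n m e (\<lambda>k. if k = i then 1 else 0)"
  show 1: "ip n ?r ?r = 1 - (\<Sum>j<m. (e j i)\<^sup>2)"
    by (simp add: ip_resid_self[OF assms(1)] ip_unit[OF assms(2)])
  show "(\<Sum>j<m. (e j i)\<^sup>2) \<le> 1" using 1 ip_self_nonneg[of n ?r] by linarith
  assume s: "(\<Sum>j<m. (e j i)\<^sup>2) = 1" and k: "k \<le> n"
  have "?r k = 0" using 1 s k ip_self_eq_0[of n ?r] by simp
  then show "(\<Sum>j<m. e j i * e j k) = (if i = k then 1 else 0)"
    using assms(2) by (auto simp: resid_def ip_unit)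
qed

lemma ONF_card_le:
  assumes "ONF n m e" shows "m \<le> n + 1"
proof -
  have "real m \<le> (\<Sum>i\<le>n. 1)"
    unfolding ONF_trace[OF assms, symmetric] using ONF_row_le(1)[OF assms] by (intro sum_mono) auto
  then show ?thesis by simp
qed

lemma ONF_complete:
  assumes "ONF n (n + 1) e" "i \<le> n" "k \<le> n"
  shows "(\<Sum>j\<le>n. e j i * e j k) = (if i = k then 1 else 0)"
proof -
  have "(\<Sum>j<n+1. (e j i)\<^sup>2) = 1"
  proof (rule ccontr)
    assume "(\<Sum>j<n+1. (e j i)\<^sup>2) \<noteq> 1"
    then have "(\<Sum>j<n+1. (e j i)\<^sup>2) < 1" using ONF_row_le(1)[OF assms(1,2)] by linarith
    then have "(\<Sum>i\<le>n. \<Sum>j<n+1. (e j i)\<^sup>2) < (\<Sum>i\<le>n. 1)"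
      using ONF_row_le(1)[OF assms(1)] assms(2) by (intro sum_strict_mono_ex1) auto
    then show False using ONF_trace[OF assms(1)] by simp
  qed
  from ONF_row_le(2)[OF assms(1,2) this assms(3)] show ?thesis by (simp add: lessThan_Suc_atMost)
qed

text \<open>As long as \<open>m \<le> n\<close>, the double count shows that some unit vector has a
  nonzero residual; normalized, it is the next member of the family.\<close>

lemma ONF_extend_full:
  assumes "ONF n m e"
  shows "\<exists>e'. ONF n (n + 1) e' \<and> (\<forall>j<m. e' j = e j)"
  using assms
proof (induction "n + 1 - m" arbitrary: m e)
  case 0
  then have "m = n + 1" using ONF_card_le[OF 0(2)] by simp
  then show ?case using 0(2) by blast
next
  case (Suc l)
  have "\<exists>i\<le>n. (\<Sum>j<m. (e j i)\<^sup>2) < 1"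
  proof (rule ccontr)
    assume "\<not> ?thesis"
    then have "(\<Sum>i\<le>n. 1) \<le> (\<Sum>i\<le>n. \<Sum>j<m. (e j i)\<^sup>2)" by (intro sum_mono) (auto simp: not_less)
    then show False using ONF_trace[OF Suc(3)] Suc(2) by simp
  qed
  then obtain i where i: "i \<le> n" "(\<Sum>j<m. (e j i)\<^sup>2) < 1" by auto
  let ?r = "resid n m e (\<lambda>k. if k = i then 1 else 0)"
  have "ip n ?r ?r \<noteq> 0" using ONF_row_le(3)[OF Suc(3) i(1)] i(2) by linarith
  from ONF_extend[OF Suc(3) this ip_resid[OF Suc(3)]]
  obtain v where v: "ONF n (Suc m) (e(m := v))" by blast
  have "l = n + 1 - Suc m" using Suc(2) by simp
  from Suc(1)[OF this v] obtain e' where "ONF n (n + 1) e'" "\<forall>j<Suc m. e' j = (e(m := v)) j"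
    by blast
  then show ?case by (intro exI[of _ e']) auto
qed

lemma lsubspace_combine:
  assumes "lsubspace n d E" "x \<in> E" "y \<in> E"
  shows "(\<lambda>i\<in>{..n}. s * x i + t * y i) \<in> E"
proof -
  obtain b where E: "E = {restrict (\<lambda>i. \<Sum>j<d. c j * b j i) {..n} | c. True}"
    using assms(1) unfolding lsubspace_def by blast
  obtain c c' where "x = restrict (\<lambda>i. \<Sum>j<d. c j * b j i) {..n}" "y = restrict (\<lambda>i. \<Sum>j<d. c' j * b j i) {..n}"
    using assms(2,3) E by auto
  then have "(\<lambda>i\<in>{..n}. s * x i + t * y i) = restrict (\<lambda>i. \<Sum>j<d. (s * c j + t * c' j) * b j i) {..n}"
    by (auto simp: ring_distribs sum.distrib sum_distrib_left mult.assoc)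
  then show ?thesis unfolding E by (intro CollectI exI[of _ "\<lambda>j. s * c j + t * c' j"]) simp
qed

lemma lsubspace_sum:
  fixes m :: nat
  assumes "lsubspace n d E" "\<And>j. j < m \<Longrightarrow> e j \<in> E"
  shows "(\<lambda>i\<in>{..n}. \<Sum>j<m. a j * e j i) \<in> E"
  using assms(2)
proof (induction m)
  case 0
  obtain b where "E = {restrict (\<lambda>i. \<Sum>j<d. c j * b j i) {..n} | c. True}"
    using assms(1) unfolding lsubspace_def by blast
  then show ?case by (auto intro!: exI[of _ "\<lambda>_. 0"])
next
  case (Suc m)
  have "(\<lambda>i\<in>{..n}. 1 * (\<lambda>i\<in>{..n}. \<Sum>j<m. a j * e j i) i + a m * e m i) \<in> E"
    using Suc by (intro lsubspace_combine[OF assms(1)]) auto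
  also have "(\<lambda>i\<in>{..n}. 1 * (\<lambda>i\<in>{..n}. \<Sum>j<m. a j * e j i) i + a m * e m i) = (\<lambda>i\<in>{..n}. \<Sum>j<Suc m. a j * e j i)"
    by auto
  finally show ?case .
qed

lemma lsubspace_Rsp: "lsubspace n d E \<Longrightarrow> E \<subseteq> Rsp n"
  unfolding lsubspace_def Rsp_def by (auto simp: PiE_iff extensional_def split: if_splits)

text \<open>Take a longest orthonormal family inside \<open>E\<close> that starts with
  \<open>c\<close>, and complete it to a basis; \<open>E\<close> is then the zero set of the
  coordinates from \<open>m\<close> on. The number \<open>m\<close> arises as this maximum and is
  bounded only by \<open>n + 1\<close>.\<close>

lemma adapted_basis:
  assumes E: "lsubspace n d E" and c: "c \<in> E" "c \<in> sph n"
  obtains m e where "1 \<le> m" "m \<le> n + 1" "e 0 = c" "ONF n (n + 1) e" "\<And>j. j < m \<Longrightarrow> e j \<in> E"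
    "E = {x \<in> Rsp n. \<forall>j\<in>{m..n}. ip n x (e j) = 0}"
proof -
  define S where "S = {m. \<exists>e. ONF n m e \<and> e 0 = c \<and> (\<forall>j<m. e j \<in> E) \<and> 1 \<le> m}"
  have "S \<subseteq> {..n+1}" using ONF_card_le by (auto simp: S_def)
  then have fS: "finite S" by (rule finite_subset) simp
  have "1 \<in> S" using c by (auto simp: S_def ONF_def sph_def intro!: exI[of _ "\<lambda>_. c"])
  then have "Max S \<in> S" using Max_in[OF fS] by auto
  then obtain e where e: "ONF n (Max S) e" "e 0 = c" "\<forall>j<Max S. e j \<in> E" "1 \<le> Max S" by (auto simp: S_def)
  define m where "m = Max S"
  note e = e[folded m_def]
  obtain e' where e': "ONF n (n + 1) e'" "\<forall>j<m. e' j = e j" using ONF_extend_full[OF e(1)] by auto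
  have mn: "m \<le> n + 1" using ONF_card_le[OF e(1)] .
  \<comment> \<open>A nonzero residual of a vector of \<open>E\<close> lies in \<open>E\<close>;
    normalized, it would lengthen the family beyond the maximum.\<close>
  have span: "\<forall>i\<le>n. resid n m e x i = 0" if x: "x \<in> E" for x
  proof (rule ccontr)
    let ?r = "resid n m e x"
    assume "\<not> (\<forall>i\<le>n. ?r i = 0)"
    then have r: "ip n ?r ?r \<noteq> 0" by (simp add: ip_self_eq_0)
    have "(\<lambda>i\<in>{..n}. 1 * x i + (-1) * (\<lambda>i\<in>{..n}. \<Sum>j<m. ip n x (e j) * e j i) i) \<in> E"
      using e by (intro lsubspace_combine[OF E] x lsubspace_sum[OF E]) auto
    also have "(\<lambda>i\<in>{..n}. 1 * x i + (-1) * (\<lambda>i\<in>{..n}. \<Sum>j<m. ip n x (e j) * e j i) i) = restrict ?r {..n}"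
      by (auto simp: resid_def)
    finally have "restrict ?r {..n} \<in> E" .
    from lsubspace_combine[OF E this this, of "1 / sqrt (ip n ?r ?r)" 0]
    have v: "(\<lambda>i\<in>{..n}. 1 / sqrt (ip n ?r ?r) * ?r i) \<in> E" by (simp cong: restrict_cong)
    have "Suc m \<in> S"
      using ONF_extend[OF e(1) r ip_resid[OF e(1)]] v e
      unfolding S_def by (intro CollectI exI[of _ "e(m := (\<lambda>i\<in>{..n}. 1 / sqrt (ip n ?r ?r) * ?r i))"]) (auto simp: less_Suc_eq)
    then have "Suc m \<le> m" unfolding m_def using fS by simp
    then show False by simp
  qed
  have "E = {x \<in> Rsp n. \<forall>j\<in>{m..n}. ip n x (e' j) = 0}"
  proof (intro equalityI subsetI CollectI conjI ballI)
    fix x assume x: "x \<in> E"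
    then show "x \<in> Rsp n" using lsubspace_Rsp[OF E] by auto
    fix j assume j: "j \<in> {m..n}"
    have "ip n x (e' j) = ip n (\<lambda>i. \<Sum>k<m. ip n x (e k) * e' k i) (e' j)"
      using span[OF x] e'(2) by (intro ip_cong) (simp add: resid_def)
    also have "\<dots> = (\<Sum>k<m. ip n x (e k) * ip n (e' k) (e' j))" by (rule ip_sum)
    also have "\<dots> = 0" using e'(1) j by (intro sum.neutral) (auto simp: ONF_def)
    finally show "ip n x (e' j) = 0" .
  next
    fix x assume x: "x \<in> {x \<in> Rsp n. \<forall>j\<in>{m..n}. ip n x (e' j) = 0}"
    have "(\<lambda>i\<in>{..n}. \<Sum>j<m. ip n x (e' j) * e' j i) \<in> E"
      using e e' by (intro lsubspace_sum[OF E]) auto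
    also have "(\<lambda>i\<in>{..n}. \<Sum>j<m. ip n x (e' j) * e' j i) = x"
    proof
      fix i
      show "(\<lambda>i\<in>{..n}. \<Sum>j<m. ip n x (e' j) * e' j i) i = x i"
      proof (cases "i \<le> n")
        case True
        have "(\<Sum>j<m. ip n x (e' j) * e' j i) = (\<Sum>j\<le>n. ip n x (e' j) * e' j i)"
          using x mn by (intro sum.mono_neutral_left) (auto simp: not_less)
        also have "\<dots> = (\<Sum>j\<le>n. \<Sum>k\<le>n. x k * (e' j k * e' j i))"
          by (simp add: ip_def sum_distrib_right mult.assoc)
        also have "\<dots> = (\<Sum>k\<le>n. x k * (\<Sum>j\<le>n. e' j k * e' j i))"
          by (subst sum.swap) (simp add: sum_distrib_left)
        also have "\<dots> = (\<Sum>k\<le>n. if k = i then x k else 0)"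
          using True ONF_complete[OF e'(1)] by (intro sum.cong) auto
        finally show ?thesis using True by simp
      next
        case False
        then show ?thesis using x by (auto simp: Rsp_def PiE_iff extensional_def)
      qed
    qed
    finally show "x \<in> E" .
  qed
  then show ?thesis using that[of m e'] e e' mn by auto
qed

subsection \<open>Cones over subsets of the sphere\<close>

lemma Rsp_eq: "Rsp n = space (Leb {..n})"
  by (simp add: Rsp_def space_Leb)

lemma nrm_ip: "nrm {..n} x = sqrt (ip n x x)"
  by (simp add: L2_set_def ip_def power2_eq_square)

lemma sph_iff: "x \<in> sph n \<longleftrightarrow> x \<in> Rsp n \<and> nrm {..n} x = 1"
  by (simp add: sph_def nrm_ip)

lemma ip_le_nrm: "\<bar>ip n x y\<bar> \<le> nrm {..n} x * nrm {..n} y"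
proof -
  have "\<bar>ip n x y\<bar> \<le> (\<Sum>i\<le>n. \<bar>x i\<bar> * \<bar>y i\<bar>)"
    unfolding ip_def by (rule order_trans[OF sum_abs]) (simp add: abs_mult)
  also have "\<dots> \<le> nrm {..n} x * nrm {..n} y" by (rule L2_set_mult_ineq)
  finally show ?thesis .
qed

lemma ip_sph_bounds:
  assumes "x \<in> sph n" "y \<in> sph n"
  shows "- 1 \<le> ip n x y" "ip n x y \<le> 1"
  using ip_le_nrm[of n x y] assms by (auto simp: sph_iff)

lemma arccos_less_iff':
  assumes "-1 \<le> a" "a \<le> 1" "0 \<le> r" "r \<le> pi"
  shows "arccos a < r \<longleftrightarrow> cos r < a" "arccos a \<le> r \<longleftrightarrow> cos r \<le> a"
proof -
  have r: "arccos (cos r) = r" using assms by (simp add: arccos_cos)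
  have c: "-1 \<le> cos r" "cos r \<le> 1" by auto
  show "arccos a < r \<longleftrightarrow> cos r < a" using arccos_less_mono[of a "cos r"] assms c r by (auto simp: abs_le_iff)
  show "arccos a \<le> r \<longleftrightarrow> cos r \<le> a" using arccos_le_mono[of a "cos r"] assms c r by (auto simp: abs_le_iff)
qed

lemma sball_iff:
  assumes "c \<in> sph n" "0 \<le> r" "r \<le> pi"
  shows "x \<in> sball n c r \<longleftrightarrow> x \<in> sph n \<and> cos r < ip n c x"
  using ip_sph_bounds[OF assms(1), of x] arccos_less_iff'(1)[of "ip n c x" r] assms
  by (auto simp: sball_def sdist_def)

lemma hemi_iff: "c \<in> sph n \<Longrightarrow> x \<in> sball n c (pi/2) \<longleftrightarrow> x \<in> sph n \<and> 0 < ip n c x"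
  by (simp add: sball_iff)

text \<open>The unbounded cone without its apex. It is homogeneous, unlike \<open>scone\<close>,
  which is its part in the closed unit ball.\<close>

definition fcone :: "nat \<Rightarrow> (nat \<Rightarrow> real) set \<Rightarrow> (nat \<Rightarrow> real) set" where
  "fcone n A = {x \<in> Rsp n. 0 < nrm {..n} x \<and> (\<lambda>i\<in>{..n}. 1 / nrm {..n} x * x i) \<in> A}"

lemma fcone_Int: "fcone n (A \<inter> A') = fcone n A \<inter> fcone n A'"
  by (auto simp: fcone_def)

lemma homog_fcone: "homog {..n} (fcone n A)"
  unfolding homog_def
proof (intro conjI ballI allI impI)
  show "fcone n A \<subseteq> {..n} \<rightarrow>\<^sub>E UNIV" by (auto simp: fcone_def Rsp_def)
  fix x t assume x: "x \<in> fcone n A" and t: "0 < (t::real)"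
  let ?y = "\<lambda>i\<in>{..n}. t * x i"
  have n: "nrm {..n} ?y = t * nrm {..n} x" using t by (intro nrm_scale) simp
  have "(\<lambda>i\<in>{..n}. 1 / nrm {..n} ?y * ?y i) = (\<lambda>i\<in>{..n}. 1 / nrm {..n} x * x i)"
    unfolding n using t by auto
  then show "?y \<in> fcone n A" using x t n by (simp add: fcone_def Rsp_def)
qed

lemma fcone_scale:
  assumes "A \<subseteq> sph n" "u \<in> A" "0 < t"
  shows "(\<lambda>i\<in>{..n}. t * u i) \<in> fcone n A"
proof -
  have u: "u \<in> Rsp n" "nrm {..n} u = 1" using assms by (auto simp: sph_iff)
  then have "(\<lambda>i\<in>{..n}. 1 / nrm {..n} u * u i) = u" by (auto simp: Rsp_def PiE_iff extensional_def)
  then have "u \<in> fcone n A" using u assms(2) by (simp add: fcone_def)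
  then show ?thesis using homog_fcone[of n A] assms(3) by (auto simp: homog_def)
qed

lemma fconeE:
  assumes "x \<in> fcone n A"
  obtains t u where "0 < t" "u \<in> A" "x = (\<lambda>i\<in>{..n}. t * u i)" "t = nrm {..n} x"
    "u = (\<lambda>i\<in>{..n}. 1 / nrm {..n} x * x i)"
proof (rule that[OF _ _ _ refl refl])
  show n: "0 < nrm {..n} x" "(\<lambda>i\<in>{..n}. 1 / nrm {..n} x * x i) \<in> A" using assms by (auto simp: fcone_def)
  show "x = (\<lambda>i\<in>{..n}. nrm {..n} x * (\<lambda>i\<in>{..n}. 1 / nrm {..n} x * x i) i)"
  proof
    fix i show "x i = (\<lambda>i\<in>{..n}. nrm {..n} x * (\<lambda>i\<in>{..n}. 1 / nrm {..n} x * x i) i) i"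
      using assms n by (cases "i \<le> n") (auto simp: fcone_def Rsp_def PiE_iff extensional_def)
  qed
qed

lemma scone_eq:
  assumes "A \<subseteq> sph n"
  shows "scone n A = fcone n A \<inter> {x. nrm {..n} x \<le> 1}"
proof (intro equalityI subsetI)
  fix x assume "x \<in> scone n A"
  then obtain u t where u: "u \<in> A" "0 < t" "t \<le> 1" "x = (\<lambda>i\<in>{..n}. t * u i)" by (auto simp: scone_def)
  then have "nrm {..n} x = t * nrm {..n} u" using nrm_scale[of t u "{..n}"] by simp
  then show "x \<in> fcone n A \<inter> {x. nrm {..n} x \<le> 1}"
    using u assms fcone_scale[OF assms u(1,2)] by (simp add: sph_iff subset_iff)
next
  fix x assume x: "x \<in> fcone n A \<inter> {x. nrm {..n} x \<le> 1}"
  then obtain t u where u: "0 < t" "u \<in> A" "x = (\<lambda>i\<in>{..n}. t * u i)" and t: "t = nrm {..n} x"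
    using fconeE[of x n A] by blast
  have "t \<le> 1" using x unfolding t by simp
  then show "x \<in> scone n A" using u unfolding scone_def by blast
qed

text \<open>A positive inner product with \<open>c\<close> keeps nontrivial combinations away from
  0, so they can be normalized, and the normalized point lies on the geodesic segment between the
  two directions.\<close>

lemma fcone_combine:
  assumes X: "X \<subseteq> sph n" "gconvex n X" and c: "\<And>x. x \<in> X \<Longrightarrow> 0 < ip n c x"
  shows "convcone {..n} (fcone n X)"
  unfolding convcone_def
proof (intro conjI ballI allI impI)
  show "fcone n X \<subseteq> {..n} \<rightarrow>\<^sub>E UNIV" by (auto simp: fcone_def Rsp_def)
  fix x y :: "nat \<Rightarrow> real" and a b :: real
  assume xy: "x \<in> fcone n X" "y \<in> fcone n X" and ab: "0 \<le> a" "0 \<le> b" "0 < a + b"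
  obtain s u where u: "0 < s" "u \<in> X" "x = (\<lambda>i\<in>{..n}. s * u i)" using fconeE[OF xy(1)] by blast
  obtain t w where w: "0 < t" "w \<in> X" "y = (\<lambda>i\<in>{..n}. t * w i)" using fconeE[OF xy(2)] by blast
  let ?z = "\<lambda>i\<in>{..n}. a * x i + b * y i"
  have z: "?z = (\<lambda>i\<in>{..n}. (a * s) * u i + (b * t) * w i)" using u w by auto
  have "ip n ?z c = (a * s) * ip n u c + (b * t) * ip n w c" unfolding z by (rule ip_combine)
  moreover have "0 < ip n u c" "0 < ip n w c" using c u w by (auto simp: ip_commute[of n _ c])
  ultimately have "0 < ip n ?z c"
    using ab u w by (cases "a = 0") (auto intro!: add_pos_nonneg)
  then have "nrm {..n} ?z \<noteq> 0" using ip_le_nrm[of n ?z c] by auto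
  then have n: "0 < nrm {..n} ?z" by (simp add: less_le)
  define v where "v = (\<lambda>i\<in>{..n}. 1 / nrm {..n} ?z * ?z i)"
  have "nrm {..n} v = 1 / nrm {..n} ?z * nrm {..n} ?z" unfolding v_def by (rule nrm_scale) simp
  then have "nrm {..n} v = 1" using n by simp
  then have "v \<in> sph n" by (simp add: sph_iff v_def Rsp_def)
  moreover have "v = (\<lambda>i\<in>{..n}. (1 / nrm {..n} ?z * (a * s)) * u i + (1 / nrm {..n} ?z * (b * t)) * w i)"
  proof -
    have "k * (a * s * p + b * t * q) = k * (a * s) * p + k * (b * t) * q" for k p q by (simp add: algebra_simps)
    then show ?thesis unfolding v_def z by (intro restrict_ext) simp
  qed
  moreover have "0 \<le> 1 / nrm {..n} ?z * (a * s)" "0 \<le> 1 / nrm {..n} ?z * (b * t)" using n ab u w by auto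
  ultimately have "v \<in> gseg n u w" unfolding gseg_def by blast
  then have "v \<in> X" using X(2) u w by (auto simp: gconvex_def)
  then show "?z \<in> fcone n X" using n by (simp add: fcone_def Rsp_def v_def)
qed

text \<open>The inequality \<open>ip n u y > C * nrm {..n} y\<close> describes an open circular cone
  around \<open>u\<close>, and \<open>C < 1\<close> puts the axis inside. The cone over an open set
  is the union of the circular cones that it contains. The second claim records such a cone around a
  given point.\<close>

lemma sets_fcone_open:
  assumes "sopen n X"
  shows "fcone n X \<in> sets (Leb {..n})"
    and "x \<in> fcone n X \<Longrightarrow> \<exists>u\<in>X. \<exists>C<1. ip n u x > C * nrm {..n} x \<and>
      (\<forall>y\<in>Rsp n. ip n u y > C * nrm {..n} y \<longrightarrow> y \<in> fcone n X)"
proof -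
  have X: "X \<subseteq> sph n" using assms by (simp add: sopen_def)
  define V where "V = (\<lambda>u C. {y. ip n u y > C * nrm {..n} y})"
  have op: "open (V u C)" for u C
    unfolding V_def ip_def L2_set_def
    by (intro open_Collect_less continuous_intros continuous_on_product_coordinates)
  have good: "\<exists>C<1. \<forall>y\<in>Rsp n. y \<in> V u C \<longrightarrow> y \<in> fcone n X" if u: "u \<in> X" for u
  proof -
    obtain e where e: "e > 0" "sball n u e \<subseteq> X" using assms u by (auto simp: sopen_def)
    \<comment> \<open>Beyond \<open>pi\<close> the cosine no longer decreases, so a radius in
      \<open>{0..pi}\<close> is used.\<close>
    let ?e = "min e pi"
    have "y \<in> fcone n X" if y: "y \<in> Rsp n" "y \<in> V u (cos ?e)" for y
    proof -
      have "nrm {..n} y \<noteq> 0"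
      proof
        assume n: "nrm {..n} y = 0"
        then have "ip n u y = 0" using ip_le_nrm[of n u y] by simp
        then show False using y n by (simp add: V_def)
      qed
      then have n: "0 < nrm {..n} y" by (simp add: less_le)
      let ?v = "\<lambda>i\<in>{..n}. 1 / nrm {..n} y * y i"
      have "nrm {..n} ?v = 1 / nrm {..n} y * nrm {..n} y" by (rule nrm_scale) simp
      then have v: "?v \<in> sph n" using n by (simp add: sph_iff Rsp_def)
      have "ip n u ?v = ip n u y / nrm {..n} y"
        using ip_scale[of n "1 / nrm {..n} y" y u] by (simp add: ip_commute[of n u])
      moreover have "cos ?e < ip n u y / nrm {..n} y" using y n by (simp add: V_def pos_less_divide_eq)
      ultimately have "cos ?e < ip n u ?v" by simp
      then have "?v \<in> sball n u ?e" using sball_iff[of u n ?e ?v] v u X e by auto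
      then have "?v \<in> X" using e by (auto simp: sball_def)
      then show ?thesis using y n by (simp add: fcone_def)
    qed
    moreover have "cos ?e < 1"
      using e cos_monotone_0_pi[of 0 ?e] by auto
    ultimately show ?thesis by blast
  qed
  have self: "x \<in> V u C" if u: "0 < t" "u \<in> X" "x = (\<lambda>i\<in>{..n}. t * u i)" "C < 1" for x t u C
  proof -
    have "ip n u u = 1" using u X by (auto simp: sph_def)
    then have "ip n u x = t" unfolding u(3) by (subst ip_commute) (simp add: ip_scale)
    moreover have "nrm {..n} x = t" unfolding u(3) using nrm_scale[of t u "{..n}"] u(1,2) X by (auto simp: sph_iff)
    ultimately show ?thesis using u(1,4) by (simp add: V_def)
  qed
  have "fcone n X = {x \<in> space (Leb {..n}). x \<in> \<Union>{V u C |u C. C < 1 \<and> u \<in> X \<and> (\<forall>y\<in>Rsp n. y \<in> V u C \<longrightarrow> y \<in> fcone n X)}}"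
    (is "_ = {x \<in> _. x \<in> \<Union>?F}")
  proof (intro equalityI subsetI CollectI conjI)
    fix x assume x: "x \<in> fcone n X"
    then show "x \<in> space (Leb {..n})" by (simp add: fcone_def Rsp_eq)
    obtain t u where u: "0 < t" "u \<in> X" "x = (\<lambda>i\<in>{..n}. t * u i)" using fconeE[OF x] by blast
    obtain C where C: "C < 1" "\<forall>y\<in>Rsp n. y \<in> V u C \<longrightarrow> y \<in> fcone n X" using good[OF u(2)] by blast
    then show "x \<in> \<Union>?F" using self[OF u C(1)] u by blast
  next
    fix x assume "x \<in> {x \<in> space (Leb {..n}). x \<in> \<Union>?F}"
    then show "x \<in> fcone n X" unfolding Rsp_eq by blast
  qed
  moreover have "open (\<Union>?F)" by (rule open_Union) (use op in blast)
  ultimately show "fcone n X \<in> sets (Leb {..n})" using sets_Leb_open[of "\<Union>?F" "{..n}"] by (simp only:)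
  assume x: "x \<in> fcone n X"
  obtain t u where u: "0 < t" "u \<in> X" "x = (\<lambda>i\<in>{..n}. t * u i)" using fconeE[OF x] by blast
  obtain C where C: "C < 1" "\<forall>y\<in>Rsp n. y \<in> V u C \<longrightarrow> y \<in> fcone n X" using good[OF u(2)] by blast
  then show "\<exists>u\<in>X. \<exists>C<1. ip n u x > C * nrm {..n} x \<and>
      (\<forall>y\<in>Rsp n. ip n u y > C * nrm {..n} y \<longrightarrow> y \<in> fcone n X)"
    using self[OF u C(1)] u unfolding V_def by blast
qed

section \<open>The completed measure and spherical volume\<close>

lemma measure_completion_sandwich:
  assumes "L \<in> sets M" "U \<in> sets M" "L \<subseteq> S" "S \<subseteq> U" "emeasure M L = emeasure M U" "emeasure M U < \<infinity>"
  shows "measure (completion M) S = measure M L"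
proof -
  have "emeasure M (U - L) = emeasure M U - emeasure M L"
    using assms by (intro emeasure_Diff) (auto simp: less_top)
  also have "\<dots> = 0" using assms by simp
  finally have N: "U - L \<in> null_sets M" using assms by (auto simp: null_sets_def)
  have S: "S \<in> sets (completion M)"
    by (rule sets_completionI[of S L "S - L" "U - L"]) (use assms N in auto)
  have "emeasure (completion M) L \<le> emeasure (completion M) S" using S assms by (intro emeasure_mono) auto
  moreover have "emeasure (completion M) S \<le> emeasure (completion M) U" using S assms by (intro emeasure_mono) auto
  ultimately have "emeasure (completion M) S = emeasure M L" using assms by (simp add: emeasure_completion)
  then show ?thesis by (simp add: measure_def)
qed

lemma svol_eq:
  assumes "A \<subseteq> sph n" "fcone n A \<in> sets (Leb {..n})"
  shows "svol n A = real (n + 1) * measure (Leb {..n}) (fcone n A \<inter> {x \<in> space (Leb {..n}). nrm {..n} x \<le> 1})"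
proof -
  have "scone n A = fcone n A \<inter> {x \<in> space (Leb {..n}). nrm {..n} x \<le> 1}"
    unfolding scone_eq[OF assms(1)] by (auto simp: fcone_def Rsp_eq)
  then show ?thesis using assms(2) unfolding svol_def lebR_def by simp
qed

subsection \<open>Rotating an orthonormal basis into the standard one\<close>

locale rotation =
  fixes n :: nat and e :: "nat \<Rightarrow> nat \<Rightarrow> real"
  assumes onb: "ONF n (n + 1) e"
begin

definition rot :: "(nat \<Rightarrow> real) \<Rightarrow> nat \<Rightarrow> real" where
  "rot y = (\<lambda>i\<in>{..n}. \<Sum>j\<le>n. y j * e j i)"

definition coord :: "(nat \<Rightarrow> real) \<Rightarrow> nat \<Rightarrow> real" where
  "coord x = (\<lambda>j\<in>{..n}. ip n x (e j))"

abbreviation "M \<equiv> Leb {..n}"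
abbreviation "UB \<equiv> {x \<in> space M. nrm {..n} x \<le> 1}"

lemma rows: "j \<le> n \<Longrightarrow> k \<le> n \<Longrightarrow> ip n (e j) (e k) = (if j = k then 1 else 0)"
  using onb by (auto simp: ONF_def)

lemma rot_Rsp [simp]: "rot y \<in> Rsp n" "coord y \<in> Rsp n"
  by (simp_all add: rot_def coord_def Rsp_def)

lemma ip_rot_e:
  assumes "j \<le> n" shows "ip n (rot y) (e j) = y j"
proof -
  have "ip n (rot y) (e j) = (\<Sum>k\<le>n. y k * ip n (e k) (e j))" by (simp add: rot_def ip_sum)
  also have "\<dots> = (\<Sum>k\<le>n. if k = j then y k else 0)" using rows assms by (intro sum.cong) auto
  finally show ?thesis using assms by simp
qed

lemma coord_rot: "y \<in> Rsp n \<Longrightarrow> coord (rot y) = y"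
  by (auto simp: coord_def ip_rot_e Rsp_def PiE_iff extensional_def)

lemma rot_coord:
  assumes "x \<in> Rsp n" shows "rot (coord x) = x"
proof
  fix i
  show "rot (coord x) i = x i"
  proof (cases "i \<le> n")
    case True
    have "rot (coord x) i = (\<Sum>j\<le>n. \<Sum>k\<le>n. x k * (e j k * e j i))"
      using True by (simp add: rot_def coord_def ip_def sum_distrib_right mult.assoc)
    also have "\<dots> = (\<Sum>k\<le>n. x k * (\<Sum>j\<le>n. e j k * e j i))"
      by (subst sum.swap) (simp add: sum_distrib_left)
    also have "\<dots> = (\<Sum>k\<le>n. if k = i then x k else 0)"
      using True ONF_complete[OF onb] by (intro sum.cong) auto
    finally show ?thesis using True by simp
  qed (use assms in \<open>auto simp: rot_def Rsp_def PiE_iff extensional_def\<close>)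
qed

lemma ip_rot: "ip n (rot y) (rot w) = ip n y w"
proof -
  have "ip n (rot y) (rot w) = (\<Sum>j\<le>n. y j * ip n (e j) (rot w))" by (simp add: rot_def[of y] ip_sum)
  also have "\<dots> = (\<Sum>j\<le>n. y j * w j)" by (intro sum.cong refl) (simp add: ip_commute[of n _ "rot w"] ip_rot_e)
  finally show ?thesis by (simp add: ip_def)
qed

lemma nrm_rot [simp]: "nrm {..n} (rot y) = nrm {..n} y"
  by (simp add: nrm_ip ip_rot)

lemma rot_combine: "rot (\<lambda>i\<in>{..n}. a * x i + b * y i) = (\<lambda>i\<in>{..n}. a * rot x i + b * rot y i)"
  by (auto simp: rot_def ring_distribs sum.distrib sum_distrib_left mult.assoc)

lemma rot_scale: "rot (\<lambda>i\<in>{..n}. a * x i) = (\<lambda>i\<in>{..n}. a * rot x i)"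
  using rot_combine[of a x 0 x] by simp

lemma distr_coord: "distr M M coord = M"
proof -
  have "distr M M (\<lambda>x. \<lambda>j\<in>{..n}. \<Sum>i\<le>n. x i * e j i) = M"
    using ONF_complete[OF onb] rows by (intro distr_orthogonal_Leb) (auto simp: ip_def)
  then show ?thesis by (simp add: coord_def[abs_def] ip_def)
qed

lemma measurable_rot [measurable]: "rot \<in> measurable M M" "coord \<in> measurable M M"
  unfolding rot_def[abs_def] coord_def[abs_def] ip_def by measurable

text \<open>The cone over \<open>A\<close> in the coordinates of the basis \<open>e\<close>: the
  centre \<open>e 0\<close> becomes the axis of coordinate 0, and an adapted subspace becomes a
  coordinate subspace.\<close>

definition pcone :: "(nat \<Rightarrow> real) set \<Rightarrow> (nat \<Rightarrow> real) set" where
  "pcone A = {y \<in> space M. rot y \<in> fcone n A}"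

lemma pcone_Int: "pcone (A \<inter> A') = pcone A \<inter> pcone A'"
  by (auto simp: pcone_def fcone_Int)

text \<open>\<open>coord\<close> preserves Lebesgue measure, so Borel bounds found in coordinates
  pull back to Borel bounds for the truncated cone, and the completion assigns it their common
  value.\<close>

lemma svol_sandwich:
  assumes A: "A \<subseteq> sph n" and LU: "L \<in> sets M" "U \<in> sets M"
    and sub: "L \<subseteq> pcone A \<inter> UB" "pcone A \<inter> UB \<subseteq> U" and eq: "emeasure M L = emeasure M U" "emeasure M U < \<infinity>"
  shows "svol n A = real (n + 1) * measure M L"
proof -
  define pull where "pull = (\<lambda>S. {x \<in> space M. coord x \<in> S})"
  have pull: "pull S \<in> sets M" "emeasure M (pull S) = emeasure M S" if "S \<in> sets M" for S
  proof -
    have "pull S = coord -` S \<inter> space M" by (auto simp: pull_def)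
    then show "pull S \<in> sets M" using that by simp
    have "emeasure M S = emeasure (distr M M coord) S" by (simp add: distr_coord)
    also have "\<dots> = emeasure M (pull S)"
      using that \<open>pull S = _\<close> by (simp add: emeasure_distr)
    finally show "emeasure M (pull S) = emeasure M S" ..
  qed
  have sc: "x \<in> scone n A \<longleftrightarrow> x \<in> space M \<and> coord x \<in> pcone A \<inter> UB" for x
  proof -
    have "nrm {..n} (coord x) = nrm {..n} x" if "x \<in> Rsp n"
      using nrm_rot[of "coord x"] rot_coord[OF that] by simp
    then show ?thesis
      unfolding scone_eq[OF A] pcone_def using rot_coord[of x] rot_Rsp(2)[of x]
      by (auto simp: Rsp_eq fcone_def)
  qed
  have "measure (completion M) (scone n A) = measure M (pull L)"
  proof (rule measure_completion_sandwich)
    show "pull L \<subseteq> scone n A" "scone n A \<subseteq> pull U" using sub sc by (auto simp: pull_def)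
  qed (use pull LU eq in auto)
  then show ?thesis using pull(2)[OF LU(1)] by (simp add: svol_def lebR_def measure_def)
qed

lemma emeasure_UB: "emeasure M UB < \<infinity>"
  by (rule emeasure_ball_finite) simp

lemma svol_pcone:
  assumes "A \<subseteq> sph n" "pcone A \<in> sets M"
  shows "svol n A = real (n + 1) * measure M (pcone A \<inter> UB)"
proof (rule svol_sandwich[OF assms(1)])
  have "emeasure M (pcone A \<inter> UB) \<le> emeasure M UB" by (intro emeasure_mono) auto
  then show "emeasure M (pcone A \<inter> UB) < \<infinity>" using emeasure_UB by (rule le_less_trans)
qed (use assms in auto)

text \<open>Both sets are homogeneous and avoid the origin, so it suffices to compare them on the
  unit sphere.\<close>

lemma pcone_homog:
  assumes D: "homog {..n} D" "\<And>y. y \<in> D \<Longrightarrow> nrm {..n} y \<noteq> 0"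
    and A: "\<And>x. x \<in> sph n \<Longrightarrow> x \<in> A \<longleftrightarrow> coord x \<in> D" and sub: "A \<subseteq> sph n"
  shows "pcone A = D"
proof -
  have "rot y \<in> fcone n A \<longleftrightarrow> y \<in> D" if y: "y \<in> space M" "nrm {..n} y > 0" for y
  proof -
    let ?k = "1 / nrm {..n} y"
    have s: "(\<lambda>i\<in>{..n}. ?k * y i) \<in> Rsp n" by (simp add: Rsp_def)
    have "nrm {..n} (\<lambda>i\<in>{..n}. ?k * y i) = ?k * nrm {..n} y" by (rule nrm_scale) simp
    then have "rot (\<lambda>i\<in>{..n}. ?k * y i) \<in> sph n" using y by (simp add: sph_iff)
    have "rot y \<in> fcone n A \<longleftrightarrow> (\<lambda>i\<in>{..n}. ?k * rot y i) \<in> A" using y by (simp add: fcone_def)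
    also have "\<dots> \<longleftrightarrow> rot (\<lambda>i\<in>{..n}. ?k * y i) \<in> A" by (simp only: rot_scale)
    also have "\<dots> \<longleftrightarrow> coord (rot (\<lambda>i\<in>{..n}. ?k * y i)) \<in> D" by (rule A) fact
    also have "\<dots> \<longleftrightarrow> (\<lambda>i\<in>{..n}. ?k * y i) \<in> D" by (simp only: coord_rot[OF s])
    also have "\<dots> \<longleftrightarrow> y \<in> D" using y by (intro homog_scale_iff[OF D(1)]) (auto simp: space_Leb)
    finally show ?thesis .
  qed
  moreover have "D \<subseteq> space M" using D(1) by (simp add: homog_def space_Leb)
  moreover have "nrm {..n} y > 0" if "y \<in> D" for y using D(2)[OF that] by (simp add: less_le)
  moreover have "nrm {..n} y > 0" if "rot y \<in> fcone n A" for y using that by (simp add: fcone_def)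
  ultimately show ?thesis unfolding pcone_def by blast
qed

lemma ip_e0: "x \<in> Rsp n \<Longrightarrow> ip n (e 0) x = coord x 0"
  by (simp add: coord_def ip_commute)

lemma e0_sph: "e 0 \<in> Rsp n \<Longrightarrow> e 0 \<in> sph n"
  using rows[of 0 0] by (simp add: sph_def)

definition Hemi :: "(nat \<Rightarrow> real) set" where "Hemi = {y \<in> space M. 0 < y 0}"

lemma Hemi_nrm: "y \<in> Hemi \<Longrightarrow> nrm {..n} y \<noteq> 0"
  using abs_le_nrm[of "{..n}" 0 y] by (auto simp: Hemi_def)

lemma homog_Hemi: "homog {..n} Hemi"
  by (auto simp: Hemi_def homog_def space_Leb)

lemma pcone_hemi: "e 0 \<in> Rsp n \<Longrightarrow> pcone (sball n (e 0) (pi/2)) = Hemi"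
  using hemi_iff[OF e0_sph] ip_e0
  by (intro pcone_homog homog_Hemi Hemi_nrm) (auto simp: Hemi_def Rsp_eq[symmetric] sph_iff)

lemma sets_Hemi [measurable]: "Hemi \<in> sets M"
  unfolding Hemi_def by measurable

text \<open>In coordinates the geodesic reflection at \<open>e 0\<close> keeps coordinate 0 and
  negates the rest. It is applied to the direction of a point and then carried to the cone by
  homogeneity.\<close>

lemma pcone_good:
  assumes X: "good_set n (e 0) X" and e0: "e 0 \<in> Rsp n"
  shows "pcone X \<in> sets M" "convcone {..n} (pcone X)" "pcone X \<subseteq> Hemi"
    "y \<in> pcone X \<Longrightarrow> flip ({..n} - {0}) y \<in> pcone X"
proof -
  have so: "sopen n X" "gconvex n X" "X \<subseteq> sph n" and hs: "X \<subseteq> sball n (e 0) (pi/2)"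
    and sy: "\<And>x. x \<in> X \<Longrightarrow> srefl n (e 0) x \<in> X"
    using X by (auto simp: good_set_def sopen_def csym_def)
  have "pcone X = rot -` fcone n X \<inter> space M" by (auto simp: pcone_def)
  then show "pcone X \<in> sets M" using sets_fcone_open(1)[OF so(1)] by simp
  have cc: "convcone {..n} (fcone n X)"
    using hs hemi_iff[OF e0_sph[OF e0]] by (intro fcone_combine[OF so(3,2)]) blast
  show "convcone {..n} (pcone X)"
    unfolding convcone_def pcone_def rot_combine
    using convconeD[OF cc] by (auto simp: space_Leb rot_combine)
  show "pcone X \<subseteq> Hemi"
    unfolding pcone_hemi[OF e0, symmetric] using hs by (auto simp: pcone_def fcone_def)
  assume y: "y \<in> pcone X"
  then have ys: "y \<in> Rsp n" and ry: "rot y \<in> fcone n X" by (auto simp: pcone_def Rsp_eq)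
  have fl: "flip ({..n} - {0}) y = (\<lambda>i\<in>{..n}. 2 * y 0 * (if i = 0 then 1 else 0) - y i)"
    using ys by (auto simp: flip_def Rsp_def PiE_iff extensional_def)
  have r: "rot (flip ({..n} - {0}) y) = (\<lambda>i\<in>{..n}. 2 * y 0 * e 0 i - rot y i)"
  proof -
    have "(\<Sum>j\<le>n. (2 * y 0 * (if j = 0 then 1 else 0) - y j) * e j i) = 2 * y 0 * e 0 i - (\<Sum>j\<le>n. y j * e j i)" for i
    proof -
      have "(\<Sum>j\<le>n. (2 * y 0 * (if j = 0 then 1 else 0) - y j) * e j i) =
        (\<Sum>j\<le>n. (if j = 0 then 2 * y 0 * e j i else 0)) - (\<Sum>j\<le>n. y j * e j i)"
        unfolding sum_subtractf[symmetric] by (intro sum.cong) (auto simp: algebra_simps)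
      then show ?thesis by simp
    qed
    moreover have "rot (flip ({..n} - {0}) y) = (\<lambda>i\<in>{..n}. \<Sum>j\<le>n. (2 * y 0 * (if j = 0 then 1 else 0) - y j) * e j i)"
      unfolding fl rot_def by (intro restrict_ext sum.cong) auto
    ultimately show ?thesis by (simp add: rot_def cong: restrict_cong)
  qed
  obtain t u where u: "0 < t" "u \<in> X" "rot y = (\<lambda>i\<in>{..n}. t * u i)" using fconeE[OF ry] by blast
  have "y 0 = ip n (rot y) (e 0)" by (simp add: ip_rot_e)
  also have "\<dots> = t * ip n u (e 0)" unfolding u(3) by (simp add: ip_scale)
  finally have "rot (flip ({..n} - {0}) y) = (\<lambda>i\<in>{..n}. t * srefl n (e 0) u i)"
    unfolding r u(3) by (auto simp: srefl_def algebra_simps)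
  moreover have "(\<lambda>i\<in>{..n}. t * srefl n (e 0) u i) \<in> fcone n X" by (intro fcone_scale so sy u)
  moreover have "flip ({..n} - {0}) y \<in> space M" unfolding fl by (simp add: space_Leb)
  ultimately show "flip ({..n} - {0}) y \<in> pcone X" by (simp add: pcone_def)
qed

text \<open>The cone over \<open>X\<close> lies in \<open>Hemi\<close>, so intersecting with
  \<open>W\<close> just cuts it with the band \<open>Y\<close>. All volumes inside the unit ball are
  finite, which allows the passage from \<open>ennreal\<close> to the reals, and the factor
  \<open>n + 1\<close> occurs twice on each side.\<close>

lemma SCI_band:
  assumes m: "1 \<le> m" "m \<le> n + 1" and e0: "e 0 \<in> Rsp n"
    and b: "band {m..n} {..<m} 0 \<kappa> Y" and hY: "homog {..n} Y"
    and W: "W \<subseteq> sph n" "\<And>x. x \<in> sph n \<Longrightarrow> x \<in> W \<longleftrightarrow> coord x \<in> Hemi \<inter> Y"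
    and X: "good_set n (e 0) X"
  shows "SCI n (e 0) X W"
proof -
  interpret band "{m..n}" "{..<m}" 0 \<kappa> Y by (rule b)
  have I: "{m..n} \<union> {..<m} = {..n}" using m by auto
  note X' = pcone_good[OF X e0]
  have BB: "B = UB" unfolding B_def I ..
  have hHY: "homog {..n} (Hemi \<inter> Y)" using homog_Hemi hY by (auto simp: homog_def)
  have pW: "pcone W = Hemi \<inter> Y" by (rule pcone_homog[OF hHY _ W(2,1)]) (auto dest: Hemi_nrm)
  have Xs: "X \<subseteq> sph n" using X by (auto simp: good_set_def sopen_def)
  have Ym: "Y \<in> sets M" using Y(1) unfolding I .
  have pXW: "pcone (X \<inter> W) = pcone X \<inter> Y" unfolding pcone_Int pW using X'(3) by auto
  let ?m = "emeasure M"
  have le: "?m (pcone X \<inter> UB) * ?m (Hemi \<inter> Y \<inter> UB) \<le> ?m (pcone X \<inter> Y \<inter> UB) * ?m (Hemi \<inter> UB)"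
    using band_correlation[of "pcone X"] X' unfolding I BB Hemi_def by auto
  have em: "?m (A \<inter> UB) = ennreal (measure M (A \<inter> UB))" if "A \<in> sets M" for A
  proof -
    have "?m (A \<inter> UB) \<le> ?m UB" by (intro emeasure_mono) auto
    then show ?thesis using emeasure_UB by (intro emeasure_eq_ennreal_measure) auto
  qed
  have "measure M (pcone X \<inter> UB) * measure M (Hemi \<inter> Y \<inter> UB) \<le> measure M (pcone X \<inter> Y \<inter> UB) * measure M (Hemi \<inter> UB)"
    using le em[OF X'(1)] em[of "Hemi \<inter> Y"] em[of "pcone X \<inter> Y"] em[of Hemi] X'(1) Ym
    by (simp add: ennreal_mult[symmetric])
  moreover have "svol n X = real (n + 1) * measure M (pcone X \<inter> UB)"
    by (rule svol_pcone[OF Xs X'(1)])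
  moreover have "svol n W = real (n + 1) * measure M (Hemi \<inter> Y \<inter> UB)"
    unfolding pW[symmetric] using Ym by (intro svol_pcone W) (simp add: pW)
  moreover have "svol n (X \<inter> W) = real (n + 1) * measure M (pcone X \<inter> Y \<inter> UB)"
    unfolding pXW[symmetric] using Ym Xs X'(1) by (intro svol_pcone) (auto simp: pXW)
  moreover have "svol n (sball n (e 0) (pi/2)) = real (n + 1) * measure M (Hemi \<inter> UB)"
    unfolding pcone_hemi[OF e0, symmetric]
    by (rule svol_pcone) (simp_all only: pcone_hemi[OF e0] sets_Hemi, auto simp: sball_def)
  ultimately show ?thesis by (simp add: SCI_def mult.assoc mult.left_commute mult_left_mono)
qed

text \<open>For \<open>y\<close> in \<open>E\<close> the inner product with \<open>x\<close> sees
  only the projection of \<open>x\<close> to \<open>E\<close>. Its maximum over unit vectors is the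
  norm of that projection, so the distance is the arccosine of this norm and at most
  \<open>pi/2\<close>; larger \<open>eps\<close> give the whole sphere.\<close>

lemma sthick_iff:
  assumes m: "1 \<le> m" "m \<le> n + 1" and e0: "e 0 \<in> Rsp n"
    and E: "E = {x \<in> Rsp n. \<forall>j\<in>{m..n}. ip n x (e j) = 0}"
    and x: "x \<in> sph n" and eps: "0 \<le> eps"
  shows "x \<in> sthick n (sph n \<inter> E) eps \<longleftrightarrow> pi/2 \<le> eps \<or> cos eps \<le> nrm {..<m} (coord x)"
proof -
  let ?p = "nrm {..<m} (coord x)"
  have split: "ip n x y = (\<Sum>j<m. coord x j * coord y j)" if y: "y \<in> Rsp n" "y \<in> E" for y
  proof -
    have "ip n x y = ip n (rot (coord x)) (rot (coord y))" using x y rot_coord by (simp add: sph_iff)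
    also have "\<dots> = (\<Sum>j\<le>n. coord x j * coord y j)" by (simp only: ip_rot) (simp add: ip_def)
    also have "\<dots> = (\<Sum>j<m. coord x j * coord y j)"
      using y m by (intro sum.mono_neutral_right) (auto simp: E coord_def not_less)
    finally show ?thesis .
  qed
  have nm: "nrm {..<m} (coord y) = 1" if y: "y \<in> sph n" "y \<in> E" for y
  proof -
    have "1 = nrm {..n} (rot (coord y))" using y rot_coord by (simp add: sph_iff)
    also have "\<dots> = nrm {..<m} (coord y)" unfolding nrm_rot unfolding L2_set_def
      using y m by (intro arg_cong[where f=sqrt] sum.mono_neutral_right) (auto simp: E coord_def not_less)
    finally show ?thesis by simp
  qed
  have p1: "?p \<le> 1"
  proof -
    have "?p \<le> nrm {..n} (coord x)" using m unfolding L2_set_def by (intro real_sqrt_le_mono sum_mono2) auto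
    also have "\<dots> = nrm {..n} (rot (coord x))" by simp
    also have "\<dots> = 1" using x rot_coord by (simp add: sph_iff)
    finally show ?thesis .
  qed
  have up: "ip n x y \<le> ?p" if y: "y \<in> sph n \<inter> E" for y
  proof -
    have "ip n x y = (\<Sum>j<m. coord x j * coord y j)" using y split by (simp add: sph_iff)
    also have "\<dots> \<le> (\<Sum>j<m. \<bar>coord x j\<bar> * \<bar>coord y j\<bar>)" by (intro sum_mono) (metis abs_ge_self abs_mult)
    also have "\<dots> \<le> ?p * nrm {..<m} (coord y)" by (rule L2_set_mult_ineq)
    finally show ?thesis using nm y by simp
  qed
  \<comment> \<open>The maximum is attained at the normalized projection. If the projection is 0,
    every point of the subsphere is at distance \<open>pi/2\<close>, and \<open>e 0\<close> is
    taken.\<close>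
  have att: "\<exists>y\<in>sph n \<inter> E. ip n x y = ?p"
  proof (cases "?p = 0")
    case True
    have "e 0 \<in> E" using e0 m rows unfolding E by auto
    moreover have "ip n x (e 0) = coord x 0" by (simp add: coord_def)
    moreover have "coord x 0 = 0" using abs_le_nrm[of "{..<m}" 0 "coord x"] m True by auto
    ultimately show ?thesis using e0_sph[OF e0] True by auto
  next
    case False
    then have p: "?p > 0" by (simp add: less_le)
    let ?w = "\<lambda>i\<in>{..n}. if i < m then 1 / ?p * coord x i else 0"
    have w: "?w \<in> Rsp n" by (simp add: Rsp_def)
    have "nrm {..n} ?w = nrm {..<m} ?w" unfolding L2_set_def
      using m by (intro arg_cong[where f=sqrt] sum.mono_neutral_right) auto
    also have "\<dots> = nrm {..<m} (\<lambda>i\<in>{..<m}. 1 / ?p * coord x i)" using m by (intro L2_set_cong) auto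
    also have "\<dots> = 1 / ?p * ?p" by (rule nrm_scale) simp
    finally have "rot ?w \<in> sph n" using p by (simp add: sph_iff)
    moreover have rE: "rot ?w \<in> E" using ip_rot_e by (auto simp: E)
    moreover have "ip n x (rot ?w) = ?p"
    proof -
      have "ip n x (rot ?w) = (\<Sum>j<m. coord x j * ?w j)"
        using split[OF rot_Rsp(1) rE] coord_rot[OF w] by simp
      also have "\<dots> = (\<Sum>j<m. (coord x j)\<^sup>2) / ?p"
        using m unfolding sum_divide_distrib by (intro sum.cong) (auto simp: power2_eq_square)
      also have "\<dots> = ?p\<^sup>2 / ?p" by (simp add: L2_set_def sum_nonneg)
      finally show ?thesis using p by (simp add: power2_eq_square)
    qed
    ultimately show ?thesis by blast
  qed
  have p0: "0 \<le> ?p" by simp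
  have "(INF y\<in>sph n \<inter> E. sdist n x y) = arccos ?p"
  proof (rule cInf_eq_minimum)
    obtain y where "y \<in> sph n \<inter> E" "ip n x y = ?p" using att by blast
    then show "arccos ?p \<in> sdist n x ` (sph n \<inter> E)" unfolding sdist_def by (metis imageI)
    fix d assume "d \<in> sdist n x ` (sph n \<inter> E)"
    then obtain y where y: "y \<in> sph n \<inter> E" "d = arccos (ip n x y)" by (auto simp: sdist_def)
    then show "arccos ?p \<le> d"
      using up[OF y(1)] ip_sph_bounds[OF x, of y] p1 by (auto intro!: arccos_le_arccos)
  qed
  then have "x \<in> sthick n (sph n \<inter> E) eps \<longleftrightarrow> arccos ?p \<le> eps" using x by (simp add: sthick_def)
  also have "\<dots> \<longleftrightarrow> pi/2 \<le> eps \<or> cos eps \<le> ?p"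
  proof (cases "pi/2 \<le> eps")
    case True
    have "arccos ?p \<le> pi/2" using arccos_le_pi2[OF p0 p1] .
    then show ?thesis using True by simp
  next
    case False
    then show ?thesis using arccos_less_iff'(2)[of ?p eps] p0 p1 eps by auto
  qed
  finally show ?thesis .
qed

end

subsection \<open>Convex cones are Lebesgue measurable\<close>

text \<open>If \<open>p\<close> is in the closure of a convex cone that contains a neighbourhood of the unit vector \<open>u\<close>,
  then \<open>p + eps u\<close> is in its interior; hence closure and interior have the same volume in a ball.\<close>

lemma cone_sandwich:
  assumes P: "finite P" and K: "homog P K" and add: "\<And>x y. x \<in> K \<Longrightarrow> y \<in> K \<Longrightarrow> (\<lambda>i\<in>P. x i + y i) \<in> K"
    and u: "nrm P u = 1" and r: "0 < r" "\<And>p. p \<in> space (Leb P) \<Longrightarrow> nrm P (\<lambda>i. p i - u i) < r \<Longrightarrow> p \<in> K"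
  obtains L U where "L \<in> sets (Leb P)" "U \<in> sets (Leb P)" "homog P L" "homog P U" "L \<subseteq> K" "K \<subseteq> U"
    "vol P {p \<in> U. nrm P p \<le> 1} = vol P {p \<in> L. nrm P p \<le> 1}"
proof -
  define b where "b = (\<lambda>p \<delta>. {x. nrm P (\<lambda>i. x i - p i) < (\<delta>::real)})"
  have bo: "open (b p \<delta>)" for p \<delta>
    unfolding b_def L2_set_def by (intro open_Collect_less continuous_intros continuous_on_product_coordinates)
  have b_scale: "(\<lambda>i\<in>P. t * x i) \<in> b (\<lambda>i. t * p i) (t * \<delta>) \<longleftrightarrow> x \<in> b p \<delta>" if t: "t > 0" for t x p \<delta>
  proof -
    have "nrm P (\<lambda>i. (\<lambda>i\<in>P. t * x i) i - t * p i) = nrm P (\<lambda>i\<in>P. t * (x i - p i))"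
      by (intro L2_set_cong) (auto simp: algebra_simps)
    also have "\<dots> = t * nrm P (\<lambda>i. x i - p i)" using t by (intro nrm_scale) simp
    finally show ?thesis using t by (simp add: b_def)
  qed
  have KP: "K \<subseteq> space (Leb P)" using K by (simp add: homog_def space_Leb)
  \<comment> \<open>\<open>V\<close> yields the interior of \<open>K\<close>, the complement of
    \<open>W\<close> its closure. The sets \<open>b p \<delta>\<close> restrict only the coordinates
    in \<open>P\<close>, hence the intersections with the space of extensional functions.\<close>
  define V where "V = \<Union>{b p \<delta> |p \<delta>. b p \<delta> \<inter> space (Leb P) \<subseteq> K}"
  define W where "W = \<Union>{b p \<delta> |p \<delta>. b p \<delta> \<inter> K = {}}"
  have VW: "open V" "open W" unfolding V_def W_def using bo by auto
  define L where "L = {x \<in> space (Leb P). x \<in> V}"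
  define U where "U = space (Leb P) - {x \<in> space (Leb P). x \<in> W}"
  have sets: "L \<in> sets (Leb P)" "U \<in> sets (Leb P)"
    unfolding L_def U_def using sets_Leb_open VW by auto
  have K_scale: "(\<lambda>i\<in>P. t * x i) \<in> K \<longleftrightarrow> x \<in> K" if "t > 0" "x \<in> space (Leb P)" for t x
    using homog_scale_iff[OF K that(1)] that(2) by (simp add: space_Leb)
  have sc_sp: "(\<lambda>i\<in>P. t * x i) \<in> space (Leb P)" for t and x :: "nat \<Rightarrow> real" by (simp add: space_Leb)
  have inv: "(\<lambda>i\<in>P. t * (\<lambda>i\<in>P. 1 / t * x i) i) = x" if "t > 0" "x \<in> space (Leb P)" for t x
    using that by (auto simp: space_Leb PiE_iff extensional_def)
  have unb: "x \<in> b (\<lambda>i. t * p i) (t * \<delta>) \<Longrightarrow> (\<lambda>i\<in>P. 1 / t * x i) \<in> b p \<delta>"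
    if "t > 0" "x \<in> space (Leb P)" for t x p \<delta>
    using b_scale[OF that(1), of "\<lambda>i\<in>P. 1 / t * x i" p \<delta>] unfolding inv[OF that] by simp
  have hL: "homog P L"
    unfolding homog_def
  proof (intro conjI ballI allI impI)
    show "L \<subseteq> P \<rightarrow>\<^sub>E UNIV" by (auto simp: L_def space_Leb)
    fix x t assume x: "x \<in> L" and t: "0 < (t::real)"
    then obtain p \<delta> where p: "x \<in> b p \<delta>" "b p \<delta> \<inter> space (Leb P) \<subseteq> K" by (auto simp: L_def V_def)
    have "b (\<lambda>i. t * p i) (t * \<delta>) \<inter> space (Leb P) \<subseteq> K"
    proof
      fix y assume y: "y \<in> b (\<lambda>i. t * p i) (t * \<delta>) \<inter> space (Leb P)"
      have "(\<lambda>i\<in>P. 1 / t * y i) \<in> K" using unb[OF t, of y p \<delta>] y p(2) sc_sp by blast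
      then have "(\<lambda>i\<in>P. t * (\<lambda>i\<in>P. 1 / t * y i) i) \<in> K" using K_scale[OF t sc_sp] by blast
      then show "y \<in> K" using inv[OF t] y by simp
    qed
    then have "(\<lambda>i\<in>P. t * x i) \<in> V" using b_scale[OF t, of x p \<delta>] p(1) unfolding V_def by blast
    then show "(\<lambda>i\<in>P. t * x i) \<in> L" using sc_sp by (simp add: L_def)
  qed
  have hU: "homog P U"
    unfolding homog_def
  proof (intro conjI ballI allI impI)
    show "U \<subseteq> P \<rightarrow>\<^sub>E UNIV" by (auto simp: U_def space_Leb)
    fix x t assume x: "x \<in> U" and t: "0 < (t::real)"
    have xs: "x \<in> space (Leb P)" "x \<notin> W" using x by (auto simp: U_def)
    have "(\<lambda>i\<in>P. t * x i) \<notin> W"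
    proof
      assume "(\<lambda>i\<in>P. t * x i) \<in> W"
      then obtain p \<delta> where p: "(\<lambda>i\<in>P. t * x i) \<in> b p \<delta>" "b p \<delta> \<inter> K = {}" by (auto simp: W_def)
      have t': "1 / t > 0" using t by simp
      have "(\<lambda>i\<in>P. 1 / t * (\<lambda>i\<in>P. t * x i) i) \<in> b (\<lambda>i. 1 / t * p i) (1 / t * \<delta>)"
        using b_scale[OF t'] p(1) by blast
      moreover have "(\<lambda>i\<in>P. 1 / t * (\<lambda>i\<in>P. t * x i) i) = x"
        using t xs by (auto simp: space_Leb PiE_iff extensional_def)
      moreover have "b (\<lambda>i. 1 / t * p i) (1 / t * \<delta>) \<inter> K = {}"
      proof (rule ccontr)
        assume "b (\<lambda>i. 1 / t * p i) (1 / t * \<delta>) \<inter> K \<noteq> {}"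
        then obtain y where y: "y \<in> b (\<lambda>i. 1 / t * p i) (1 / t * \<delta>)" "y \<in> K" by auto
        have "(\<lambda>i\<in>P. 1 / (1 / t) * y i) \<in> b p \<delta>" using unb[OF t', of y p \<delta>] y KP by auto
        moreover have "(\<lambda>i\<in>P. 1 / (1 / t) * y i) \<in> K" using K_scale[OF t, of y] y KP by auto
        ultimately show False using p(2) by blast
      qed
      ultimately have "x \<in> W" unfolding W_def by auto
      then show False using xs by simp
    qed
    then show "(\<lambda>i\<in>P. t * x i) \<in> U" using sc_sp by (simp add: U_def)
  qed
  have LK: "L \<subseteq> K" by (auto simp: L_def V_def)
  have KU: "K \<subseteq> U" using KP by (auto simp: U_def W_def)
  have shift: "affm P 1 (\<lambda>i. eps * u i) p \<in> L" if p: "p \<in> U" and eps: "0 < eps" for p eps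
  proof -
    let ?q = "affm P 1 (\<lambda>i. eps * u i) p" and ?\<delta> = "eps * r / 2"
    have \<delta>: "0 < ?\<delta>" using eps r by simp
    have ps: "p \<in> space (Leb P)" "p \<notin> W" using p by (auto simp: U_def)
    have "p \<in> b p ?\<delta>" using \<delta> by (simp add: b_def L2_set_def)
    then obtain x where x: "x \<in> b p ?\<delta>" "x \<in> K" using ps(2) unfolding W_def by blast
    have "b ?q ?\<delta> \<inter> space (Leb P) \<subseteq> K"
    proof
      fix w assume w: "w \<in> b ?q ?\<delta> \<inter> space (Leb P)"
      \<comment> \<open>Chosen so that \<open>w = x + eps * v\<close>. The differences
        \<open>w - q\<close> and \<open>p - x\<close> each have norm below
        \<open>eps * r / 2\<close>, which places \<open>v\<close> within \<open>r\<close> of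
        \<open>u\<close>, hence in \<open>K\<close>.\<close>
      let ?v = "\<lambda>i\<in>P. 1 / eps * (w i - x i)"
      have "nrm P (\<lambda>i. (w i - ?q i) + (p i - x i)) \<le> nrm P (\<lambda>i. w i - ?q i) + nrm P (\<lambda>i. p i - x i)"
        by (rule L2_set_triangle_ineq)
      also have "nrm P (\<lambda>i. p i - x i) = nrm P (\<lambda>i. x i - p i)"
        unfolding L2_set_def by (subst power2_commute) simp
      also have "nrm P (\<lambda>i. w i - ?q i) + nrm P (\<lambda>i. x i - p i) < ?\<delta> + ?\<delta>"
        using w x by (intro add_strict_mono) (auto simp: b_def)
      finally have *: "nrm P (\<lambda>i. (w i - ?q i) + (p i - x i)) < eps * r" by simp
      have "nrm P (\<lambda>i. ?v i - u i) = nrm P (\<lambda>i\<in>P. 1 / eps * ((w i - ?q i) + (p i - x i)))"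
      proof (rule L2_set_cong[OF refl])
        fix i assume "i \<in> P"
        moreover have "1 / eps * (a - b) - c = 1 / eps * (a - (eps * c + d) + (d - b))" for a b c d
          using eps by (simp add: field_simps)
        ultimately show "?v i - u i = (\<lambda>i\<in>P. 1 / eps * ((w i - ?q i) + (p i - x i))) i" by (simp add: affm_def)
      qed
      also have "\<dots> = 1 / eps * nrm P (\<lambda>i. (w i - ?q i) + (p i - x i))" using eps by (intro nrm_scale) simp
      also have "\<dots> < 1 / eps * (eps * r)" by (rule mult_strict_left_mono[OF *]) (use eps in simp)
      also have "\<dots> = r" using eps by simp
      finally have "nrm P (\<lambda>i. ?v i - u i) < r" .
      then have "?v \<in> K" by (intro r(2)) (simp_all add: space_Leb)
      then have "(\<lambda>i\<in>P. eps * ?v i) \<in> K" by (rule K_scale[OF eps, THEN iffD2, rotated]) (simp add: space_Leb)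
      from add[OF x(2) this] have "(\<lambda>i\<in>P. x i + (\<lambda>i\<in>P. eps * ?v i) i) \<in> K" .
      also have "(\<lambda>i\<in>P. x i + (\<lambda>i\<in>P. eps * ?v i) i) = w"
      proof
        fix i
        show "(\<lambda>i\<in>P. x i + (\<lambda>i\<in>P. eps * ?v i) i) i = w i"
          using w eps by (cases "i \<in> P") (simp_all add: space_Leb PiE_iff extensional_def)
      qed
      finally show "w \<in> K" .
    qed
    moreover have "?q \<in> b ?q ?\<delta>" using \<delta> by (simp add: b_def L2_set_def)
    ultimately have "\<exists>p \<delta>. ?q \<in> b p \<delta> \<and> b p \<delta> \<inter> space (Leb P) \<subseteq> K" by (intro exI conjI)
    then have "?q \<in> V" unfolding V_def by blast
    then show ?thesis by (simp add: L_def affm_def space_Leb)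
  qed
  have m: "{p \<in> A. nrm P p \<le> s} \<in> sets (Leb P)" if "A \<in> sets (Leb P)" for A s
  proof -
    have "{p \<in> A. nrm P p \<le> s} = A \<inter> {p \<in> space (Leb P). nrm P p \<le> s}"
      using sets.sets_into_space[OF that] by auto
    then show ?thesis using that by simp
  qed
  have fin: "vol P {p \<in> A. nrm P p \<le> 1} < \<infinity>" if "A \<in> sets (Leb P)" for A
  proof -
    have "vol P {p \<in> A. nrm P p \<le> 1} \<le> vol P {p \<in> space (Leb P). nrm P p \<le> 1}"
      using sets.sets_into_space[OF that] by (intro emeasure_mono) auto
    then show ?thesis using emeasure_ball_finite[OF P] by (rule le_less_trans)
  qed
  have "vol P {p \<in> U. nrm P p \<le> 1} \<le> vol P {p \<in> L. nrm P p \<le> 1}"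
  proof (rule le_of_le_scaled[OF fin[OF sets(2)] fin[OF sets(1)], where d="card P"])
    fix t :: real assume t: "1 < t"
    \<comment> \<open>Translation by \<open>(t - 1) u\<close> lengthens vectors by at most
      \<open>t - 1\<close>, so the unit ball lands in the ball of radius \<open>t\<close>;
      homogeneity of \<open>L\<close> scales that back at the cost of
      \<open>t^card P\<close>.\<close>
    let ?a = "\<lambda>i. (t - 1) * u i"
    have "{p \<in> U. nrm P p \<le> 1} \<subseteq> {p \<in> space (Leb P). affm P 1 ?a p \<in> {p \<in> L. nrm P p \<le> t * 1}}"
    proof safe
      fix p assume p: "p \<in> U" "nrm P p \<le> 1"
      show "p \<in> space (Leb P)" using p by (simp add: U_def)
      show "affm P 1 ?a p \<in> L" using t by (intro shift p) simp
      have "nrm P (affm P 1 ?a p) = nrm P (\<lambda>i. (\<lambda>i\<in>P. (t - 1) * u i) i + p i)"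
        by (intro L2_set_cong) (auto simp: affm_def)
      also have "\<dots> \<le> nrm P (\<lambda>i\<in>P. (t - 1) * u i) + nrm P p" by (rule L2_set_triangle_ineq)
      also have "nrm P (\<lambda>i\<in>P. (t - 1) * u i) = (t - 1) * nrm P u" using t by (intro nrm_scale) simp
      finally show "nrm P (affm P 1 ?a p) \<le> t * 1" using u p by simp
    qed
    then have "vol P {p \<in> U. nrm P p \<le> 1} \<le>
       vol P {p \<in> space (Leb P). affm P 1 ?a p \<in> {p \<in> L. nrm P p \<le> t * 1}}"
    proof (rule emeasure_mono)
      have "affm P 1 ?a -` {p \<in> L. nrm P p \<le> t * 1} \<inter> space (Leb P) \<in> sets (Leb P)"
        by (intro measurable_sets[OF measurable_affm] m sets)
      then show "{p \<in> space (Leb P). affm P 1 ?a p \<in> {p \<in> L. nrm P p \<le> t * 1}} \<in> sets (Leb P)"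
        by (simp add: vimage_def Int_def conj_commute)
    qed
    also have "\<dots> = vol P {p \<in> L. nrm P p \<le> t * 1}"
      using emeasure_affm[OF P _ m[OF sets(1), of "t * 1"], of 1 ?a] by simp
    also have "\<dots> = ennreal (t ^ card P) * vol P {p \<in> L. nrm P p \<le> 1}"
      using t by (intro cone_ball_scale(2)[OF P hL sets(1)]) simp
    finally show "vol P {p \<in> U. nrm P p \<le> 1} \<le> ennreal (t ^ card P) * vol P {p \<in> L. nrm P p \<le> 1}" .
  qed
  moreover have "vol P {p \<in> L. nrm P p \<le> 1} \<le> vol P {p \<in> U. nrm P p \<le> 1}"
    using LK KU by (intro emeasure_mono m sets) auto
  ultimately show ?thesis by (intro that[OF sets hL hU LK KU] antisym)
qed

subsection \<open>Joins\<close>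

text \<open>The closed form describes tubes \<open>S + eps\<close>; the strict form
  \<open>bandset'\<close> describes open balls.\<close>

definition bandset :: "nat \<Rightarrow> nat \<Rightarrow> real \<Rightarrow> (nat \<Rightarrow> real) set" where
  "bandset n m \<kappa> = {y \<in> space (Leb {..n}). \<kappa> * nrm {m..n} y \<le> nrm {..<m} y}"

definition bandset' :: "nat \<Rightarrow> nat \<Rightarrow> real \<Rightarrow> (nat \<Rightarrow> real) set" where
  "bandset' n m \<kappa> = {y \<in> space (Leb {..n}). \<kappa> * nrm {m..n} y < nrm {..<m} y}"

lemma band_bandset:
  assumes "1 \<le> m" "m \<le> n + 1" "0 \<le> \<kappa>"
  shows "band {m..n} {..<m} 0 \<kappa> (bandset n m \<kappa>)" "band {m..n} {..<m} 0 \<kappa> (bandset' n m \<kappa>)"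
proof -
  have I: "{m..n} \<union> {..<m} = {..n}" using assms by auto
  have [measurable]: "nrm {m..n} \<in> borel_measurable (Leb {..n})" "nrm {..<m} \<in> borel_measurable (Leb {..n})"
    using assms by (auto intro!: measurable_nrm_sub)
  show "band {m..n} {..<m} 0 \<kappa> (bandset n m \<kappa>)" "band {m..n} {..<m} 0 \<kappa> (bandset' n m \<kappa>)"
    unfolding band_def I using assms by (auto simp: bandset_def bandset'_def)
qed

lemma homog_bandset:
  assumes "1 \<le> m" "m \<le> n + 1"
  shows "homog {..n} (bandset n m \<kappa>)" "homog {..n} (bandset' n m \<kappa>)"
proof -
  have 1: "nrm J (\<lambda>i\<in>{..n}. t * y i) = t * nrm J y" if "t > 0" "J \<subseteq> {..n}" for J t and y :: "nat \<Rightarrow> real"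
  proof -
    have "nrm J (\<lambda>i\<in>{..n}. t * y i) = nrm J (\<lambda>i\<in>J. t * y i)" using that by (intro L2_set_cong) auto
    then show ?thesis using that nrm_scale[of t y J] by simp
  qed
  have sub: "{m..n} \<subseteq> {..n}" "{..<m} \<subseteq> {..n}" using assms by auto
  have 2: "\<kappa> * (t * a) \<le> t * b \<longleftrightarrow> \<kappa> * a \<le> b" "\<kappa> * (t * a) < t * b \<longleftrightarrow> \<kappa> * a < b" if "t > 0" for t a b :: real
  proof -
    have "\<kappa> * (t * a) = t * (\<kappa> * a)" by simp
    then show "\<kappa> * (t * a) \<le> t * b \<longleftrightarrow> \<kappa> * a \<le> b" "\<kappa> * (t * a) < t * b \<longleftrightarrow> \<kappa> * a < b"
      using that by (simp_all del: mult.left_commute)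
  qed
  show "homog {..n} (bandset n m \<kappa>)" "homog {..n} (bandset' n m \<kappa>)"
    by (auto simp: homog_def bandset_def bandset'_def space_Leb 1[OF _ sub(1)] 1[OF _ sub(2)] 2)
qed

text \<open>All quantities are nonnegative and may be squared. On the unit circle,
  \<open>p^2 - cos^2\<close> equals \<open>(sin * p)^2 - (cos * q)^2\<close> at the angle
  \<open>eps\<close>, so the two comparisons have the same sign; the second form is homogeneous in
  \<open>p\<close> and \<open>q\<close>.\<close>

lemma cos_le_iff_cot:
  assumes "0 < eps" "eps \<le> pi/2" "0 \<le> p" "0 \<le> q" "p\<^sup>2 + q\<^sup>2 = 1"
  shows "cos eps \<le> p \<longleftrightarrow> cos eps / sin eps * q \<le> p" "cos eps < p \<longleftrightarrow> cos eps / sin eps * q < p"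
proof -
  have s: "0 < sin eps" using assms pi_gt_zero by (intro sin_gt_zero) linarith+
  have c: "0 \<le> cos eps" using assms by (intro cos_ge_zero) auto
  have sq: "a \<le> b \<longleftrightarrow> a\<^sup>2 \<le> b\<^sup>2" if "0 \<le> a" "0 \<le> b" for a b :: real
    using that by (simp add: power_mono_iff)
  have id: "p\<^sup>2 - (cos eps)\<^sup>2 = (sin eps * p)\<^sup>2 - (cos eps * q)\<^sup>2"
  proof -
    have "(sin eps * p)\<^sup>2 - (cos eps * q)\<^sup>2 = (1 - (cos eps)\<^sup>2) * p\<^sup>2 - (cos eps)\<^sup>2 * (1 - p\<^sup>2)"
      using assms(5) by (simp add: power_mult_distrib sin_squared_eq algebra_simps flip: assms(5))
    then show ?thesis by (simp add: algebra_simps)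
  qed
  have cs: "0 \<le> cos eps * q" "0 \<le> sin eps * p" using s c assms by auto
  have "cos eps \<le> p \<longleftrightarrow> cos eps * q \<le> sin eps * p" "p \<le> cos eps \<longleftrightarrow> sin eps * p \<le> cos eps * q"
    unfolding sq[OF c assms(3)] sq[OF assms(3) c] sq[OF cs] sq[OF cs(2,1)] using id by linarith+
  then show "cos eps \<le> p \<longleftrightarrow> cos eps / sin eps * q \<le> p" "cos eps < p \<longleftrightarrow> cos eps / sin eps * q < p"
    using s by (auto simp: field_simps not_le[symmetric])
qed

context rotation
begin

definition emb :: "nat \<Rightarrow> (nat \<Rightarrow> real) \<Rightarrow> nat \<Rightarrow> real" where
  "emb m p = (\<lambda>i\<in>{..n}. if i < m then p i else 0)"

text \<open>The cone over a subset of the span of the first \<open>m\<close> basis vectors,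
  described by \<open>m\<close> coordinates. In this smaller space it can have interior, which its
  copy in the full space lacks when \<open>m \<le> n\<close>.\<close>

definition base :: "nat \<Rightarrow> (nat \<Rightarrow> real) set \<Rightarrow> (nat \<Rightarrow> real) set" where
  "base m X = {p \<in> space (Leb {..<m}). rot (emb m p) \<in> fcone n X}"

lemma nrm_emb:
  assumes "m \<le> n + 1" shows "nrm {..n} (emb m p) = nrm {..<m} p"
proof -
  have "(\<Sum>i\<le>n. (emb m p i)\<^sup>2) = (\<Sum>i<m. (emb m p i)\<^sup>2)"
    using assms by (intro sum.mono_neutral_right) (auto simp: emb_def)
  also have "\<dots> = (\<Sum>i<m. (p i)\<^sup>2)" using assms by (intro sum.cong) (auto simp: emb_def)
  finally show ?thesis by (simp add: L2_set_def)
qed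

lemma emb_combine:
  assumes "m \<le> n + 1"
  shows "emb m (\<lambda>i\<in>{..<m}. a * p i + b * p' i) = (\<lambda>i\<in>{..n}. a * emb m p i + b * emb m p' i)"
  using assms by (auto simp: emb_def)

lemma base_convcone:
  assumes m: "m \<le> n + 1" and X: "X \<subseteq> sph n" "gconvex n X" "\<And>x. x \<in> X \<Longrightarrow> 0 < ip n (e 0) x"
  shows "convcone {..<m} (base m X)"
proof -
  have cc: "convcone {..n} (fcone n X)" by (rule fcone_combine[OF X])
  show ?thesis
    unfolding convcone_def base_def
  proof (intro conjI ballI allI impI CollectI)
    fix x y :: "nat \<Rightarrow> real" and a b :: real
    assume "x \<in> {p \<in> space (Leb {..<m}). rot (emb m p) \<in> fcone n X}"
      "y \<in> {p \<in> space (Leb {..<m}). rot (emb m p) \<in> fcone n X}" and ab: "0 \<le> a" "0 \<le> b" "0 < a + b"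
    then show "rot (emb m (\<lambda>i\<in>{..<m}. a * x i + b * y i)) \<in> fcone n X"
      unfolding emb_combine[OF m] rot_combine by (intro convconeD[OF cc ]) auto
  qed (auto simp: space_Leb)
qed

lemma base_pos:
  assumes m: "1 \<le> m" "m \<le> n + 1" and X: "\<And>x. x \<in> X \<Longrightarrow> 0 < ip n (e 0) x" and p: "p \<in> base m X"
  shows "0 < p 0"
proof -
  have "rot (emb m p) \<in> fcone n X" using p by (simp add: base_def)
  then obtain t u where u: "0 < t" "u \<in> X" "rot (emb m p) = (\<lambda>i\<in>{..n}. t * u i)" using fconeE by blast
  have "p 0 = emb m p 0" using m by (simp add: emb_def)
  also have "\<dots> = ip n (rot (emb m p)) (e 0)" by (simp add: ip_rot_e)
  also have "\<dots> = t * ip n (e 0) u" unfolding u(3) by (simp add: ip_scale ip_commute[of n u])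
  finally show ?thesis using u X by simp
qed

text \<open>Turns a spherical neighbourhood of the centre inside \<open>E\<close> into a Euclidean
  ball around the first unit vector, the form of interior that \<open>cone_sandwich\<close> asks
  for.\<close>

lemma base_nbhd:
  assumes m: "1 \<le> m" "m \<le> n + 1" and e0: "e 0 \<in> sph n"
    and E: "E = {x \<in> Rsp n. \<forall>j\<in>{m..n}. ip n x (e j) = 0}"
    and eps: "eps > 0" "sball n (e 0) eps \<inter> (sph n \<inter> E) \<subseteq> X"
  obtains r where "0 < r" "\<And>p. p \<in> space (Leb {..<m}) \<Longrightarrow> nrm {..<m} (\<lambda>i. p i - (if i = 0 then 1 else 0)) < r \<Longrightarrow> p \<in> base m X"
proof -
  \<comment> \<open>The cap of the angle at 1, below \<open>pi/2\<close>, keeps the cosine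
    positive.\<close>
  define C where "C = cos (min eps 1)"
  have C: "0 < C" "C < 1"
  proof -
    show "0 < C" unfolding C_def using eps pi_gt3 by (intro cos_gt_zero_pi) auto
    show "C < 1" unfolding C_def using cos_monotone_0_pi[of 0 "min eps 1"] eps pi_gt3 by auto
  qed
  \<comment> \<open>The estimates give \<open>p 0 > 1 - r\<close> and norm below
    \<open>1 + r\<close>, so \<open>C * (1 + r) < 1 - r\<close> is wanted; this holds because
    \<open>C + 2 * r = 1\<close> and \<open>C * r < r\<close>.\<close>
  define r where "r = (1 - C) / 2"
  have r: "0 < r" "r < 1" using C by (auto simp: r_def)
  have "p \<in> base m X" if p: "p \<in> space (Leb {..<m})" and near: "nrm {..<m} (\<lambda>i. p i - (if i = 0 then 1 else 0)) < r" for p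
  proof -
    let ?d = "\<lambda>i. p i - (if i = 0 then 1 else (0::real))" and ?N = "nrm {..<m} p"
    have "\<bar>p 0 - 1\<bar> < r" using abs_le_nrm[of "{..<m}" 0 ?d] m near by auto
    then have p0: "1 - r < p 0" by auto
    have "?N = nrm {..<m} (\<lambda>i. ?d i + (if i = 0 then 1 else 0))" by (intro L2_set_cong) auto
    also have "\<dots> \<le> nrm {..<m} ?d + nrm {..<m} (\<lambda>i. if i = 0 then 1 else 0)" by (rule L2_set_triangle_ineq)
    also have "nrm {..<m} (\<lambda>i. if i = 0 then 1 else (0::real)) = 1" using m by (simp add: L2_set_def if_distrib[of "\<lambda>x. x\<^sup>2"] cong: if_cong)
    finally have N: "?N < 1 + r" using near by simp
    have Np: "?N > 0" using abs_le_nrm[of "{..<m}" 0 p] m p0 r by auto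
    have "C * ?N < p 0"
    proof -
      have "C * ?N \<le> C * (1 + r)" using C N by simp
      also have "\<dots> < 1 - r"
      proof -
        have "C * r < 1 * r" using C r by (intro mult_strict_right_mono) auto
        then show ?thesis unfolding r_def by (simp add: field_simps)
      qed
      finally show ?thesis using p0 by simp
    qed
    let ?x = "rot (emb m p)" and ?u = "\<lambda>i\<in>{..n}. 1 / ?N * rot (emb m p) i"
    have nx: "nrm {..n} ?x = ?N" by (simp add: nrm_emb[OF m(2)])
    have "nrm {..n} ?u = 1 / ?N * nrm {..n} ?x" by (rule nrm_scale) simp
    then have us: "?u \<in> sph n" using Np nx by (simp add: sph_iff Rsp_def)
    have ipx: "ip n ?u w = 1 / ?N * ip n ?x w" for w using ip_scale[of n "1 / ?N" ?x w] by simp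
    have "ip n ?u (e j) = 0" if "j \<in> {m..n}" for j
      unfolding ipx using that by (subst ip_rot_e) (auto simp: emb_def)
    then have uE: "?u \<in> E" unfolding E using us by (simp add: sph_iff)
    have "ip n (e 0) ?u = 1 / ?N * p 0"
      unfolding ip_commute[of n "e 0"] ipx ip_rot_e[OF le0] using m by (simp add: emb_def)
    then have "C < ip n (e 0) ?u" using \<open>C * ?N < p 0\<close> Np by (simp add: pos_less_divide_eq)
    then have "?u \<in> sball n (e 0) (min eps 1)"
      using sball_iff[OF e0, of "min eps 1" ?u] us eps pi_gt3 by (auto simp: C_def)
    then have "?u \<in> X" using eps(2) us uE by (auto simp: sball_def)
    then show ?thesis using p Np nx by (simp add: base_def fcone_def)
  qed
  then show ?thesis using r that by blast
qed

definition join :: "(nat \<Rightarrow> real) set \<Rightarrow> (nat \<Rightarrow> real) set \<Rightarrow> (nat \<Rightarrow> real) set" where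
  "join X F = {restrict (\<lambda>i. cos t * u i + sin t * v i) {..n} | u v t. u \<in> X \<and> v \<in> F \<and> 0 \<le> t \<and> t \<le> pi/2}"

lemma join_sph:
  assumes E: "E \<subseteq> Rsp n" and X: "X \<subseteq> sph n \<inter> E"
  shows "join X (sph n \<inter> orthc n E) \<subseteq> sph n"
proof
  fix x assume "x \<in> join X (sph n \<inter> orthc n E)"
  then obtain u v t where x: "x = (\<lambda>i\<in>{..n}. cos t * u i + sin t * v i)" "u \<in> X" "v \<in> sph n \<inter> orthc n E"
    by (auto simp: join_def)
  have uv: "ip n u u = 1" "ip n v v = 1" "ip n u v = 0" "ip n v u = 0"
    using x X by (auto simp: sph_def orthc_def ip_commute[of n u v])
  have "ip n x x = cos t * ip n x u + sin t * ip n x v"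
    unfolding x(1) by (simp only: ip_combine ip_commute[of n _ "\<lambda>i\<in>{..n}. cos t * u i + sin t * v i"])
  also have "ip n x u = cos t" unfolding x(1) ip_combine using uv by simp
  also have "ip n x v = sin t" unfolding x(1) ip_combine using uv by simp
  finally have "ip n x x = 1" by (simp flip: power2_eq_square)
  then show "x \<in> sph n" using x(1) by (simp add: sph_def Rsp_def)
qed

text \<open>The join parameter of a point is the angle whose cosine and sine are the relative
  lengths of its components in \<open>E\<close> and in the complement. Cylinder and join differ only
  where the component in \<open>E\<close> vanishes, that is, where \<open>cos t = 0\<close>.\<close>

lemma pcone_join:
  assumes m: "1 \<le> m" "m \<le> n" and eE: "\<And>j. j < m \<Longrightarrow> e j \<in> E"
    and E: "E = {x \<in> Rsp n. \<forall>j\<in>{m..n}. ip n x (e j) = 0}"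
    and X: "X \<subseteq> sph n \<inter> E"
  shows "{y \<in> space M. restrict y {..<m} \<in> base m X} \<subseteq> pcone (join X (sph n \<inter> orthc n E))"
    and "pcone (join X (sph n \<inter> orthc n E)) \<subseteq> {y \<in> space M. restrict y {..<m} \<in> base m X} \<union> {y \<in> space M. nrm {..<m} y = 0}"
proof -
  have m1: "m \<le> n + 1" using m by simp
  show "{y \<in> space M. restrict y {..<m} \<in> base m X} \<subseteq> pcone (join X (sph n \<inter> orthc n E))"
  proof safe
    fix y assume y: "y \<in> space M" and b: "restrict y {..<m} \<in> base m X"
    define z' where "z' = (\<lambda>i\<in>{..n}. if i < m then 0 else y i)"
    define q where "q = nrm {..n} z'"
    have eq: "emb m (restrict y {..<m}) = emb m y" by (auto simp: emb_def)
    have w: "rot (emb m y) \<in> fcone n X" using b by (simp add: base_def eq)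
    then obtain t u where u: "0 < t" "u \<in> X" "rot (emb m y) = (\<lambda>i\<in>{..n}. t * u i)" and t: "t = nrm {..n} (rot (emb m y))"
      by (rule fconeE)
    obtain z where z: "z \<in> Rsp n" "\<And>j. j < m \<Longrightarrow> z j = 0" "nrm {..n} z = 1" "\<And>i. i \<le> n \<Longrightarrow> z' i = q * z i"
    proof (cases "q = 0")
      case True
      have 1: "z' i = 0" if "i \<le> n" for i using abs_le_nrm[of "{..n}" i z'] that True by (simp add: q_def)
      \<comment> \<open>With no component orthogonal to \<open>E\<close> the direction is arbitrary,
        but a unit vector of the complement must exist; the last basis vector serves because
        \<open>m \<le> n\<close>.\<close>
      let ?z = "\<lambda>i\<in>{..n}. if i = n then 1 else (0::real)"
      have "nrm {..n} ?z = 1" by (simp add: L2_set_def if_distrib[of "\<lambda>x. x\<^sup>2"] cong: if_cong)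
      then show ?thesis using that[of ?z] m True 1 by (auto simp: Rsp_def)
    next
      case False
      then have q: "q > 0" by (simp add: q_def less_le)
      let ?z = "\<lambda>i\<in>{..n}. 1 / q * z' i"
      have "nrm {..n} ?z = 1 / q * q" unfolding q_def by (rule nrm_scale) simp
      then show ?thesis using that[of ?z] q m by (auto simp: Rsp_def z'_def)
    qed
    have ysplit: "y = (\<lambda>i\<in>{..n}. 1 * emb m y i + q * z i)"
    proof
      fix i show "y i = (\<lambda>i\<in>{..n}. 1 * emb m y i + q * z i) i"
        using y z(4)[of i] z(2)[of i] by (cases "i \<le> n"; cases "i < m") (auto simp: emb_def z'_def space_Leb PiE_iff extensional_def)
    qed
    have ry: "rot y = (\<lambda>i\<in>{..n}. t * u i + q * rot z i)"
      by (subst ysplit, subst rot_combine) (auto simp: u(3))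
    have N2: "(nrm {..n} y)\<^sup>2 = t\<^sup>2 + q\<^sup>2"
    proof -
      have "t = nrm {..n} (emb m y)" using t by simp
      then have "t\<^sup>2 = (\<Sum>i\<le>n. (emb m y i)\<^sup>2)" by (simp add: L2_set_def sum_nonneg)
      moreover have "q\<^sup>2 = (\<Sum>i\<le>n. (z' i)\<^sup>2)" by (simp add: q_def L2_set_def sum_nonneg)
      moreover have "(nrm {..n} y)\<^sup>2 = (\<Sum>i\<le>n. (y i)\<^sup>2)" by (simp add: L2_set_def sum_nonneg)
      moreover have "(\<Sum>i\<le>n. (y i)\<^sup>2) = (\<Sum>i\<le>n. (emb m y i)\<^sup>2) + (\<Sum>i\<le>n. (z' i)\<^sup>2)"
        unfolding sum.distrib[symmetric] by (intro sum.cong) (auto simp: emb_def z'_def)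
      ultimately show ?thesis by simp
    qed
    let ?N = "nrm {..n} y"
    have q0: "0 \<le> q" by (simp add: q_def)
    have N: "?N > 0"
    proof -
      have "?N\<^sup>2 > 0" unfolding N2 using u by (simp add: add_pos_nonneg)
      then show ?thesis by (simp add: less_le)
    qed
    define \<theta> where "\<theta> = arccos (t / ?N)"
    have tN: "0 \<le> t / ?N" "t / ?N \<le> 1"
    proof -
      have "t\<^sup>2 \<le> ?N\<^sup>2" unfolding N2 by simp
      then have "t \<le> ?N" using N by (simp add: power2_le_iff_abs_le)
      then show "0 \<le> t / ?N" "t / ?N \<le> 1" using N u by auto
    qed
    have c: "cos \<theta> = t / ?N" unfolding \<theta>_def using tN by (intro cos_arccos) auto
    have s: "sin \<theta> = q / ?N"
    proof -
      have "sin \<theta> = sqrt (1 - (t / ?N)\<^sup>2)" unfolding \<theta>_def using tN by (intro sin_arccos) auto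
      also have "1 - (t / ?N)\<^sup>2 = (q / ?N)\<^sup>2"
      proof -
        have "(t / ?N)\<^sup>2 + (q / ?N)\<^sup>2 = ?N\<^sup>2 / ?N\<^sup>2" by (simp add: power_divide N2 flip: add_divide_distrib)
        also have "\<dots> = 1" using N by simp
        finally show ?thesis by linarith
      qed
      finally show ?thesis using N q0 by simp
    qed
    have "rot z \<in> orthc n E"
      unfolding orthc_def
    proof (intro CollectI conjI ballI)
      fix x assume x: "x \<in> E"
      have "ip n (rot z) x = ip n (rot z) (rot (coord x))" using x rot_coord by (simp add: E)
      also have "\<dots> = (\<Sum>i\<le>n. z i * coord x i)" by (simp only: ip_rot) (simp add: ip_def)
      also have "\<dots> = 0"
      proof (rule sum.neutral, rule ballI)
        fix i assume "i \<in> {..n}"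
        then show "z i * coord x i = 0" using z(2)[of i] x by (cases "i < m") (auto simp: E coord_def)
      qed
      finally show "ip n (rot z) x = 0" .
    qed simp
    moreover have "rot z \<in> sph n" using z by (simp add: sph_iff)
    moreover have "0 \<le> \<theta>" unfolding \<theta>_def using tN by (intro arccos_lbound) auto
    moreover have "\<theta> \<le> pi/2" unfolding \<theta>_def using tN by (rule arccos_le_pi2)
    ultimately have "restrict (\<lambda>i. cos \<theta> * u i + sin \<theta> * rot z i) {..n} \<in> join X (sph n \<inter> orthc n E)"
      using u(2) unfolding join_def by blast
    also have "restrict (\<lambda>i. cos \<theta> * u i + sin \<theta> * rot z i) {..n} = (\<lambda>i\<in>{..n}. 1 / nrm {..n} (rot y) * rot y i)"
    proof -
      have "rot y i = t * u i + q * rot z i" if "i \<le> n" for i using that by (simp add: ry)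
      then show ?thesis unfolding c s nrm_rot by (intro restrict_ext) (simp add: add_divide_distrib)
    qed
    finally have "rot y \<in> fcone n (join X (sph n \<inter> orthc n E))"
      using N unfolding fcone_def by (intro CollectI conjI) (simp_all only: nrm_rot rot_Rsp)
    then show "y \<in> pcone (join X (sph n \<inter> orthc n E))" using y by (simp add: pcone_def)
  qed
  show "pcone (join X (sph n \<inter> orthc n E)) \<subseteq> {y \<in> space M. restrict y {..<m} \<in> base m X} \<union> {y \<in> space M. nrm {..<m} y = 0}"
  proof
    fix y assume "y \<in> pcone (join X (sph n \<inter> orthc n E))"
    then have y: "y \<in> space M" and ry: "rot y \<in> fcone n (join X (sph n \<inter> orthc n E))" by (auto simp: pcone_def)
    obtain s x where s: "0 < s" "x \<in> join X (sph n \<inter> orthc n E)" "rot y = (\<lambda>i\<in>{..n}. s * x i)" using fconeE[OF ry] by blast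
    obtain u v t where x: "x = (\<lambda>i\<in>{..n}. cos t * u i + sin t * v i)" "u \<in> X" "v \<in> sph n \<inter> orthc n E" "0 \<le> t" "t \<le> pi/2"
      using s(2) by (auto simp: join_def)
    have ct: "0 \<le> cos t" using x by (intro cos_ge_zero) auto
    have v0: "ip n v (e j) = 0" if "j < m" for j using x(3) eE[OF that] by (auto simp: orthc_def)
    have u0: "ip n u (e j) = 0" if "j \<in> {m..n}" for j using x(2) X that by (auto simp: E)
    have yj: "y j = (s * cos t) * ip n u (e j)" if "j < m" for j
    proof -
      have "y j = ip n (rot y) (e j)" using that m by (subst ip_rot_e) auto
      also have "\<dots> = s * ip n x (e j)" unfolding s(3) by (simp add: ip_scale)
      also have "ip n x (e j) = cos t * ip n u (e j)" unfolding x(1) ip_combine using v0[OF that] by simp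
      finally show ?thesis by simp
    qed
    show "y \<in> {y \<in> space M. restrict y {..<m} \<in> base m X} \<union> {y \<in> space M. nrm {..<m} y = 0}"
    proof (cases "cos t = 0")
      case True
      then have "nrm {..<m} y = 0" using yj by (simp add: L2_set_def)
      then show ?thesis using y by simp
    next
      case False
      then have st: "0 < s * cos t" using s ct by (simp add: less_le)
      have uR: "u \<in> Rsp n" using x X by (auto simp: E)
      have "emb m (restrict y {..<m}) = (\<lambda>i\<in>{..n}. (s * cos t) * coord u i)"
        using yj u0 by (auto simp: emb_def coord_def)
      then have "rot (emb m (restrict y {..<m})) = (\<lambda>i\<in>{..n}. (s * cos t) * rot (coord u) i)" by (simp only: rot_scale)
      also have "\<dots> \<in> fcone n X" unfolding rot_coord[OF uR] using X x st by (intro fcone_scale) auto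
      finally show ?thesis using y by (auto simp: base_def space_Leb)
    qed
  qed
qed

lemma null_subspace:
  assumes "1 \<le> m" "m \<le> n + 1"
  shows "{y \<in> space M. nrm {..<m} y = 0} \<in> null_sets M"
proof -
  have I: "{m..n} \<union> {..<m} = {..n}" using assms by auto
  have [measurable]: "nrm {..<m} \<in> borel_measurable M" using assms by (intro measurable_nrm_sub) auto
  have s: "{y \<in> space M. nrm {..<m} y = 0} \<in> sets M" by measurable
  have "0 \<in> {..<m}" using assms by simp
  then have ne: "{..<m} \<noteq> {}" by blast
  have sl: "slice {m..n} {..<m} {y \<in> space M. nrm {..<m} y = 0} q = {p \<in> space (Leb {..<m}). nrm {..<m} p = 0}" for q
  proof -
    have "{m..n} \<inter> {..<m} = {}" by auto
    then have "nrm {..<m} (merge {m..n} {..<m} (q, p)) = nrm {..<m} p" for p by (rule nrm_merge(2))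
    then show ?thesis using merge_in_space[of "{m..n}" "{..<m}"] unfolding I by simp
  qed
  have "emeasure M {y \<in> space M. nrm {..<m} y = 0} = (\<integral>\<^sup>+q. vol {..<m} {p \<in> space (Leb {..<m}). nrm {..<m} p = 0} \<partial>Leb {m..n})"
  proof -
    have d: "{m..n} \<inter> {..<m} = {}" by auto
    show ?thesis using emeasure_slices[of "{m..n}" "{..<m}", unfolded I, OF _ _ d s] unfolding sl by auto
  qed
  also have "\<dots> = 0" using emeasure_sphere_null[OF _ ne, of 0] by simp
  finally show ?thesis using s by (simp add: null_sets_def)
qed

text \<open>Join and hemisphere are both cylinders up to null sets, so the four volumes are, up to
  the factor \<open>n + 1\<close>, \<open>k * a\<close>, \<open>k * (a + b)\<close>,
  \<open>h * a\<close> and \<open>h * (a + b)\<close>, where \<open>k\<close> and \<open>h\<close>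
  belong to the bases and \<open>a\<close>, \<open>b\<close> to the weights.\<close>

lemma join_equality:
  assumes m: "1 \<le> m" "m \<le> n" and eE: "\<And>j. j < m \<Longrightarrow> e j \<in> E"
    and E: "E = {x \<in> Rsp n. \<forall>j\<in>{m..n}. ip n x (e j) = 0}"
    and X: "X \<subseteq> sph n \<inter> E" "gconvex n X" "X \<subseteq> sball n (e 0) (pi/2)" "csym n (sph n \<inter> E) (e 0) X"
    and W: "W \<subseteq> sph n" "\<And>x. x \<in> sph n \<Longrightarrow> x \<in> W \<longleftrightarrow> coord x \<in> Hemi \<inter> bandset n m \<kappa>" and \<kappa>: "0 \<le> \<kappa>"
  defines "Xn \<equiv> join X (sph n \<inter> orthc n E)"
  shows "svol n (Xn \<inter> W) * svol n (sball n (e 0) (pi/2)) = svol n Xn * svol n W"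
proof -
  have m1: "m \<le> n + 1" using m by simp
  have e0: "e 0 \<in> Rsp n" using eE[of 0] m by (simp add: E)
  interpret band "{m..n}" "{..<m}" 0 \<kappa> "bandset n m \<kappa>" by (rule band_bandset[OF m(1) m1 \<kappa>])
  have I: "{m..n} \<union> {..<m} = {..n}" using m by auto
  have BB: "B = UB" unfolding B_def I ..
  let ?Y = "bandset n m \<kappa>" and ?m = "emeasure M" and ?P = "Leb {..<m}"
  have Ym: "?Y \<in> sets M" using Y(1) unfolding I .
  have pos: "0 < ip n (e 0) x" if "x \<in> X" for x using that X(3) hemi_iff[OF e0_sph[OF e0]] by blast
  let ?K = "base m X"
  have cK: "convcone {..<m} ?K" using X(1) by (intro base_convcone m1 X(2) pos) auto
  obtain eps where eps: "eps > 0" "sball n (e 0) eps \<inter> (sph n \<inter> E) \<subseteq> X" using X(4) by (auto simp: csym_def)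
  obtain r where r: "0 < r" "\<And>p. p \<in> space ?P \<Longrightarrow> nrm {..<m} (\<lambda>i. p i - (if i = 0 then 1 else 0)) < r \<Longrightarrow> p \<in> ?K"
    using base_nbhd[OF m(1) m1 e0_sph[OF e0] E eps] by blast
  have un: "nrm {..<m} (\<lambda>i. if i = 0 then 1 else (0::real)) = 1"
    using m by (simp add: L2_set_def if_distrib[of "\<lambda>x. x\<^sup>2"] cong: if_cong)
  have addK: "(\<lambda>i\<in>{..<m}. x i + y i) \<in> ?K" if "x \<in> ?K" "y \<in> ?K" for x y
    using convconeD[OF cK that, of 1 1] by simp
  obtain L U where LU: "L \<in> sets ?P" "U \<in> sets ?P" "homog {..<m} L" "homog {..<m} U" "L \<subseteq> ?K" "?K \<subseteq> U"
    and eqLU: "emeasure ?P {p \<in> U. nrm {..<m} p \<le> 1} = emeasure ?P {p \<in> L. nrm {..<m} p \<le> 1}"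
    using cone_sandwich[OF _ convcone_imp_homog[OF cK] addK un r] by blast
  define cyl where "cyl = (\<lambda>K. {y \<in> space M. restrict y {..<m} \<in> K})"
  let ?a = "\<integral>\<^sup>+q. wY (nrm {m..n} q) \<partial>Leb {m..n}" and ?b = "\<integral>\<^sup>+q. wN (nrm {m..n} q) \<partial>Leb {m..n}"
  let ?\<kappa> = "\<lambda>K. emeasure ?P {p \<in> K. nrm {..<m} p \<le> 1}"
  have cyl_eq: "{y \<in> space M. restrict y {..<m} \<in> K} = cyl K" for K by (simp add: cyl_def)
  note cy = emeasure_cylinder[unfolded I BB cyl_eq]
  have cyY: "?m (cyl K \<inter> ?Y \<inter> UB) = ?\<kappa> K * ?a" and cyB: "?m (cyl K \<inter> UB) = ?\<kappa> K * (?a + ?b)"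
    if K: "homog {..<m} K" "K \<in> sets ?P" for K
  proof -
    show 1: "?m (cyl K \<inter> ?Y \<inter> UB) = ?\<kappa> K * ?a" by (rule cy(2)[OF K])
    have "?m (cyl K \<inter> UB) = ?m (cyl K \<inter> ?Y \<inter> UB) + ?m ((cyl K - ?Y) \<inter> UB)"
      using cy(1)[OF K] Ym by (subst plus_emeasure) (auto intro!: arg_cong[where f="?m"])
    then show "?m (cyl K \<inter> UB) = ?\<kappa> K * (?a + ?b)" unfolding 1 cy(3)[OF K] by (simp add: distrib_left)
  qed
  note cyL = cy(1)[OF LU(3,1)] and cyU = cy(1)[OF LU(4,2)]
  have Xns: "Xn \<subseteq> sph n" unfolding Xn_def using X(1) by (intro join_sph) (auto simp: E)
  have sub: "cyl ?K \<subseteq> pcone Xn" "pcone Xn \<subseteq> cyl ?K \<union> {y \<in> space M. nrm {..<m} y = 0}"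
    unfolding cyl_def Xn_def using pcone_join[OF m eE E X(1)] by auto
  have mono: "cyl L \<subseteq> cyl ?K" "cyl ?K \<subseteq> cyl U" using LU by (auto simp: cyl_def)
  have KH: "cyl ?K \<subseteq> Hemi"
    using base_pos[OF m(1) m1 pos] m by (fastforce simp: cyl_def Hemi_def)
  have hHY: "homog {..n} (Hemi \<inter> ?Y)" using homog_Hemi homog_bandset[OF m(1) m1] by (auto simp: homog_def)
  have pW: "pcone W = Hemi \<inter> ?Y" by (rule pcone_homog[OF hHY _ W(2,1)]) (auto dest: Hemi_nrm)
  have HP: "nrm {..<m} y \<noteq> 0" if "y \<in> Hemi" for y
    using abs_le_nrm[of "{..<m}" 0 y] that m by (auto simp: Hemi_def)
  \<comment> \<open>Points of \<open>Hemi\<close> have a nonzero component in \<open>E\<close>, so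
    after intersecting with \<open>W\<close> the join agrees exactly with the cylinder.\<close>
  have pXW: "pcone (Xn \<inter> W) = cyl ?K \<inter> ?Y"
    unfolding pcone_Int pW using sub KH HP by blast
  have fin: "?m A < \<infinity>" if "A \<subseteq> UB" for A
  proof -
    have "?m A \<le> ?m UB" using that by (intro emeasure_mono) auto
    then show ?thesis using emeasure_UB by (rule le_less_trans)
  qed
  define k where "k = ?\<kappa> L"
  have v1: "svol n (Xn \<inter> W) = real (n + 1) * enn2real (k * ?a)"
  proof -
    have "svol n (Xn \<inter> W) = real (n + 1) * measure M (cyl L \<inter> ?Y \<inter> UB)"
    proof (rule svol_sandwich)
      show "cyl U \<inter> ?Y \<inter> UB \<in> sets M" "cyl L \<inter> ?Y \<inter> UB \<in> sets M" using cyL cyU Ym by auto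
      show "?m (cyl L \<inter> ?Y \<inter> UB) = ?m (cyl U \<inter> ?Y \<inter> UB)" using cyY LU eqLU by simp
      show "?m (cyl U \<inter> ?Y \<inter> UB) < \<infinity>" by (rule fin) auto
    qed (use Xns mono in \<open>auto simp: pXW\<close>)
    then show ?thesis using cyY[OF LU(3,1)] by (simp add: measure_def k_def)
  qed
  have v2: "svol n Xn = real (n + 1) * enn2real (k * (?a + ?b))"
  proof -
    \<comment> \<open>The directions orthogonal to \<open>E\<close> may belong to the join; they are
      added to the upper bound only, as a null set.\<close>
    let ?Z = "{y \<in> space M. nrm {..<m} y = 0}"
    note Z = null_subspace[OF m(1) m1]
    have UZ: "cyl U \<inter> UB \<in> sets M" using cyU by auto
    have eZ: "?m (cyl U \<inter> UB \<union> ?Z) = ?m (cyl U \<inter> UB)" by (rule emeasure_Un_null_set[OF UZ Z])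
    have "svol n Xn = real (n + 1) * measure M (cyl L \<inter> UB)"
    proof (rule svol_sandwich)
      show "cyl U \<inter> UB \<union> ?Z \<in> sets M" "cyl L \<inter> UB \<in> sets M" using cyL UZ Z by auto
      show "?m (cyl L \<inter> UB) = ?m (cyl U \<inter> UB \<union> ?Z)" unfolding eZ using cyB LU eqLU by simp
      show "?m (cyl U \<inter> UB \<union> ?Z) < \<infinity>" unfolding eZ by (rule fin) auto
      show "cyl L \<inter> UB \<subseteq> pcone Xn \<inter> UB" using mono sub by auto
      show "pcone Xn \<inter> UB \<subseteq> cyl U \<inter> UB \<union> ?Z" using mono sub by auto
    qed (rule Xns)
    then show ?thesis using cyB[OF LU(3,1)] by (simp add: measure_def k_def)
  qed
  define K0 where "K0 = {p \<in> space ?P. 0 < p 0}"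
  have [measurable]: "(\<lambda>p. p 0) \<in> borel_measurable ?P"
    using measurable_component_singleton[of 0 "{..<m}" "\<lambda>_. lborel :: real measure"] m by simp
  have "K0 \<in> sets ?P" unfolding K0_def by measurable
  moreover have "homog {..<m} K0" using m by (auto simp: K0_def homog_def space_Leb)
  ultimately have K0: "homog {..<m} K0" "K0 \<in> sets ?P" by auto
  have H: "cyl K0 = Hemi" using m by (auto simp: cyl_def K0_def Hemi_def space_Leb)
  define h where "h = ?\<kappa> K0"
  have v3: "svol n (sball n (e 0) (pi/2)) = real (n + 1) * enn2real (h * (?a + ?b))"
  proof -
    have hs: "sball n (e 0) (pi/2) \<subseteq> sph n" by (auto simp: sball_def)
    show ?thesis
      using svol_pcone[OF hs] cyB[OF K0] unfolding pcone_hemi[OF e0] H h_def by (simp add: measure_def)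
  qed
  have v4: "svol n W = real (n + 1) * enn2real (h * ?a)"
    using svol_pcone[OF W(1)] cyY[OF K0] Ym unfolding pW H h_def by (simp add: measure_def)
  show ?thesis unfolding v1 v2 v3 v4 by (simp add: enn2real_mult mult_ac)
qed

end

subsection \<open>Raising the dimension\<close>

text \<open>The join of \<open>A\<close> with the complementary coordinate sphere, without that
  sphere itself: its points project to 0 and lie in no \<open>fcone\<close>. Leaving it out keeps
  the suspension of an open set open.\<close>

definition susp :: "nat \<Rightarrow> nat \<Rightarrow> (nat \<Rightarrow> real) set \<Rightarrow> (nat \<Rightarrow> real) set" where
  "susp m l A = {x \<in> sph l. restrict x {..m} \<in> fcone m A}"

definition pad :: "nat \<Rightarrow> nat \<Rightarrow> (nat \<Rightarrow> real) \<Rightarrow> nat \<Rightarrow> real" where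
  "pad m l p = (\<lambda>i\<in>{..l}. if i \<le> m then p i else 0)"

lemma susp_Int: "susp m l (A \<inter> A') = susp m l A \<inter> susp m l A'"
  by (auto simp: susp_def fcone_Int)

lemma ip_pad: "m \<le> l \<Longrightarrow> ip l (pad m l p) x = ip m p (restrict x {..m})"
proof -
  assume "m \<le> l"
  then have "(\<Sum>i\<le>l. pad m l p i * x i) = (\<Sum>i\<le>m. p i * x i)"
    by (intro sum.mono_neutral_cong_right) (auto simp: pad_def)
  then show ?thesis by (simp add: ip_def)
qed

lemma restrict_pad: "m \<le> l \<Longrightarrow> p \<in> Rsp m \<Longrightarrow> restrict (pad m l p) {..m} = p"
  by (auto simp: pad_def Rsp_def PiE_iff extensional_def fun_eq_iff)

lemma pad_sph:
  assumes "m \<le> l" "p \<in> sph m" shows "pad m l p \<in> sph l"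
proof -
  have "ip l (pad m l p) (pad m l p) = ip m p p"
    using assms by (simp add: ip_pad restrict_pad sph_def del: ip_restrict)
  then show ?thesis using assms by (simp add: sph_def Rsp_def pad_def)
qed

lemma fcone_susp:
  assumes "m \<le> l"
  shows "fcone l (susp m l A) = {x \<in> space (Leb {..l}). restrict x {..m} \<in> fcone m A}"
proof -
  have "x \<in> fcone l (susp m l A) \<longleftrightarrow> restrict x {..m} \<in> fcone m A" if x: "x \<in> Rsp l" for x
  proof (cases "nrm {..l} x = 0")
    case True
    have "nrm {..m} (restrict x {..m}) \<le> nrm {..l} x"
    proof -
      have "nrm {..m} (restrict x {..m}) = nrm {..m} x" by (intro L2_set_cong) auto
      also have "\<dots> \<le> nrm {..l} x" unfolding L2_set_def using assms by (intro real_sqrt_le_mono sum_mono2) auto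
      finally show ?thesis .
    qed
    then show ?thesis using True by (auto simp: fcone_def)
  next
    case False
    then have N: "0 < nrm {..l} x" by (simp add: less_le)
    let ?u = "\<lambda>i\<in>{..l}. 1 / nrm {..l} x * x i"
    have "nrm {..l} ?u = 1 / nrm {..l} x * nrm {..l} x" by (rule nrm_scale) simp
    then have us: "?u \<in> sph l" using N by (simp add: sph_iff Rsp_def)
    have "x \<in> fcone l (susp m l A) \<longleftrightarrow> ?u \<in> susp m l A" using x N by (simp add: fcone_def)
    also have "\<dots> \<longleftrightarrow> restrict ?u {..m} \<in> fcone m A" using us by (simp add: susp_def)
    also have "restrict ?u {..m} = (\<lambda>i\<in>{..m}. 1 / nrm {..l} x * restrict x {..m} i)" using assms by auto
    also have "\<dots> \<in> fcone m A \<longleftrightarrow> restrict x {..m} \<in> fcone m A"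
      using N by (intro homog_scale_iff[OF homog_fcone]) (auto split: if_splits)
    finally show ?thesis .
  qed
  moreover have "fcone l (susp m l A) \<subseteq> Rsp l" by (auto simp: fcone_def)
  ultimately show ?thesis unfolding Rsp_eq[symmetric] by blast
qed

text \<open>The cone over a suspension is the cylinder over the cone, so its volume is a multiple of
  the volume below, with a factor that depends on the dimensions alone. The band with
  \<open>\<kappa> = 0\<close> and the whole space as \<open>Y\<close> supplies the formula.\<close>

lemma svol_susp:
  assumes ml: "m < l"
  obtains F where "0 < F" "\<And>A. A \<subseteq> sph m \<Longrightarrow> fcone m A \<in> sets (Leb {..m}) \<Longrightarrow> svol l (susp m l A) = F * svol m A"
proof -
  let ?Q = "{Suc m..l}" and ?P = "{..m}"
  have I: "?Q \<union> ?P = {..l}" using ml by auto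
  interpret band ?Q ?P 0 0 "space (Leb {..l})"
    by standard (use I in auto)
  let ?a = "\<integral>\<^sup>+q. wY (nrm ?Q q) \<partial>Leb ?Q"
  have BB: "B = {x \<in> space (Leb {..l}). nrm {..l} x \<le> 1}" unfolding B_def I ..
  have cyl: "{x \<in> space (Leb {..l}). restrict x ?P \<in> K} \<in> sets (Leb {..l})"
     "vol {..l} ({x \<in> space (Leb {..l}). restrict x ?P \<in> K} \<inter> B) = vol ?P {p \<in> K. nrm ?P p \<le> 1} * ?a"
    if "homog ?P K" "K \<in> sets (Leb ?P)" for K
  proof -
    have eq: "{x \<in> space (Leb {..l}). restrict x ?P \<in> K} \<inter> space (Leb {..l}) \<inter> B = {x \<in> space (Leb {..l}). restrict x ?P \<in> K} \<inter> B" by auto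
    show "{x \<in> space (Leb {..l}). restrict x ?P \<in> K} \<in> sets (Leb {..l})"
     "vol {..l} ({x \<in> space (Leb {..l}). restrict x ?P \<in> K} \<inter> B) = vol ?P {p \<in> K. nrm ?P p \<le> 1} * ?a"
      using emeasure_cylinder(1,2)[OF that] unfolding I eq by auto
  qed
  have h: "homog ?P (space (Leb ?P))" by (auto simp: homog_def space_Leb)
  have eqB: "{x \<in> space (Leb {..l}). restrict x ?P \<in> space (Leb ?P)} \<inter> B = B"
    unfolding BB by (auto simp: space_Leb)
  \<comment> \<open>Taking the full space as base computes the unit ball. Since the balls in both
    dimensions have positive finite volume, \<open>?a\<close> is positive and finite.\<close>
  have bl: "vol {..l} B = vol ?P {p \<in> space (Leb ?P). nrm ?P p \<le> 1} * ?a"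
    using cyl(2)[OF h sets.top] unfolding eqB .
  have Bpos: "vol {..l} B > 0"
  proof -
    have "vol {..l} {x \<in> space (Leb {..l}). nrm {..l} x < 1} > 0" by (rule emeasure_ball_pos) auto
    also have "vol {..l} {x \<in> space (Leb {..l}). nrm {..l} x < 1} \<le> vol {..l} B"
      unfolding BB by (intro emeasure_mono) auto
    finally show ?thesis .
  qed
  have Bfin: "vol {..l} B < \<infinity>" unfolding BB by (rule emeasure_ball_finite) simp
  have pfin: "vol ?P {p \<in> space (Leb ?P). nrm ?P p \<le> 1} < \<infinity>" by (rule emeasure_ball_finite) simp
  have a: "?a \<noteq> 0" "?a \<noteq> top"
  proof -
    show "?a \<noteq> 0" using bl Bpos by auto
    have "vol ?P {p \<in> space (Leb ?P). nrm ?P p \<le> 1} \<noteq> 0" using bl Bpos by auto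
    then show "?a \<noteq> top" using bl Bfin by (auto simp: ennreal_mult_eq_top_iff)
  qed
  define F where "F = real (l + 1) / real (m + 1) * enn2real ?a"
  have "0 < enn2real ?a" using a by (simp add: enn2real_positive_iff less_top zero_less_iff_neq_zero)
  then have "0 < F" by (simp add: F_def)
  moreover have "svol l (susp m l A) = F * svol m A" if A: "A \<subseteq> sph m" "fcone m A \<in> sets (Leb ?P)" for A
  proof -
    have fs: "fcone l (susp m l A) = {x \<in> space (Leb {..l}). restrict x ?P \<in> fcone m A}"
      using ml by (intro fcone_susp) simp
    have "svol l (susp m l A) = real (l + 1) * measure (Leb {..l}) (fcone l (susp m l A) \<inter> B)"
      unfolding BB
    proof (rule svol_eq)
      show "fcone l (susp m l A) \<in> sets (Leb {..l})" unfolding fs by (rule cyl(1)[OF homog_fcone A(2)])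
    qed (auto simp: susp_def)
    also have "\<dots> = real (l + 1) * enn2real (vol ?P {p \<in> fcone m A. nrm ?P p \<le> 1} * ?a)"
      unfolding fs measure_def cyl(2)[OF homog_fcone A(2)] ..
    also have "{p \<in> fcone m A. nrm ?P p \<le> 1} = fcone m A \<inter> {x \<in> space (Leb ?P). nrm ?P x \<le> 1}"
      by (auto simp: fcone_def Rsp_eq)
    finally show ?thesis unfolding svol_eq[OF A] F_def by (simp add: measure_def enn2real_mult)
  qed
  ultimately show ?thesis using that by blast
qed

text \<open>The projected point lies in a circular cone inside \<open>fcone m A\<close>, given by a
  strict inequality between Lipschitz functions. Since \<open>|y - x|^2 = 2 - 2 * ip l x y\<close>
  on the sphere, a small spherical ball moves the projection too little to violate it.\<close>

lemma sopen_susp: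
  assumes ml: "m \<le> l" and A: "sopen m A"
  shows "sopen l (susp m l A)"
  unfolding sopen_def
proof (intro conjI ballI)
  show "susp m l A \<subseteq> sph l" by (auto simp: susp_def)
  fix x assume x: "x \<in> susp m l A"
  let ?r = "\<lambda>x. restrict x {..m}"
  have xs: "x \<in> sph l" and xr: "?r x \<in> fcone m A" using x by (auto simp: susp_def)
  obtain u C where u: "u \<in> A" "ip m u (?r x) > C * nrm {..m} (?r x)"
      "\<forall>y\<in>Rsp m. ip m u y > C * nrm {..m} y \<longrightarrow> y \<in> fcone m A"
    using sets_fcone_open(2)[OF A xr] by auto
  have us: "nrm {..m} u = 1" using u(1) A by (auto simp: sopen_def sph_iff)
  define g where "g = ip m u (?r x) - C * nrm {..m} (?r x)"
  \<comment> \<open>\<open>1 + |C|\<close> is a Lipschitz bound for the difference of the two sides,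
    and \<open>g\<close> is the slack at \<open>x\<close>. The cap at 1 keeps
    \<open>1 - \<delta>^2 / 2\<close> in the domain of \<open>arccos\<close>.\<close>
  define \<delta> where "\<delta> = min (g / (1 + \<bar>C\<bar>)) 1"
  have \<delta>: "0 < \<delta>" "\<delta> \<le> 1" using u(2) by (auto simp: \<delta>_def g_def)
  define eps where "eps = arccos (1 - \<delta>\<^sup>2 / 2)"
  have d2: "0 < \<delta>\<^sup>2" "\<delta>\<^sup>2 \<le> 1" using \<delta> by (auto simp: power_le_one)
  have "arccos 1 < eps" unfolding eps_def using d2 by (intro arccos_less_arccos) auto
  then have eps: "0 < eps" "cos eps = 1 - \<delta>\<^sup>2 / 2" "eps \<le> pi"
    using d2 unfolding eps_def by (auto intro!: cos_arccos arccos_ubound)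
  have "sball l x eps \<subseteq> susp m l A"
  proof
    fix y assume "y \<in> sball l x eps"
    then have ys: "y \<in> sph l" and i: "1 - \<delta>\<^sup>2 / 2 < ip l x y" using sball_iff[OF xs, of eps y] eps by auto
    let ?D = "nrm {..l} (\<lambda>i. y i - x i)"
    have "?D\<^sup>2 = (\<Sum>i\<le>l. (y i - x i)\<^sup>2)" by (simp add: L2_set_def sum_nonneg)
    also have "\<dots> = (\<Sum>i\<le>l. y i * y i + x i * x i - 2 * (x i * y i))"
      by (intro sum.cong) (auto simp: power2_eq_square algebra_simps)
    also have "\<dots> = ip l y y + ip l x x - 2 * ip l x y"
      by (simp add: ip_def sum.distrib sum_subtractf sum_distrib_left)
    finally have "?D\<^sup>2 < \<delta>\<^sup>2" using i xs ys by (simp add: sph_def)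
    then have D: "?D < \<delta>" using \<delta> by (simp add: power2_less_imp_less)
    let ?d = "\<lambda>i. ?r y i - ?r x i"
    have dD: "nrm {..m} ?d \<le> ?D"
    proof -
      have "nrm {..m} ?d = nrm {..m} (\<lambda>i. y i - x i)" by (intro L2_set_cong) auto
      also have "\<dots> \<le> ?D" unfolding L2_set_def using ml by (intro real_sqrt_le_mono sum_mono2) auto
      finally show ?thesis .
    qed
    have 1: "ip m u (?r x) - ip m u (?r y) \<le> ?D"
    proof -
      have "ip m ?d u = ip m (?r y) u - ip m (?r x) u" by (rule ip_diff)
      moreover have "ip m u (?r x) = ip m (?r x) u" "ip m u (?r y) = ip m (?r y) u" by (rule ip_commute)+
      moreover have "- ip m ?d u \<le> nrm {..m} ?d * nrm {..m} u" using ip_le_nrm[of m ?d u] by linarith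
      ultimately show ?thesis using us dD by (simp only: mult_1_right)
    qed
    have 2: "\<bar>nrm {..m} (?r y) - nrm {..m} (?r x)\<bar> \<le> ?D"
    proof -
      have "nrm {..m} (?r y) = nrm {..m} (\<lambda>i. ?d i + ?r x i)" by (intro L2_set_cong) auto
      also have "\<dots> \<le> nrm {..m} ?d + nrm {..m} (?r x)" by (rule L2_set_triangle_ineq)
      finally have a: "nrm {..m} (?r y) \<le> nrm {..m} ?d + nrm {..m} (?r x)" .
      have "nrm {..m} (?r x) = nrm {..m} (\<lambda>i. (- ?d i) + ?r y i)" by (intro L2_set_cong) auto
      also have "\<dots> \<le> nrm {..m} (\<lambda>i. - ?d i) + nrm {..m} (?r y)" by (rule L2_set_triangle_ineq)
      also have "nrm {..m} (\<lambda>i. - ?d i) = nrm {..m} ?d" unfolding L2_set_def by (simp only: power2_minus)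
      finally show ?thesis using a dD by linarith
    qed
    have "C * nrm {..m} (?r y) - C * nrm {..m} (?r x) \<le> \<bar>C\<bar> * ?D"
    proof -
      have "C * nrm {..m} (?r y) - C * nrm {..m} (?r x) \<le> \<bar>C * (nrm {..m} (?r y) - nrm {..m} (?r x))\<bar>"
        by (simp add: algebra_simps)
      also have "\<dots> \<le> \<bar>C\<bar> * ?D" unfolding abs_mult using 2 by (intro mult_left_mono) auto
      finally show ?thesis .
    qed
    moreover have "(1 + \<bar>C\<bar>) * ?D < g"
    proof -
      have "(1 + \<bar>C\<bar>) * ?D < (1 + \<bar>C\<bar>) * \<delta>" using D by (intro mult_strict_left_mono) auto
      also have "\<dots> \<le> (1 + \<bar>C\<bar>) * (g / (1 + \<bar>C\<bar>))" by (intro mult_left_mono) (auto simp: \<delta>_def)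
      also have "\<dots> = g" by (simp add: add_pos_nonneg)
      finally show ?thesis .
    qed
    ultimately have "ip m u (?r y) > C * nrm {..m} (?r y)" using 1 by (simp add: g_def algebra_simps)
    moreover have "?r y \<in> Rsp m" by (simp add: Rsp_def)
    ultimately have "?r y \<in> fcone m A" using u(3) by blast
    then show "y \<in> susp m l A" using ys by (simp add: susp_def)
  qed
  then show "\<exists>e>0. sball l x e \<subseteq> susp m l A" using eps(1) by blast
qed

text \<open>Restriction to the first coordinates is linear and carries the reflection at the padded
  centre to the reflection at \<open>p\<close>, so convexity, position in the hemisphere and
  symmetry pull back from the cone over \<open>K\<close>. The neighbourhood of the centre comes from
  openness.\<close>

lemma good_set_susp:
  assumes ml: "m \<le> l" and p: "p \<in> sph m" and K: "good_set m p K"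
  shows "good_set l (pad m l p) (susp m l K)"
proof -
  let ?c = "pad m l p" and ?r = "\<lambda>x. restrict x {..m}"
  have so: "sopen m K" "gconvex m K" "K \<subseteq> sph m" and hs: "K \<subseteq> sball m p (pi/2)"
    and sy: "\<And>x. x \<in> K \<Longrightarrow> srefl m p x \<in> K" and nb: "\<exists>e>0. sball m p e \<inter> sph m \<subseteq> K"
    using K by (auto simp: good_set_def sopen_def csym_def)
  have cs: "?c \<in> sph l" by (rule pad_sph[OF ml p])
  have pos: "0 < ip m p x" if "x \<in> K" for x using that hs hemi_iff[OF p] by blast
  have cc: "convcone {..m} (fcone m K)" by (rule fcone_combine[OF so(3,2) pos])
  have op: "sopen l (susp m l K)" by (rule sopen_susp[OF ml so(1)])
  have conv: "gconvex l (susp m l K)"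
    unfolding gconvex_def gseg_def
  proof (intro ballI subsetI)
    fix x y z assume xy: "x \<in> susp m l K" "y \<in> susp m l K"
      and "z \<in> {z \<in> sph l. \<exists>a b. 0 \<le> a \<and> 0 \<le> b \<and> z = (\<lambda>i\<in>{..l}. a * x i + b * y i)}"
    then obtain a b where ab: "0 \<le> a" "0 \<le> b" and z: "z \<in> sph l" "z = (\<lambda>i\<in>{..l}. a * x i + b * y i)" by blast
    have "a + b > 0"
    proof (rule ccontr)
      assume "\<not> a + b > 0"
      then have "a = 0" "b = 0" using ab by auto
      then have "ip l z z = 0" unfolding z(2) by (simp add: ip_def)
      then show False using z(1) by (simp add: sph_def)
    qed
    then have "(\<lambda>i\<in>{..m}. a * ?r x i + b * ?r y i) \<in> fcone m K"
      using xy ab convconeD[OF cc, of "?r x" "?r y" a b] by (simp add: susp_def)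
    moreover have "?r z = (\<lambda>i\<in>{..m}. a * ?r x i + b * ?r y i)" unfolding z(2) using ml by auto
    ultimately have "?r z \<in> fcone m K" by (simp only:)
    then show "z \<in> susp m l K" using z(1) by (simp add: susp_def)
  qed
  have hemi: "susp m l K \<subseteq> sball l ?c (pi/2)"
  proof
    fix x assume x: "x \<in> susp m l K"
    then have xr: "?r x \<in> fcone m K" by (simp add: susp_def)
    obtain t u where u: "0 < t" "u \<in> K" "?r x = (\<lambda>i\<in>{..m}. t * u i)" using fconeE[OF xr] by blast
    have "ip l ?c x = ip m p (?r x)" by (rule ip_pad[OF ml])
    also have "\<dots> = t * ip m p u"
      unfolding u(3) using ip_scale[of m t u p] by (simp add: ip_commute[of m p])
    finally have "0 < ip l ?c x" using u(1) pos[OF u(2)] by simp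
    then show "x \<in> sball l ?c (pi/2)" using hemi_iff[OF cs] x by (auto simp: susp_def)
  qed
  have "p \<in> K"
  proof -
    obtain e where "e > 0" "sball m p e \<inter> sph m \<subseteq> K" using nb by blast
    moreover have "ip m p p = 1" using p by (simp add: sph_def)
    ultimately show ?thesis using p by (auto simp: sball_def sdist_def)
  qed
  then have "?c \<in> susp m l K"
  proof -
    assume pK: "p \<in> K"
    have pR: "p \<in> Rsp m" using p by (simp add: sph_def)
    have "(\<lambda>i\<in>{..m}. 1 * p i) = p" using pR by (simp add: Rsp_def PiE_restrict)
    then have "p \<in> fcone m K" using fcone_scale[OF so(3) pK, of 1] by simp
    then show ?thesis using cs unfolding susp_def by (simp add: restrict_pad[OF ml pR])
  qed
  then have nb': "\<exists>e>0. sball l ?c e \<inter> sph l \<subseteq> susp m l K"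
    using op unfolding sopen_def by (meson inf.coboundedI1)
  have refl: "srefl l ?c x \<in> susp m l K" if x: "x \<in> susp m l K" for x
  proof -
    have xs: "x \<in> sph l" and xr: "?r x \<in> fcone m K" using x by (auto simp: susp_def)
    obtain t u where u: "0 < t" "u \<in> K" "?r x = (\<lambda>i\<in>{..m}. t * u i)" using fconeE[OF xr] by blast
    have ipc: "ip l x ?c = ip m (?r x) p" using ip_pad[OF ml, of p x] by (simp add: ip_commute)
    have form: "srefl l ?c x = (\<lambda>i\<in>{..l}. (2 * ip l x ?c) * ?c i + (-1) * x i)" by (auto simp: srefl_def)
    let ?y = "srefl l ?c x"
    have ip1: "ip l ?y w = 2 * ip l x ?c * ip l ?c w - ip l x w" for w
      unfolding form ip_combine by simp
    have n: "ip l x x = 1" "ip l ?c ?c = 1" using xs cs by (simp_all add: sph_def)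
    have "ip l ?c ?y = ip l x ?c" by (subst ip_commute, subst ip1) (simp add: n)
    moreover have "ip l x ?y = 2 * ip l x ?c * ip l x ?c - 1"
      by (subst ip_commute, subst ip1, subst ip_commute[of l ?c x]) (simp add: n)
    ultimately have "ip l ?y ?y = 1" by (subst ip1) simp
    then have s: "srefl l ?c x \<in> sph l" by (simp add: sph_def Rsp_def srefl_def)
    have ipt: "ip m (?r x) p = t * ip m u p" unfolding u(3) by (simp add: ip_scale)
    have "?r (srefl l ?c x) = (\<lambda>i\<in>{..m}. 2 * (t * ip m u p) * p i - ?r x i)"
      using ml unfolding srefl_def ipc ipt by (intro ext) (auto simp: pad_def)
    also have "\<dots> = (\<lambda>i\<in>{..m}. t * srefl m p u i)"
      unfolding u(3) by (intro restrict_ext) (simp add: srefl_def algebra_simps)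
    also have "\<dots> \<in> fcone m K" by (intro fcone_scale so sy u)
    finally show ?thesis using s by (simp add: susp_def)
  qed
  show ?thesis using op conv hemi nb' refl by (simp add: good_set_def csym_def)
qed

text \<open>Suspension commutes with intersection and takes the hemisphere to the hemisphere, so all
  four volumes acquire the same factor \<open>F\<close>, and \<open>F * F\<close> cancels.\<close>

lemma SCI_of_susp:
  assumes ml: "m < l" and p: "p \<in> sph m" and K: "good_set m p K1" "good_set m p K2"
    and S: "SCI l (pad m l p) (susp m l K1) (susp m l K2)"
  shows "SCI m p K1 K2"
proof -
  obtain F where F: "0 < F" "\<And>A. A \<subseteq> sph m \<Longrightarrow> fcone m A \<in> sets (Leb {..m}) \<Longrightarrow> svol l (susp m l A) = F * svol m A"
    using svol_susp[OF ml] by blast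
  have ml': "m \<le> l" using ml by simp
  have o: "sopen m K1" "sopen m K2" using K by (auto simp: good_set_def)
  have s: "K1 \<subseteq> sph m" "K2 \<subseteq> sph m" using o by (auto simp: sopen_def)
  note c = sets_fcone_open(1)[OF o(1)] sets_fcone_open(1)[OF o(2)]
  have hcone: "fcone m (sball m p (pi/2)) = {x \<in> Rsp m. 0 < ip m p x}"
  proof -
    have "x \<in> fcone m (sball m p (pi/2)) \<longleftrightarrow> 0 < ip m p x" if x: "x \<in> Rsp m" for x
    proof (cases "nrm {..m} x = 0")
      case True
      then show ?thesis using ip_le_nrm[of m p x] by (auto simp: fcone_def)
    next
      case False
      then have N: "0 < nrm {..m} x" by (simp add: less_le)
      let ?u = "\<lambda>i\<in>{..m}. 1 / nrm {..m} x * x i"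
      have "nrm {..m} ?u = 1 / nrm {..m} x * nrm {..m} x" by (rule nrm_scale) simp
      then have us: "?u \<in> sph m" using N by (simp add: sph_iff Rsp_def)
      have "ip m p ?u = 1 / nrm {..m} x * ip m p x"
        using ip_scale[of m "1 / nrm {..m} x" x p] by (simp add: ip_commute[of m p])
      then show ?thesis using x N us hemi_iff[OF p, of ?u] by (simp add: fcone_def zero_less_divide_iff)
    qed
    then show ?thesis by (auto simp: fcone_def)
  qed
  have hm: "fcone m (sball m p (pi/2)) \<in> sets (Leb {..m})"
    unfolding hcone Rsp_eq ip_def by measurable
  have hsusp: "susp m l (sball m p (pi/2)) = sball l (pad m l p) (pi/2)"
  proof -
    have "restrict x {..m} \<in> Rsp m" for x by (simp add: Rsp_def)
    then show ?thesis
      unfolding susp_def hcone using hemi_iff[OF pad_sph[OF ml' p]] ip_pad[OF ml', of p] by auto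
  qed
  have "F * svol m (K1 \<inter> K2) * (F * svol m (sball m p (pi/2))) \<ge> F * svol m K1 * (F * svol m K2)"
  proof -
    have 1: "svol l (susp m l (K1 \<inter> K2)) = F * svol m (K1 \<inter> K2)"
      using c s by (intro F(2)) (auto simp: fcone_Int)
    have 2: "svol l (susp m l (sball m p (pi/2))) = F * svol m (sball m p (pi/2))"
      by (rule F(2)[OF _ hm]) (auto simp: sball_def)
    show ?thesis
      using S unfolding SCI_def hsusp[symmetric] susp_Int[symmetric] 1 2 F(2)[OF s(1) c(1)] F(2)[OF s(2) c(2)] .
  qed
  then have "(F * F) * (svol m K1 * svol m K2) \<le> (F * F) * (svol m (K1 \<inter> K2) * svol m (sball m p (pi/2)))"
    by (simp add: mult_ac)
  then show ?thesis using F(1) by (simp add: SCI_def)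
qed

lemma SCI_all_dimensions:
  assumes "\<forall>m\<ge>N. \<forall>p\<in>sph m. \<forall>K1 K2. good_set m p K1 \<and> good_set m p K2 \<longrightarrow> SCI m p K1 K2"
    and "p \<in> sph m" "good_set m p K1" "good_set m p K2"
  shows "SCI m p K1 K2"
proof (rule SCI_of_susp[OF _ assms(2-4)])
  \<comment> \<open>Above \<open>N\<close> to reach the hypothesis, and strictly above
    \<open>m\<close> because the suspension formula compares two different dimensions.\<close>
  let ?l = "max N (Suc m)"
  show "m < ?l" by simp
  then have "m \<le> ?l" by simp
  then show "SCI ?l (pad m ?l p) (susp m ?l K1) (susp m ?l K2)"
    using assms(1) pad_sph[OF _ assms(2)] good_set_susp[OF _ assms(2,3)] good_set_susp[OF _ assms(2,4)]
    by simp
qed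

subsection \<open>The correlation inequality\<close>

lemma SCI_hemisphere:
  assumes "X \<subseteq> sball n c (pi/2)"
  shows "SCI n c X (sball n c (pi/2))" "SCI n c (sball n c (pi/2)) X"
  using assms by (auto simp: SCI_def Int_absorb1 Int_absorb2 mult.commute)

lemma (in rotation) nrm_coord_split:
  assumes "m \<le> n + 1" "x \<in> sph n"
  shows "(nrm {..<m} (coord x))\<^sup>2 + (nrm {m..n} (coord x))\<^sup>2 = 1"
proof -
  have I: "{m..n} \<union> {..<m} = {..n}" using assms(1) by auto
  have "1 = nrm {..n} (rot (coord x))" using assms(2) rot_coord by (simp add: sph_iff)
  also have "\<dots> = nrm ({m..n} \<union> {..<m}) (coord x)" unfolding nrm_rot I ..
  also have "\<dots> = sqrt ((nrm {m..n} (coord x))\<^sup>2 + (nrm {..<m} (coord x))\<^sup>2)"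
    by (rule nrm_Un) auto
  finally show ?thesis by (simp add: add.commute)
qed

text \<open>For \<open>m = 1\<close> the component in the span is the coordinate along
  \<open>c\<close>, so within the hemisphere the ball around \<open>c\<close> is the open tube of
  the same radius around the pair of antipodes \<open>c\<close> and \<open>-c\<close>.\<close>

lemma SCI_cap:
  assumes c: "c \<in> sph n" and K: "good_set n c K" and r: "0 < r" "r \<le> pi/2"
  shows "SCI n c (sball n c r) K"
proof (cases "r = pi/2")
  case True
  show ?thesis unfolding True using K by (intro SCI_hemisphere(2)) (simp add: good_set_def)
next
  case False
  have "ONF n 1 (\<lambda>_. c)" using c by (simp add: ONF_def sph_def)
  then obtain e where e: "ONF n (n + 1) e" "e 0 = c" using ONF_extend_full[of n 1 "\<lambda>_. c"] by auto
  interpret rotation n e by standard (rule e)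
  have e0: "e 0 \<in> Rsp n" using c e by (simp add: sph_def)
  have \<kappa>: "0 \<le> cos r / sin r" using r by (intro divide_nonneg_nonneg cos_ge_zero sin_ge_zero) auto
  have "SCI n (e 0) K (sball n c r)"
  proof (rule SCI_band[where m=1, OF _ _ e0 band_bandset(2)[OF _ _ \<kappa>] homog_bandset(2)])
    fix x assume x: "x \<in> sph n"
    have i: "ip n c x = coord x 0" using x e ip_e0 by (simp add: sph_def)
    have "{..<Suc 0} = {0}" by auto
    then have P: "nrm {..<1} y = \<bar>y 0\<bar>" for y by (simp add: L2_set_def)
    have "x \<in> sball n c r \<longleftrightarrow> cos r < coord x 0" using sball_iff[OF c, of r x] x r i by simp
    also have "\<dots> \<longleftrightarrow> 0 < coord x 0 \<and> cos r < nrm {..<1} (coord x)"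
      using r cos_ge_zero[of r] unfolding P by auto
    also have "cos r < nrm {..<1} (coord x) \<longleftrightarrow> cos r / sin r * nrm {1..n} (coord x) < nrm {..<1} (coord x)"
      using nrm_coord_split[of 1 x] x r by (intro cos_le_iff_cot(2)) auto
    finally show "x \<in> sball n c r \<longleftrightarrow> coord x \<in> Hemi \<inter> bandset' n 1 (cos r / sin r)"
      using rot_Rsp(2)[of x] by (auto simp: Hemi_def bandset'_def Rsp_eq)
  qed (use K e in \<open>auto simp: sball_def\<close>)
  then show ?thesis unfolding e by (simp add: SCI_def Int_commute mult.commute)
qed

lemma (in rotation) sthick_hemi_iff:
  assumes m: "1 \<le> m" "m \<le> n + 1" and e0: "e 0 \<in> Rsp n"
    and E: "E = {x \<in> Rsp n. \<forall>j\<in>{m..n}. ip n x (e j) = 0}"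
    and eps: "0 < eps" "eps \<le> pi/2" and x: "x \<in> sph n"
  shows "x \<in> sthick n (sph n \<inter> E) eps \<inter> sball n (e 0) (pi/2) \<longleftrightarrow> coord x \<in> Hemi \<inter> bandset n m (cos eps / sin eps)"
proof -
  have "x \<in> sthick n (sph n \<inter> E) eps \<longleftrightarrow> cos eps \<le> nrm {..<m} (coord x)"
  proof -
    have "cos eps \<le> nrm {..<m} (coord x)" if "pi/2 \<le> eps"
    proof -
      have "eps = pi/2" using that eps(2) by simp
      then have "cos eps = 0" using cos_pi_half by (simp only:)
      then show ?thesis by simp
    qed
    then show ?thesis using sthick_iff[OF m e0 E x, of eps] eps by auto
  qed
  also have "\<dots> \<longleftrightarrow> cos eps / sin eps * nrm {m..n} (coord x) \<le> nrm {..<m} (coord x)"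
    using nrm_coord_split[OF m(2) x] eps by (intro cos_le_iff_cot(1)) auto
  finally have 1: "x \<in> sthick n (sph n \<inter> E) eps \<longleftrightarrow> coord x \<in> bandset n m (cos eps / sin eps)"
    using rot_Rsp(2)[of x] by (simp add: bandset_def Rsp_eq)
  have "x \<in> sball n (e 0) (pi/2) \<longleftrightarrow> coord x \<in> Hemi"
    using hemi_iff[OF e0_sph[OF e0]] x ip_e0 rot_Rsp(2)[of x] by (simp add: Hemi_def Rsp_eq sph_def)
  then show ?thesis using 1 by blast
qed

text \<open>For \<open>eps \<le> pi/2\<close> the tube is a closed band. Beyond \<open>pi/2\<close>
  it contains the whole hemisphere, where the inequality is an equality.\<close>

lemma SCI_tube:
  assumes X: "good_set n c X" and E: "lsubspace n d E" "c \<in> E" and c: "c \<in> sph n" and eps: "0 < eps"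
  shows "SCI n c X (sthick n (sph n \<inter> E) eps \<inter> sball n c (pi/2))"
proof -
  obtain m e where e: "1 \<le> m" "m \<le> n + 1" "e 0 = c" "ONF n (n + 1) e" "\<And>j. j < m \<Longrightarrow> e j \<in> E"
    and E': "E = {x \<in> Rsp n. \<forall>j\<in>{m..n}. ip n x (e j) = 0}"
    using adapted_basis[OF E c] by blast
  interpret rotation n e by standard (rule e)
  have e0: "e 0 \<in> Rsp n" using c e by (simp add: sph_def)
  show ?thesis
  proof (cases "eps \<le> pi/2")
    case True
    have \<kappa>: "0 \<le> cos eps / sin eps" using eps True by (intro divide_nonneg_nonneg cos_ge_zero sin_ge_zero) auto
    have "SCI n (e 0) X (sthick n (sph n \<inter> E) eps \<inter> sball n c (pi/2))"
      using sthick_hemi_iff[OF e(1,2) e0 E' eps True] X e(3)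
      by (intro SCI_band[OF e(1,2) e0 band_bandset(1)[OF e(1,2) \<kappa>] homog_bandset(1)[OF e(1,2)]])
         (auto simp: sthick_def)
    then show ?thesis using e(3) by simp
  next
    case False
    have "sball n c (pi/2) \<subseteq> sthick n (sph n \<inter> E) eps"
      using sthick_iff[OF e(1,2) e0 E', of _ eps] False eps by (auto simp: sball_def)
    then have "sthick n (sph n \<inter> E) eps \<inter> sball n c (pi/2) = sball n c (pi/2)" by auto
    then show ?thesis using X by (auto simp: good_set_def intro: SCI_hemisphere)
  qed
qed

lemma svol_empty: "svol n {} = 0"
  by (simp add: svol_def scone_def)

lemma svol_join_tube:
  assumes E: "lsubspace n d E" "c \<in> E" and c: "c \<in> sph n" and eps: "0 < eps" "eps \<le> pi/2"
    and X: "X \<subseteq> sph n \<inter> E" "gconvex n X" "X \<subseteq> sball n c (pi/2)" "csym n (sph n \<inter> E) c X"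
  defines "Xn \<equiv> {restrict (\<lambda>i. cos t * u i + sin t * v i) {..n} | u v t.
                       u \<in> X \<and> v \<in> sph n \<inter> orthc n E \<and> 0 \<le> t \<and> t \<le> pi/2}"
    and "Y \<equiv> sthick n (sph n \<inter> E) eps \<inter> sball n c (pi/2)"
  shows "svol n (Xn \<inter> Y) * svol n (sball n c (pi/2)) = svol n Xn * svol n Y"
proof -
  obtain m e where e: "1 \<le> m" "m \<le> n + 1" "e 0 = c" "ONF n (n + 1) e" "\<And>j. j < m \<Longrightarrow> e j \<in> E"
    and E': "E = {x \<in> Rsp n. \<forall>j\<in>{m..n}. ip n x (e j) = 0}"
    using adapted_basis[OF E c] by blast
  interpret rotation n e by standard (rule e)
  have e0: "e 0 \<in> Rsp n" using c e by (simp add: sph_def)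
  have XJ: "Xn = join X (sph n \<inter> orthc n E)" unfolding Xn_def join_def ..
  show ?thesis
  proof (cases "m \<le> n")
    case True
    have \<kappa>: "0 \<le> cos eps / sin eps" using eps by (intro divide_nonneg_nonneg cos_ge_zero sin_ge_zero) auto
    have W: "Y \<subseteq> sph n" "\<And>x. x \<in> sph n \<Longrightarrow> x \<in> Y \<longleftrightarrow> coord x \<in> Hemi \<inter> bandset n m (cos eps / sin eps)"
      using sthick_hemi_iff[OF e(1,2) e0 E' eps] e(3) by (auto simp: Y_def sthick_def)
    show ?thesis
      using join_equality[OF e(1) True e(5) E' X(1,2) _ _ W \<kappa>] X(3,4) unfolding XJ e(3) by simp
  next
    case False
    \<comment> \<open>If the adapted basis has \<open>m = n + 1\<close>, no unit vector is
      orthogonal to \<open>E\<close>; the join is then empty and both sides are 0.\<close>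
    then have "E = Rsp n" using E' by auto
    then have "sph n \<inter> orthc n E = {}" by (auto simp: orthc_def sph_def)
    then have "Xn = {}" by (simp add: XJ join_def)
    then show ?thesis by (simp add: svol_empty)
  qed
qed

theorem mainTheorem1:
  fixes n :: nat and c :: "nat \<Rightarrow> real"
  assumes "n \<ge> 2" and "c \<in> sph n"
  shows
   "(\<forall>K r. good_set n c K \<and> 0 < r \<and> r \<le> pi/2 \<longrightarrow> SCI n c (sball n c r) K)
  \<and> (\<forall>k e E Xk. 1 \<le> k \<and> k \<le> n - 1 \<and> 0 < e \<and> e \<le> pi/2 \<and>
        lsubspace n (k+1) E \<and> c \<in> E \<and>
        Xk \<subseteq> sph n \<inter> E \<and> gconvex n Xk \<and> Xk \<subseteq> sball n c (pi/2) \<and> c \<in> Xk \<and>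
        csym n (sph n \<inter> E) c Xk
      \<longrightarrow> (let Xn = {restrict (\<lambda>i. cos t * u i + sin t * v i) {..n} | u v t.
                       u \<in> Xk \<and> v \<in> sph n \<inter> orthc n E \<and> 0 \<le> t \<and> t \<le> pi/2};
              Y = sthick n (sph n \<inter> E) e \<inter> sball n c (pi/2)
          in svol n (Xn \<inter> Y) * svol n (sball n c (pi/2)) = svol n Xn * svol n Y))
  \<and> ((\<exists>N::nat. \<forall>m\<ge>N. \<forall>p\<in>sph m. \<forall>K1 K2. good_set m p K1 \<and> good_set m p K2 \<longrightarrow> SCI m p K1 K2)
      \<longrightarrow> (\<forall>m\<ge>1. \<forall>p\<in>sph m. \<forall>K1 K2. good_set m p K1 \<and> good_set m p K2 \<longrightarrow> SCI m p K1 K2))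
  \<and> (\<forall>X k E e. good_set n c X \<and> 1 \<le> k \<and> k \<le> n - 1 \<and> lsubspace n (k+1) E \<and> c \<in> E \<and> 0 < e
      \<longrightarrow> SCI n c X (sthick n (sph n \<inter> E) e \<inter> sball n c (pi/2)))"
proof (intro conjI)
  note c = assms(2)
  show "\<forall>K r. good_set n c K \<and> 0 < r \<and> r \<le> pi/2 \<longrightarrow> SCI n c (sball n c r) K"
    using SCI_cap[OF c] by blast
  show "\<forall>k e E Xk. 1 \<le> k \<and> k \<le> n - 1 \<and> 0 < e \<and> e \<le> pi/2 \<and>
        lsubspace n (k+1) E \<and> c \<in> E \<and>
        Xk \<subseteq> sph n \<inter> E \<and> gconvex n Xk \<and> Xk \<subseteq> sball n c (pi/2) \<and> c \<in> Xk \<and>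
        csym n (sph n \<inter> E) c Xk
      \<longrightarrow> (let Xn = {restrict (\<lambda>i. cos t * u i + sin t * v i) {..n} | u v t.
                       u \<in> Xk \<and> v \<in> sph n \<inter> orthc n E \<and> 0 \<le> t \<and> t \<le> pi/2};
              Y = sthick n (sph n \<inter> E) e \<inter> sball n c (pi/2)
          in svol n (Xn \<inter> Y) * svol n (sball n c (pi/2)) = svol n Xn * svol n Y)"
    unfolding Let_def by (intro allI impI svol_join_tube[OF _ _ c]; elim conjE; assumption)
  show "(\<exists>N::nat. \<forall>m\<ge>N. \<forall>p\<in>sph m. \<forall>K1 K2. good_set m p K1 \<and> good_set m p K2 \<longrightarrow> SCI m p K1 K2)
      \<longrightarrow> (\<forall>m\<ge>1. \<forall>p\<in>sph m. \<forall>K1 K2. good_set m p K1 \<and> good_set m p K2 \<longrightarrow> SCI m p K1 K2)"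
  proof (intro impI allI ballI)
    fix m p K1 K2
    assume "\<exists>N::nat. \<forall>m\<ge>N. \<forall>p\<in>sph m. \<forall>K1 K2. good_set m p K1 \<and> good_set m p K2 \<longrightarrow> SCI m p K1 K2"
      and p: "p \<in> sph m" and K: "good_set m p K1 \<and> good_set m p K2"
    then obtain N :: nat where
      "\<forall>m\<ge>N. \<forall>p\<in>sph m. \<forall>K1 K2. good_set m p K1 \<and> good_set m p K2 \<longrightarrow> SCI m p K1 K2" by blast
    from SCI_all_dimensions[OF this p] K show "SCI m p K1 K2" by blast
  qed
  show "\<forall>X k E e. good_set n c X \<and> 1 \<le> k \<and> k \<le> n - 1 \<and> lsubspace n (k+1) E \<and> c \<in> E \<and> 0 < e
      \<longrightarrow> SCI n c X (sthick n (sph n \<inter> E) e \<inter> sball n c (pi/2))"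
    using SCI_tube[OF _ _ _ c] by blast
qed

end
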